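(* Let $\mathcal{B}=(\Gamma,\mathcal{E})$ be a Brocard porism, with isodynamic points $X_{15},X_{16}$ and Beltrami points $P_2,U_2$. Recursive calculation of the anti second Brocard triangle, starting from 3-periodics of $\mathcal{B}$, produces an infinite sequence of Brocard porisms $\mathcal{B}^*,\mathcal{B}^{**},\mathcal{B}^{***},\dots$ such that: (i) the isodynamic points remain stationary at the original $X_{15}$ and $X_{16}$; (ii) the Brocard circle of each new porism is exterior to the previous one, forming a reverse infinite nesting; (iii) the sequence of porisms converges to the segment $P_2U_2$, i.e.: the major (resp. minor) semi-axis of the Brocard inellipse converges to $|P_2U_2|$ (resp. $0$); the circumradius $R$ monotonically increases and converges to infinity; and the Brocard angle $\omega$ decreases monotonically to zero.
   Context: For a triangle $T=ABC$ with vertices labelled counterclockwise, the Brocard angle $\omega$ and Brocard points $\Omega_1,\Omega_2$ are defined by $\angle\Omega_1AB=\angle\Omega_1BC=\angle\Omega_1CA=\omega$ and $\angle\Omega_2BA=\angle\Omega_2CB=\angle\Omega_2AC=\omega$. $X_3$ is the circumcenter and $X_6$ the symmedian point. The Brocard circle $\mathcal{K}$ is the circle through $X_3,\Omega_1,\Omega_2$; it has $X_3X_6$ as a diameter. The Brocard inellipse is the ellipse tangent to the three sides with foci $\Omega_1,\Omega_2$. The isodynamic points are the two common points of the three Apollonius circles of the triangle; $X_{15}$ is the one inside the circumcircle and $X_{16}$ is its inverse in the circumcircle. The Beltrami points $P_2,U_2$ are the inverses of $\Omega_1,\Omega_2$ in the circumcircle. A Brocard porism is the pair $(\Gamma,\mathcal{E})$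 of circumcircle and Brocard inellipse of a triangle; its 3-periodics are all triangles inscribed in $\Gamma$ and circumscribed about $\mathcal{E}$. All of them have the same circumradius $R$ and the same $\omega,\Omega_1,\Omega_2,X_3,X_6,X_{15},X_{16},P_2,U_2,\mathcal{K}$, so these are attributes of the porism. The second Brocard triangle $T'=A'B'C'$ of $T=ABC$: $A'$ is the intersection, other than $X_6$, of the line $AX_6$ with $\mathcal{K}$ (and $A'=X_6$ if the line is tangent to $\mathcal{K}$), similarly $B'$ and $C'$. The anti second Brocard triangle $T^*$ of $T$ is a triangle whose second Brocard triangle is $T$. $\mathcal{B}^*$ is the Brocard porism having the anti second Brocard triangles of 3-periodics of $\mathcal{B}$ as 3-periodics, $\mathcal{B}^{**}=(\mathcal{B}^* )^*$, etc.
   Formalization: The major axis (twice the major semi-axis), not the semi-axis, is shown to converge to |P2U2|, since the semi-axis tends to |P2U2|/2; porisms of equilateral triangles, which have no Brocard circle, X16, P2 or U2, are excluded. *)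

theory Defs
  imports "HOL-Analysis.Analysis"
begin

text \<open>The Euclidean plane is \<^typ>\<open>complex\<close>. A triangle is the set of its three vertices, so
  it carries no labelling; where the orientation of a labelling matters it is chosen
  explicitly (\<open>ccw\<close>). This is convenient because a counterclockwise triangle \<open>ABC\<close> has a clockwise
  second Brocard triangle \<open>A'B'C'\<close>.\<close>

definition triangle :: "complex set \<Rightarrow> bool" where
  "triangle T \<longleftrightarrow> card T = 3 \<and> \<not> collinear T"

definition equilateral :: "complex set \<Rightarrow> bool" where
  "equilateral T \<longleftrightarrow> (\<forall>A B C. T = {A, B, C} \<longrightarrow> dist A B = dist B C \<and> dist B C = dist C A)"

definition ccw :: "complex \<Rightarrow> complex \<Rightarrow> complex \<Rightarrow> bool" where
  "ccw A B C \<longleftrightarrow> Im (cnj (B - A) * (C - A)) > 0"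

text \<open>The unsigned angle \<open>PVQ\<close> at the vertex \<open>V\<close>, in \<open>[0, \<pi>]\<close>.\<close>

definition vertex_angle :: "complex \<Rightarrow> complex \<Rightarrow> complex \<Rightarrow> real" where
  "vertex_angle P V Q = \<bar>Arg ((P - V) / (Q - V))\<bar>"

definition circumcenter :: "complex set \<Rightarrow> complex" where
  "circumcenter T = (THE O'. \<exists>r. T \<subseteq> sphere O' r)"

definition circumradius :: "complex set \<Rightarrow> real" where
  "circumradius T = (THE r. \<exists>O'. T \<subseteq> sphere O' r)"

definition circumcircle :: "complex set \<Rightarrow> complex set" where
  "circumcircle T = sphere (circumcenter T) (circumradius T)"

definition inverse_in_circle :: "complex \<Rightarrow> real \<Rightarrow> complex \<Rightarrow> complex" where
  "inverse_in_circle c r P = c + (r / dist c P)\<^sup>2 *\<^sub>R (P - c)"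

definition inverse_in_circumcircle :: "complex set \<Rightarrow> complex \<Rightarrow> complex" where
  "inverse_in_circumcircle T = inverse_in_circle (circumcenter T) (circumradius T)"

text \<open>The symmedian at \<open>A\<close> is the mirror image of the median at \<open>A\<close> in the bisector of the angle
  at \<open>A\<close>. That bisector has a direction whose square is \<open>sgn (B - A) * sgn (C - A)\<close>.\<close>

definition symmedian :: "complex \<Rightarrow> complex \<Rightarrow> complex \<Rightarrow> complex set" where
  "symmedian A B C =
     (\<lambda>z. A + sgn (B - A) * sgn (C - A) * cnj (z - A)) ` (affine hull {A, midpoint B C})"

definition symmedian_point :: "complex set \<Rightarrow> complex" where
  "symmedian_point T = (THE K. \<forall>A B C. T = {A, B, C} \<longrightarrow> K \<in> symmedian A B C)"

text \<open>Since the angles are unsigned, the Brocard points are required to lie inside the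
  triangle.\<close>

definition brocard_configuration :: "complex set \<Rightarrow> real \<Rightarrow> complex \<Rightarrow> complex \<Rightarrow> bool" where
  "brocard_configuration T \<omega> P Q \<longleftrightarrow>
     P \<in> interior (convex hull T) \<and> Q \<in> interior (convex hull T) \<and>
     (\<exists>A B C. T = {A, B, C} \<and> ccw A B C \<and>
        vertex_angle P A B = \<omega> \<and> vertex_angle P B C = \<omega> \<and> vertex_angle P C A = \<omega> \<and>
        vertex_angle Q B A = \<omega> \<and> vertex_angle Q C B = \<omega> \<and> vertex_angle Q A C = \<omega>)"

definition brocard_angle :: "complex set \<Rightarrow> real" where
  "brocard_angle T = (THE \<omega>. \<exists>P Q. brocard_configuration T \<omega> P Q)"

definition brocard_point1 :: "complex set \<Rightarrow> complex" where
  "brocard_point1 T = (THE P. \<exists>\<omega> Q. brocard_configuration T \<omega> P Q)"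

definition brocard_point2 :: "complex set \<Rightarrow> complex" where
  "brocard_point2 T = (THE Q. \<exists>\<omega> P. brocard_configuration T \<omega> P Q)"

text \<open>The circle through the circumcenter and the two Brocard points. These three points are
  noncollinear unless the triangle is equilateral, in which case they coincide.\<close>

definition brocard_circle :: "complex set \<Rightarrow> complex set" where
  "brocard_circle T = circumcircle {circumcenter T, brocard_point1 T, brocard_point2 T}"

text \<open>Foci \<open>F1\<close>, \<open>F2\<close> and major semi-axis \<open>a\<close>; it is a nondegenerate ellipse iff
  \<open>dist F1 F2 < 2 * a\<close>.\<close>

definition ellipse :: "complex \<Rightarrow> complex \<Rightarrow> real \<Rightarrow> complex set" where
  "ellipse F1 F2 a = {P. dist P F1 + dist P F2 = 2 * a}"

definition major_semiaxis :: "complex set \<Rightarrow> real" where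
  "major_semiaxis E = (THE a. \<exists>F1 F2. dist F1 F2 < 2 * a \<and> E = ellipse F1 F2 a)"

definition minor_semiaxis :: "complex set \<Rightarrow> real" where
  "minor_semiaxis E = (THE b. \<exists>F1 F2 a. dist F1 F2 < 2 * a \<and> E = ellipse F1 F2 a \<and>
                              b = sqrt (a\<^sup>2 - (dist F1 F2 / 2)\<^sup>2))"

text \<open>A line is tangent to a nondegenerate ellipse iff it meets the ellipse in exactly one point;
  here this point must lie on the side itself, not only on its extension.\<close>

definition circumscribed_about :: "complex set \<Rightarrow> complex set \<Rightarrow> bool" where
  "circumscribed_about T E \<longleftrightarrow>
     (\<forall>A\<in>T. \<forall>B\<in>T. A \<noteq> B \<longrightarrow> (\<exists>P\<in>closed_segment A B. affine hull {A, B} \<inter> E = {P}))"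

definition brocard_inellipse :: "complex set \<Rightarrow> complex set" where
  "brocard_inellipse T =
     (THE E. (\<exists>a. dist (brocard_point1 T) (brocard_point2 T) < 2 * a \<and>
                  E = ellipse (brocard_point1 T) (brocard_point2 T) a) \<and>
             circumscribed_about T E)"

text \<open>The \<open>A\<close>-Apollonius circle: the points whose distances to \<open>B\<close> and \<open>C\<close> are in the ratio
  \<open>AB : AC\<close>. If \<open>AB = AC\<close> it degenerates to the perpendicular bisector of \<open>BC\<close>.\<close>

definition apollonius_circle :: "complex \<Rightarrow> complex \<Rightarrow> complex \<Rightarrow> complex set" where
  "apollonius_circle A B C = {P. dist P B * dist A C = dist P C * dist A B}"

definition isodynamic_point1 :: "complex set \<Rightarrow> complex" where
  "isodynamic_point1 T =
     (THE P. P \<in> ball (circumcenter T) (circumradius T) \<and>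
             (\<forall>A B C. T = {A, B, C} \<longrightarrow> P \<in> apollonius_circle A B C))"

definition isodynamic_point2 :: "complex set \<Rightarrow> complex" where
  "isodynamic_point2 T = inverse_in_circumcircle T (isodynamic_point1 T)"

definition beltrami_point1 :: "complex set \<Rightarrow> complex" where
  "beltrami_point1 T = inverse_in_circumcircle T (brocard_point1 T)"

definition beltrami_point2 :: "complex set \<Rightarrow> complex" where
  "beltrami_point2 T = inverse_in_circumcircle T (brocard_point2 T)"

definition second_brocard_vertex :: "complex set \<Rightarrow> complex \<Rightarrow> complex" where
  "second_brocard_vertex T A =
     (let K = symmedian_point T; S = affine hull {A, K} \<inter> brocard_circle T
      in if S = {K} then K else (THE P. P \<in> S \<and> P \<noteq> K))"

definition second_brocard_triangle :: "complex set \<Rightarrow> complex set" where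
  "second_brocard_triangle T = second_brocard_vertex T ` T"

text \<open>An equilateral triangle has no Brocard circle, hence no second Brocard triangle.\<close>

definition is_anti_second_brocard :: "complex set \<Rightarrow> complex set \<Rightarrow> bool" where
  "is_anti_second_brocard T' T \<longleftrightarrow>
     triangle T' \<and> \<not> equilateral T' \<and> second_brocard_triangle T' = T"

type_synonym porism = "complex set \<times> complex set"

text \<open>Equilateral triangles are excluded: for them the Brocard circle, the second isodynamic point
  and the Beltrami points do not exist.\<close>

definition brocard_porism :: "porism \<Rightarrow> bool" where
  "brocard_porism \<B> \<longleftrightarrow>
     (\<exists>T. triangle T \<and> \<not> equilateral T \<and> \<B> = (circumcircle T, brocard_inellipse T))"

definition three_periodics :: "porism \<Rightarrow> complex set set" where
  "three_periodics \<B> = {T. triangle T \<and> T \<subseteq> fst \<B> \<and> circumscribed_about T (snd \<B>)}"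

text \<open>The common value of \<open>f\<close> on all 3-periodics.\<close>

definition porism_attribute :: "(complex set \<Rightarrow> 'a) \<Rightarrow> porism \<Rightarrow> 'a" where
  "porism_attribute f \<B> = (THE x. \<forall>T\<in>three_periodics \<B>. f T = x)"

definition is_anti_porism :: "porism \<Rightarrow> porism \<Rightarrow> bool" where
  "is_anti_porism \<B>' \<B> \<longleftrightarrow> brocard_porism \<B>' \<and>
     three_periodics \<B>' = {T'. \<exists>T\<in>three_periodics \<B>. is_anti_second_brocard T' T}"

text \<open>The sequence of iterated anti porisms, with the given one at index 0.\<close>

definition anti_porism_sequence :: "porism \<Rightarrow> (nat \<Rightarrow> porism) \<Rightarrow> bool" where
  "anti_porism_sequence \<B> s \<longleftrightarrow> s 0 = \<B> \<and> (\<forall>n. is_anti_porism (s (Suc n)) (s n))"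

text \<open>Convergence in the Hausdorff metric (for nonempty compact sets).\<close>

definition hausdorff_converges :: "(nat \<Rightarrow> complex set) \<Rightarrow> complex set \<Rightarrow> bool" where
  "hausdorff_converges X L \<longleftrightarrow>
     (\<forall>e>0. \<forall>\<^sub>F n in sequentially. X n \<subseteq> (\<Union>x\<in>L. ball x e) \<and> L \<subseteq> (\<Union>x\<in>X n. ball x e))"

end

theory Submission
  imports Defs
begin

text \<open>Put \<open>mob a b w = b + a * (1 + w) / (1 - w)\<close>. Every non-equilateral triangle is the image \<open>tri a b t\<close>
  under \<open>mob a b\<close> of an equilateral triangle \<open>t, t * zeta, t * zeta\<^sup>2\<close> with \<open>0 < norm t < 1\<close>, where
  \<open>zeta\<close> is a primitive cube root of unity. In these coordinates the isodynamic points are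
  \<open>mob a b 0 = b + a\<close> and \<open>mob a b\<close> of infinity, that is \<open>b - a\<close>; the Brocard points are the images of
  \<open>(norm t)\<^sup>2 * zeta\<^sup>2\<close> and \<open>(norm t)\<^sup>2 * zeta\<close>, so the Beltrami points are the images of \<open>zeta\<^sup>2\<close> and
  \<open>zeta\<close>; the Brocard circle is the image of the circle of radius \<open>(norm t)\<^sup>2\<close>; and the second Brocard
  triangle of \<open>tri a b t\<close> is \<open>tri a b (t\<^sup>2)\<close>. A Brocard porism consists of all \<open>tri a b t\<close> with
  \<open>norm t = r\<close>, so passing to anti second Brocard triangles keeps \<open>a\<close> and \<open>b\<close> and replaces \<open>r\<close> by
  \<open>sqrt r\<close>. The \<open>n\<close>-th porism has the parameter \<open>root (2 ^ n) r\<close>, which increases to \<open>1\<close>, and all limits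
  are read off from explicit formulas.\<close>

section \<open>The Moebius parametrisation\<close>

text \<open>The coordinates are adapted to the invariants of the iteration: the Apollonius circles
  meet in the isodynamic points, and sending these to 0 and infinity makes the triangle equilateral
  and its coaxal family of circles concentric. The parameter \<open>w = 1\<close> stands for the
  point at infinity, so the centre of \<open>apo a b r\<close> is the image of its reflection
  \<open>r\<^sup>2\<close> in the circle \<open>norm w = r\<close>. The unit circle corresponds to
  the line through \<open>b\<close> perpendicular to the direction of \<open>a\<close>; this line
  carries the Beltrami points, and the inellipses flatten onto it as \<open>r\<close> tends to 1.

  The obstacle is that \<open>mob a b\<close> respects circles, angles and inversion but neither
  lines nor ellipses. Symmedians are therefore computed through squared side lengths and the power
  of a point, and tangency to the inellipse is carried over by a second, projective map that agrees
  with \<open>mob a b\<close> on one circle. Moreover most notions are definite descriptions over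
  unlabelled triangles, so each formula needs existence and uniqueness, checked against every
  labelling.\<close>

lemma three_eq_insert_cases:
  assumes "{A, B, C} = {X, Y, Z}" "X \<noteq> Y" "Y \<noteq> Z" "Z \<noteq> X"
  shows "(A = X \<and> B = Y \<and> C = Z) \<or> (A = Y \<and> B = Z \<and> C = X) \<or> (A = Z \<and> B = X \<and> C = Y) \<or>
         (A = X \<and> B = Z \<and> C = Y) \<or> (A = Y \<and> B = X \<and> C = Z) \<or> (A = Z \<and> B = Y \<and> C = X)"
proof -
  have "A \<in> {X, Y, Z}" "B \<in> {X, Y, Z}" "C \<in> {X, Y, Z}" "X \<in> {A, B, C}" "Y \<in> {A, B, C}" "Z \<in> {A, B, C}"
    using assms(1) by blast+
  then show ?thesis using assms(2-) by auto
qed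

lemma card3_iff: "card {A, B, C} = 3 \<longleftrightarrow> A \<noteq> B \<and> B \<noteq> C \<and> C \<noteq> A"
  by (auto simp: card_insert_if)

lemma of_real_norm_sq: "(complex_of_real (norm z))\<^sup>2 = z * cnj z"
  using complex_norm_square[of z] by simp

lemma sq_less_iff: "0 \<le> x \<Longrightarrow> 0 \<le> y \<Longrightarrow> x\<^sup>2 < y\<^sup>2 \<longleftrightarrow> x < (y::real)"
  using power_mono_iff[of y x 2] by (simp add: not_le[symmetric])

text \<open>The difference of the squared distances to \<open>P\<close> and \<open>Q\<close> is an
  affine function of the point and constant on \<open>T\<close>, so \<open>T\<close> lies on a line
  perpendicular to \<open>Q - P\<close>.\<close>

lemma collinear_sphere_centers:
  fixes T :: "complex set"
  assumes "T \<subseteq> sphere P r" "T \<subseteq> sphere Q s" "P \<noteq> Q"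
  shows "collinear T"
proof -
  have *: "Re (cnj (Q - P) * x) = Re (cnj (Q - P) * y)" if "x \<in> T" "y \<in> T" for x y
  proof -
    have e: "(dist P z)\<^sup>2 - (dist Q z)\<^sup>2 = 2 * Re (cnj (Q - P) * z) + (norm P)\<^sup>2 - (norm Q)\<^sup>2" for z
      unfolding dist_norm cmod_power2 by (simp add: power2_eq_square algebra_simps)
    have "dist P x = r" "dist Q x = s" "dist P y = r" "dist Q y = s" using assms that by auto
    then show ?thesis using e[of x] e[of y] by simp
  qed
  show ?thesis unfolding collinear_def
  proof (rule exI[of _ "\<i> * (Q - P)"], intro ballI)
    fix x y assume "x \<in> T" "y \<in> T"
    from *[OF this] have 0: "Re (cnj (Q - P) * (x - y)) = 0" by (simp add: algebra_simps)
    define k where "k = Im (cnj (Q - P) * (x - y)) / (norm (Q - P))\<^sup>2"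
    have n: "(norm (Q - P))\<^sup>2 \<noteq> 0" using assms by simp
    have "cnj (Q - P) * (x - y) = of_real (k * (norm (Q - P))\<^sup>2) * \<i>"
      using 0 n by (simp add: complex_eq_iff k_def)
    also have "\<dots> = cnj (Q - P) * (k *\<^sub>R (\<i> * (Q - P)))"
      by (simp only: of_real_mult complex_norm_square scaleR_conv_of_real ac_simps)
    finally show "\<exists>c. x - y = c *\<^sub>R (\<i> * (Q - P))" using assms(3)
      by (metis complex_cnj_zero_iff mult_left_cancel right_minus_eq)
  qed
qed

text \<open>Two circles through \<open>T\<close> share their centre, since otherwise
  \<open>T\<close> would be collinear. One circle through \<open>T\<close> therefore settles the
  definite descriptions behind \<open>circumcenter\<close> and \<open>circumradius\<close>.\<close>

lemma circumcenter_radius_unique: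
  assumes "T \<subseteq> sphere P r" "\<not> collinear T"
  shows "circumcenter T = P" "circumradius T = r" "circumcircle T = sphere P r"
proof -
  have u: "Q = P \<and> s = r" if "T \<subseteq> sphere Q s" for Q s
  proof -
    have 1: "Q = P" using collinear_sphere_centers[OF that assms(1)] assms(2) by blast
    obtain x where "x \<in> T" using assms(2) by (metis collinear_empty all_not_in_conv)
    then have "dist P x = r" "dist Q x = s" using that assms(1) by auto
    then show ?thesis using 1 by simp
  qed
  show c: "circumcenter T = P" unfolding circumcenter_def
    by (rule the_equality) (use u assms in blast)+
  show d: "circumradius T = r" unfolding circumradius_def
    by (rule the_equality) (use u assms in blast)+
  show "circumcircle T = sphere P r" by (simp add: circumcircle_def c d)
qed

text \<open>\<open>Im (cnj (B - A) * (C - A))\<close> is twice the signed area of the triangle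
  \<open>A\<close>, \<open>B\<close>, \<open>C\<close>; collinearity, orientation and interior
  points are all read off from it. If it vanishes and \<open>B \<noteq> A\<close>, then
  \<open>C - A\<close> is a real multiple of \<open>B - A\<close>.\<close>

lemma Im_cnj_mult_eq_0_imp_collinear:
  fixes A B C :: complex
  assumes "Im (cnj (B - A) * (C - A)) = 0"
  shows "collinear {A, B, C}"
proof (cases "B = A")
  case False
  define k where "k = Re (cnj (B - A) * (C - A)) / (norm (B - A))\<^sup>2"
  have n: "(norm (B - A))\<^sup>2 \<noteq> 0" using False by simp
  have "cnj (B - A) * (C - A) = of_real (k * (norm (B - A))\<^sup>2)"
    using assms n by (simp add: complex_eq_iff k_def)
  also have "\<dots> = cnj (B - A) * (k *\<^sub>R (B - A))"
    by (simp only: of_real_mult complex_norm_square scaleR_conv_of_real ac_simps)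
  finally have "C - A = k *\<^sub>R (B - A)" using False
      by (metis complex_cnj_zero_iff mult_left_cancel right_minus_eq)
  then have "C = (1 - k) *\<^sub>R A + k *\<^sub>R B" by (simp add: algebra_simps)
  then have "collinear {A, C, B}" unfolding collinear_3_expand by (intro disjI2 exI[of _ "1 - k"]) simp
  then show ?thesis by (simp add: insert_commute)
qed simp

lemma collinear_imp_Im_cnj_mult_eq_0:
  fixes A B C :: complex
  assumes "collinear {A, B, C}"
  shows "Im (cnj (B - A) * (C - A)) = 0"
proof -
  obtain u where u: "\<And>x y. x \<in> {A,B,C} \<Longrightarrow> y \<in> {A,B,C} \<Longrightarrow> \<exists>c. x - y = c *\<^sub>R u"
    using assms unfolding collinear_def by blast
  obtain c d where "B - A = c *\<^sub>R u" "C - A = d *\<^sub>R u" using u by (metis insert_iff)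
  then show ?thesis by (simp add: scaleR_conv_of_real)
qed

lemma collinear_iff_Im: "collinear {A, B, C} \<longleftrightarrow> Im (cnj (B - A) * (C - A)) = 0"
  using Im_cnj_mult_eq_0_imp_collinear collinear_imp_Im_cnj_mult_eq_0 by blast

section \<open>The primitive cube root of unity\<close>

definition zeta :: complex where "zeta = Complex (-1/2) (sqrt 3 / 2)"

lemma zeta_sq: "zeta\<^sup>2 = cnj zeta"
  by (simp add: zeta_def complex_eq_iff power2_eq_square)

lemma cnj_zeta: "cnj zeta = - 1 - zeta"
  by (simp add: zeta_def complex_eq_iff)

lemma zeta_mult_zeta: "zeta * zeta = - 1 - zeta"
  using zeta_sq cnj_zeta by (simp add: power2_eq_square)

text \<open>The nested form lets rewriting reduce powers of \<open>zeta\<close> inside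
  right-associated products as well.\<close>

lemma zeta_mult_zeta_mult: "zeta * (zeta * x) = - x - zeta * x"
  by (simp add: mult.assoc[symmetric] zeta_mult_zeta algebra_simps)

lemma zeta_cube: "zeta ^ 3 = 1"
  by (simp add: power3_eq_cube zeta_mult_zeta algebra_simps)

lemma norm_zeta [simp]: "norm zeta = 1"
  by (simp add: zeta_def cmod_def power2_eq_square)

lemma norm_zeta_sub_1: "norm (zeta - 1) = sqrt 3" "norm (1 - zeta) = sqrt 3"
  by (simp_all add: zeta_def cmod_def power2_eq_square)

lemma zeta_neq_1: "zeta \<noteq> 1" by (simp add: zeta_def complex_eq_iff)

lemma zeta_neq_0: "zeta \<noteq> 0" by (simp add: zeta_def complex_eq_iff)

text \<open>The pole is \<open>w = 1\<close>, where division by zero returns \<open>b\<close>, a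
  value also taken at \<open>w = -1\<close>; hence the side conditions \<open>w \<noteq> 1\<close>
  in what follows.\<close>

definition mob :: "complex \<Rightarrow> complex \<Rightarrow> complex \<Rightarrow> complex" where
  "mob a b w = b + a * (1 + w) / (1 - w)"

lemma mob_diff:
  assumes "w \<noteq> 1" "z \<noteq> 1"
  shows "mob a b w - mob a b z = 2 * a * (w - z) / ((1 - w) * (1 - z))"
  using assms by (simp add: mob_def divide_simps) (simp add: algebra_simps)

lemma dist_mob:
  assumes "w \<noteq> 1" "z \<noteq> 1"
  shows "dist (mob a b w) (mob a b z) = 2 * norm a * dist w z / (norm (1 - w) * norm (1 - z))"
  using assms by (simp add: dist_norm mob_diff norm_mult norm_divide)

lemma mob_inj:
  assumes "w \<noteq> 1" "z \<noteq> 1" "a \<noteq> 0" "mob a b w = mob a b z"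
  shows "w = z"
  using mob_diff[OF assms(1,2), of a b] assms by simp

lemma mob_surj:
  assumes "P \<noteq> b - a" "a \<noteq> 0"
  shows "\<exists>w. w \<noteq> 1 \<and> P = mob a b w"
proof (intro exI conjI)
  \<comment> \<open>The inverse Moebius transformation. Its pole \<open>P = b - a\<close> is the
    image of infinity and has no parameter.\<close>
  let ?w = "(P - b - a) / (P - b + a)"
  have n: "P - b + a \<noteq> 0" using assms(1) by (auto simp: algebra_simps)
  have 1: "1 - ?w = 2 * a / (P - b + a)" "1 + ?w = 2 * (P - b) / (P - b + a)"
    using n by (simp_all add: field_simps)
  show "?w \<noteq> 1" using 1 n assms by auto
  have "a * (1 + ?w) / (1 - ?w) = P - b" unfolding 1 using n assms(2) by simp
  then show "P = mob a b ?w" by (simp add: mob_def)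
qed

text \<open>The image \<open>apo a b r\<close> of the circle \<open>norm w = r\<close>, a member of the Apollonian pencil with limit
  points \<open>b + a\<close> and \<open>b - a\<close>.\<close>

definition apo_radius :: "complex \<Rightarrow> real \<Rightarrow> real" where
  "apo_radius a r = norm a * (2 * r / (1 - r\<^sup>2))"

definition apo :: "complex \<Rightarrow> complex \<Rightarrow> real \<Rightarrow> complex set" where
  "apo a b r = sphere (mob a b (of_real (r\<^sup>2))) (apo_radius a r)"

lemma of_real_sq_neq_1: "0 < r \<Longrightarrow> r < 1 \<Longrightarrow> (of_real (r\<^sup>2) :: complex) \<noteq> 1"
  by (metis of_real_eq_1_iff power2_eq_1_iff not_less_iff_gr_or_eq less_trans zero_less_one
      neg_less_0_iff_less order.asym)

lemma one_minus_sq_pos: "0 < r \<Longrightarrow> r < 1 \<Longrightarrow> 0 < 1 - (r::real)\<^sup>2"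
  by (simp add: power_less_one_iff)

lemma norm_less_1_neq: "norm (w::complex) < 1 \<Longrightarrow> w \<noteq> 1" by auto

text \<open>Squaring the distances makes the power of a point factor: for nonzero \<open>a\<close>
  it is a positive multiple of \<open>(norm w)\<^sup>2 - r\<^sup>2\<close>, so its sign decides
  between the circle, its inside and its outside.\<close>

lemma apo_power:
  assumes r: "0 < r" "r < 1" and w: "w \<noteq> 1"
  shows "(dist (mob a b w) (mob a b (of_real (r\<^sup>2))))\<^sup>2 - (apo_radius a r)\<^sup>2
     = 4 * (norm a)\<^sup>2 * ((norm w)\<^sup>2 - r\<^sup>2) / ((norm (1 - w))\<^sup>2 * (1 - r\<^sup>2))"
proof -
  have p: "1 - r\<^sup>2 > 0" by (rule one_minus_sq_pos[OF r])
  have n: "norm (1 - of_real (r\<^sup>2) :: complex) = 1 - r\<^sup>2"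
    using p by (metis abs_of_pos norm_of_real of_real_1 of_real_diff)
  have e: "(norm (w - of_real (r\<^sup>2)))\<^sup>2 - r\<^sup>2 * (norm (1 - w))\<^sup>2 = ((norm w)\<^sup>2 - r\<^sup>2) * (1 - r\<^sup>2)"
    unfolding cmod_power2 by (simp add: power2_eq_square algebra_simps)
  have q: "norm (1 - w) > 0" using w by simp
  have "(dist (mob a b w) (mob a b (of_real (r\<^sup>2))))\<^sup>2 - (apo_radius a r)\<^sup>2
    = 4 * (norm a)\<^sup>2 * ((norm (w - of_real (r\<^sup>2)))\<^sup>2 - r\<^sup>2 * (norm (1 - w))\<^sup>2) / ((norm (1 - w))\<^sup>2 * (1 - r\<^sup>2)\<^sup>2)"
    unfolding dist_mob[OF w of_real_sq_neq_1[OF r]] n apo_radius_def using p q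
    by (simp add: dist_norm divide_simps) (simp add: power2_eq_square algebra_simps)
  also have "\<dots> = 4 * (norm a)\<^sup>2 * ((norm w)\<^sup>2 - r\<^sup>2) / ((norm (1 - w))\<^sup>2 * (1 - r\<^sup>2))"
    unfolding e using p q by (simp add: power2_eq_square)
  finally show ?thesis .
qed

lemma apo_radius_pos: "0 < r \<Longrightarrow> r < 1 \<Longrightarrow> a \<noteq> 0 \<Longrightarrow> 0 < apo_radius a r"
  using one_minus_sq_pos by (simp add: apo_radius_def)

text \<open>The image of infinity has no parameter, so the criteria in terms of
  \<open>norm w\<close> do not reach it. Its distance from the centre shows separately that it lies
  outside the circle.\<close>

lemma minus_diff_center:
  assumes r: "0 < r" "r < 1"
  shows "dist (b - a) (mob a b (of_real (r\<^sup>2))) = norm a * (2 / (1 - r\<^sup>2))"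
proof -
  have p: "1 - r\<^sup>2 > 0" by (rule one_minus_sq_pos[OF r])
  have "b - a - mob a b (of_real (r\<^sup>2)) = - a * of_real (2 / (1 - r\<^sup>2))"
    using of_real_sq_neq_1[OF r] by (simp add: mob_def divide_simps) (simp add: algebra_simps)
  then have "dist (b - a) (mob a b (of_real (r\<^sup>2))) = norm a * \<bar>2 / (1 - r\<^sup>2)\<bar>"
    by (simp only: dist_norm norm_mult norm_minus_cancel norm_of_real)
  then show ?thesis using p by simp
qed

lemma mob_in_cball_iff:
  assumes r: "0 < r" "r < 1" and w: "w \<noteq> 1" and a: "a \<noteq> 0"
  shows "dist (mob a b w) (mob a b (of_real (r\<^sup>2))) = apo_radius a r \<longleftrightarrow> norm w = r"
    and "dist (mob a b w) (mob a b (of_real (r\<^sup>2))) < apo_radius a r \<longleftrightarrow> norm w < r"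
proof -
  have p: "1 - r\<^sup>2 > 0" by (rule one_minus_sq_pos[OF r])
  have q: "4 * (norm a)\<^sup>2 / ((norm (1 - w))\<^sup>2 * (1 - r\<^sup>2)) > 0" (is "?k > 0") using p w a by simp
  have e: "(dist (mob a b w) (mob a b (of_real (r\<^sup>2))))\<^sup>2 - (apo_radius a r)\<^sup>2 = ?k * ((norm w)\<^sup>2 - r\<^sup>2)"
    using apo_power[OF r w] by simp
  have R: "apo_radius a r > 0" using apo_radius_pos r a by blast
  have "dist (mob a b w) (mob a b (of_real (r\<^sup>2))) = apo_radius a r \<longleftrightarrow>
     (dist (mob a b w) (mob a b (of_real (r\<^sup>2))))\<^sup>2 - (apo_radius a r)\<^sup>2 = 0"
    using R by simp
  also have "\<dots> \<longleftrightarrow> norm w = r" unfolding e using p a w r by auto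
  finally show "dist (mob a b w) (mob a b (of_real (r\<^sup>2))) = apo_radius a r \<longleftrightarrow> norm w = r" .
  have "dist (mob a b w) (mob a b (of_real (r\<^sup>2))) < apo_radius a r \<longleftrightarrow>
     (dist (mob a b w) (mob a b (of_real (r\<^sup>2))))\<^sup>2 - (apo_radius a r)\<^sup>2 < 0"
    unfolding less_iff_diff_less_0[symmetric] using R by (intro sq_less_iff[symmetric]) auto
  also have "\<dots> \<longleftrightarrow> (norm w)\<^sup>2 < r\<^sup>2" unfolding e using q by (simp only: mult_less_0_iff) auto
  also have "\<dots> \<longleftrightarrow> norm w < r" using r by (intro sq_less_iff) auto
  finally show "dist (mob a b w) (mob a b (of_real (r\<^sup>2))) < apo_radius a r \<longleftrightarrow> norm w < r" .
qed

lemma apo_eq_image: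
  assumes r: "0 < r" "r < 1" and a: "a \<noteq> 0"
  shows "apo a b r = mob a b ` {w. norm w = r}"
proof (intro equalityI subsetI)
  fix P assume P: "P \<in> apo a b r"
  have "P \<noteq> b - a"
  proof
    assume "P = b - a"
    then have "norm a * (2 / (1 - r\<^sup>2)) = apo_radius a r" using P minus_diff_center[OF r, of b a]
      by (simp add: apo_def dist_commute)
    then show False using a r one_minus_sq_pos[OF r] by (simp add: apo_radius_def)
  qed
  then obtain w where w: "w \<noteq> 1" "P = mob a b w" using mob_surj a by blast
  then show "P \<in> mob a b ` {w. norm w = r}" using P mob_in_cball_iff(1)[OF r w(1) a]
    by (auto simp: apo_def dist_commute)
next
  fix P assume "P \<in> mob a b ` {w. norm w = r}"
  then obtain w where w: "norm w = r" "P = mob a b w" by auto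
  then have "w \<noteq> 1" using r by auto
  then show "P \<in> apo a b r" using w mob_in_cball_iff(1)[OF r _ a]
    by (auto simp: apo_def dist_commute)
qed

section \<open>Triangles whose parameters are equilateral\<close>

definition tri :: "complex \<Rightarrow> complex \<Rightarrow> complex \<Rightarrow> complex set" where
  "tri a b t = {mob a b t, mob a b (t * zeta), mob a b (t * zeta\<^sup>2)}"

text \<open>A point strictly between two points of a sphere is strictly closer to the centre, so
  none of the three can lie between the other two.\<close>

lemma sphere_three_noncollinear:
  fixes A B C :: complex
  assumes "{A, B, C} \<subseteq> sphere c r" "A \<noteq> B" "B \<noteq> C" "C \<noteq> A"
  shows "\<not> collinear {A, B, C}"
proof
  assume "collinear {A, B, C}"
  then have "between (A,B) C \<or> between (B,C) A \<or> between (C,A) B"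
    by (metis collinear_between_cases)
  moreover have no: "\<not> between (X, Y) Z" if "X \<in> sphere c r" "Y \<in> sphere c r" "Z \<in> sphere c r" "Z \<noteq> X" "Z \<noteq> Y" "X \<noteq> Y" for X Y Z
  proof
    assume "between (X, Y) Z"
    then have "Z \<in> open_segment X Y" using that by (simp add: between_mem_segment open_segment_def)
    then have "dist c Z < max (dist c X) (dist c Y)" using that(6)
      using dist_decreases_open_segment[of Z X Y c] by linarith
    then show False using that by simp
  qed
  ultimately show False using assms no[of A B C] no[of B C A] no[of C A B] by auto
qed

lemma tri_vertices_neq:
  assumes "t \<noteq> 0" "norm t < 1" "a \<noteq> 0"
  shows "mob a b t \<noteq> mob a b (t * zeta)" "mob a b (t * zeta) \<noteq> mob a b (t * zeta\<^sup>2)"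
    "mob a b (t * zeta\<^sup>2) \<noteq> mob a b t"
proof -
  \<comment> \<open>Replacing \<open>t\<close> by \<open>t * zeta\<close> permutes the vertices
    cyclically, so one pair is enough.\<close>
  have *: "mob a b t \<noteq> mob a b (t * zeta)" if "t \<noteq> 0" "norm t < 1" for t
    using mob_inj[of t "t * zeta" a b] that assms zeta_neq_1 norm_less_1_neq[of t] norm_less_1_neq[of "t * zeta"]
    by (auto simp: norm_mult)
  show "mob a b t \<noteq> mob a b (t * zeta)" using * assms by blast
  show "mob a b (t * zeta) \<noteq> mob a b (t * zeta\<^sup>2)" using *[of "t * zeta"] assms zeta_neq_0
    by (simp add: norm_mult power2_eq_square mult.assoc)
  show "mob a b (t * zeta\<^sup>2) \<noteq> mob a b t" using *[of "t * zeta\<^sup>2"] assms zeta_neq_0 zeta_cube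
    by (simp add: norm_mult norm_power power2_eq_square power3_eq_cube mult.assoc)
qed

lemma tri_subset_apo:
  assumes "t \<noteq> 0" "norm t < 1" "a \<noteq> 0"
  shows "tri a b t \<subseteq> apo a b (norm t)"
  using assms by (auto simp: apo_eq_image tri_def norm_mult norm_power)

lemma triangle_tri:
  assumes "t \<noteq> 0" "norm t < 1" "a \<noteq> 0"
  shows "triangle (tri a b t)" "card (tri a b t) = 3" "\<not> collinear (tri a b t)"
proof -
  show c: "card (tri a b t) = 3" unfolding tri_def card3_iff using tri_vertices_neq[OF assms] by simp
  show d: "\<not> collinear (tri a b t)" unfolding tri_def
    by (rule sphere_three_noncollinear[OF tri_subset_apo[OF assms, unfolded tri_def apo_def]])
      (use tri_vertices_neq[OF assms] in auto)
  show "triangle (tri a b t)" using c d by (simp add: triangle_def)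
qed

lemma circumcircle_tri:
  assumes "t \<noteq> 0" "norm t < 1" "a \<noteq> 0"
  shows "circumcenter (tri a b t) = mob a b (of_real ((norm t)\<^sup>2))"
    "circumradius (tri a b t) = apo_radius a (norm t)"
    "circumcircle (tri a b t) = apo a b (norm t)"
  using circumcenter_radius_unique[OF tri_subset_apo[OF assms, unfolded apo_def] triangle_tri(3)[OF assms]]
  by (simp_all add: apo_def)

lemma ccw_labelling:
  assumes "triangle T"
  obtains A B C where "T = {A, B, C}" "Im (cnj (B - A) * (C - A)) > 0" "A \<noteq> B" "B \<noteq> C" "C \<noteq> A"
proof -
  obtain A B C where T: "T = {A, B, C}" "A \<noteq> B" "A \<noteq> C" "B \<noteq> C"
    using assms unfolding triangle_def card_3_iff by blast
  then have n: "Im (cnj (B - A) * (C - A)) \<noteq> 0"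
    using assms unfolding triangle_def collinear_iff_Im[symmetric] by simp
  show thesis
  proof (cases "Im (cnj (B - A) * (C - A)) > 0")
    case False
    have "Im (cnj (C - A) * (B - A)) = - Im (cnj (B - A) * (C - A))" by (simp add: algebra_simps)
    then have "Im (cnj (C - A) * (B - A)) > 0" using False n by linarith
    then show thesis using that[of A C B] T by (auto simp: insert_commute)
  qed (use that[of A B C] T in auto)
qed

text \<open>The squared norms cancel, and \<open>q = p * cnj t\<close> keeps its real part under
  rotation by the cube roots of unity, which forces \<open>q = 0\<close>. This yields the uniqueness
  of the first isodynamic point and, with \<open>p = 1\<close>, excludes equilateral
  triangles.\<close>

lemma equidistant_zeta:
  assumes "dist p t = dist p (t * zeta)" "dist p (t * zeta) = dist p (t * zeta\<^sup>2)" "t \<noteq> 0"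
  shows "p = 0"
proof -
  define q where "q = p * cnj t"
  have e: "(dist p w)\<^sup>2 = (norm p)\<^sup>2 + (norm w)\<^sup>2 - 2 * Re (p * cnj w)" for w
    unfolding dist_norm cmod_power2 by (simp add: power2_eq_square algebra_simps)
  have 1: "Re q = Re (q * cnj zeta)" 
    using e[of t] e[of "t * zeta"] assms(1) by (simp add: norm_mult q_def mult.assoc del: times_complex.sel)
  have 2: "Re (q * cnj zeta) = Re (q * (cnj zeta)\<^sup>2)" 
    using e[of "t * zeta\<^sup>2"] e[of "t * zeta"] assms(2) by (simp add: norm_mult norm_power q_def mult.assoc del: times_complex.sel)
  have "(cnj zeta)\<^sup>2 = zeta" by (metis complex_cnj_cnj complex_cnj_power zeta_sq)
  then have "Re (q * cnj zeta) = Re (q * zeta)" using 2 by simp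
  then have "Im q = 0" by (simp add: zeta_def)
  moreover from this 1 have "Re q = 0" by (simp add: zeta_def)
  ultimately have "q = 0" by (simp add: complex_eq_iff)
  then show ?thesis using assms(3) by (simp add: q_def)
qed

lemma dist_zeta:
  "dist t (t * zeta) = sqrt 3 * norm t"
  "dist (t * zeta) (t * zeta\<^sup>2) = sqrt 3 * norm t"
  "dist (t * zeta\<^sup>2) t = sqrt 3 * norm t"
proof -
  have *: "dist t (t * zeta) = sqrt 3 * norm t" for t
  proof -
    have "t - t * zeta = t * (1 - zeta)" by (simp add: algebra_simps)
    then show ?thesis by (simp add: dist_norm norm_mult norm_zeta_sub_1)
  qed
  show "dist t (t * zeta) = sqrt 3 * norm t" by (rule *)
  show "dist (t * zeta) (t * zeta\<^sup>2) = sqrt 3 * norm t"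
    using *[of "t * zeta"] by (simp add: power2_eq_square mult.assoc norm_mult)
  show "dist (t * zeta\<^sup>2) t = sqrt 3 * norm t"
    using *[of "t * zeta\<^sup>2"] zeta_cube by (simp add: power2_eq_square power3_eq_cube mult.assoc norm_mult)
qed

lemma zeta_mult_neq_1:
  assumes "norm t < 1"
  shows "t \<noteq> 1" "t * zeta \<noteq> 1" "t * zeta\<^sup>2 \<noteq> 1"
  using norm_less_1_neq[of t] norm_less_1_neq[of "t * zeta"] norm_less_1_neq[of "t * zeta\<^sup>2"] assms
  by (auto simp: norm_mult norm_power)

text \<open>Every side carries a factor \<open>1 / norm (1 - w)\<close> for each end point. In the
  Apollonius conditions these factors cancel and only distances between parameters remain.\<close>

lemma dist_tri_vertices:
  assumes "norm t < 1"
  shows "dist (mob a b t) (mob a b (t * zeta)) = 2 * sqrt 3 * norm a * norm t / (norm (1 - t) * norm (1 - t * zeta))"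
    "dist (mob a b (t * zeta)) (mob a b (t * zeta\<^sup>2)) = 2 * sqrt 3 * norm a * norm t / (norm (1 - t * zeta) * norm (1 - t * zeta\<^sup>2))"
    "dist (mob a b (t * zeta\<^sup>2)) (mob a b t) = 2 * sqrt 3 * norm a * norm t / (norm (1 - t * zeta\<^sup>2) * norm (1 - t))"
  using zeta_mult_neq_1[OF assms] by (simp_all add: dist_mob dist_zeta)

lemma apo_radius_less: "0 < r \<Longrightarrow> r < 1 \<Longrightarrow> a \<noteq> 0 \<Longrightarrow> apo_radius a r < norm a * (2 / (1 - r\<^sup>2))"
  using one_minus_sq_pos[of r] unfolding apo_radius_def
  by (intro mult_strict_left_mono divide_strict_right_mono) auto

text \<open>Equal sides would make the pole 1 equidistant from the three parameters, hence equal to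
  their centre 0.\<close>

lemma not_equilateral_tri:
  assumes "t \<noteq> 0" "norm t < 1" "a \<noteq> 0"
  shows "\<not> equilateral (tri a b t)"
proof
  note n = zeta_mult_neq_1[OF assms(2)]
  have pos: "norm (1 - t) > 0" "norm (1 - t * zeta) > 0" "norm (1 - t * zeta\<^sup>2) > 0" using n by auto
  assume "equilateral (tri a b t)"
  then have "dist (mob a b t) (mob a b (t * zeta)) = dist (mob a b (t * zeta)) (mob a b (t * zeta\<^sup>2))"
    "dist (mob a b (t * zeta)) (mob a b (t * zeta\<^sup>2)) = dist (mob a b (t * zeta\<^sup>2)) (mob a b t)"
    unfolding equilateral_def tri_def by blast+
  then have "norm (1 - t) = norm (1 - t * zeta\<^sup>2)" "norm (1 - t * zeta) = norm (1 - t)"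
    unfolding dist_tri_vertices[OF assms(2)] using pos assms by (simp_all add: field_simps)
  then have "(1::complex) = 0" by (intro equidistant_zeta[of 1 t]) (use assms in \<open>simp_all add: dist_norm\<close>)
  then show False by simp
qed

text \<open>The parameters come from the discrete Fourier coefficients \<open>c1\<close>, \<open>c2\<close> of a counterclockwise
  labelling: \<open>t = c2 / c1\<close>, the area is a positive multiple of \<open>(norm c1)\<^sup>2 - (norm c2)\<^sup>2\<close>, and \<open>c2 = 0\<close> iff
  the triangle is equilateral.\<close>

lemma triangle_eq_tri:
  assumes "triangle T" "\<not> equilateral T"
  obtains a b t where "T = tri a b t" "t \<noteq> 0" "norm t < 1" "a \<noteq> 0"
proof -
  obtain A B C where T: "T = {A, B, C}" and S: "Im (cnj (B - A) * (C - A)) > 0"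
    and d: "A \<noteq> B" "B \<noteq> C" "C \<noteq> A" using ccw_labelling[OF assms(1)] by blast
  define G where "G = (A + B + C) / 3"
  define c1 where "c1 = (A + zeta\<^sup>2 * B + zeta * C) / 3"
  define c2 where "c2 = (A + zeta * B + zeta\<^sup>2 * C) / 3"
  have ABC: "A = G + c1 + c2" "B = G + zeta * c1 + zeta\<^sup>2 * c2" "C = G + zeta\<^sup>2 * c1 + zeta * c2"
    by (simp_all add: G_def c1_def c2_def power2_eq_square zeta_mult_zeta complex_eq_iff zeta_def field_simps)
  have "Im (cnj (B - A) * (C - A)) = (3 * sqrt 3 / 2) * ((norm c1)\<^sup>2 - (norm c2)\<^sup>2)"
    unfolding ABC cmod_power2
    by (simp add: zeta_sq cnj_zeta) (simp add: zeta_def field_simps power2_eq_square)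
  then have c12: "norm c2 < norm c1" using S sq_less_iff[of "norm c2" "norm c1"]
    by (simp only: zero_less_mult_iff) auto
  then have c1: "c1 \<noteq> 0" by auto
  have c2: "c2 \<noteq> 0"
  proof
    assume 0: "c2 = 0"
    have "A - B = c1 * (1 - zeta)" "B - C = c1 * zeta * (1 - zeta)" "C - A = c1 * zeta\<^sup>2 * (1 - zeta)"
      by (simp_all add: ABC 0 power2_eq_square zeta_mult_zeta zeta_mult_zeta_mult algebra_simps)
    then have "dist A B = norm c1 * sqrt 3" "dist B C = norm c1 * sqrt 3" "dist C A = norm c1 * sqrt 3"
      by (simp_all add: dist_norm norm_mult norm_power norm_zeta_sub_1)
    then have "equilateral T" unfolding equilateral_def T
      using three_eq_insert_cases[OF sym d] by (smt (verit) dist_commute)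
    then show False using assms by blast
  qed
  define t where "t = c2 / c1"
  have t: "t \<noteq> 0" "norm t < 1" using c1 c2 c12 by (simp_all add: t_def norm_divide)
  have "norm (t ^ 3) < 1" using t by (simp add: norm_power power_less_one_iff)
  then have t3: "t ^ 3 \<noteq> 1" by auto
  \<comment> \<open>On the three parameters \<open>w ^ 3 = t ^ 3\<close>, so the vertex
    \<open>G + m * w + m * w\<^sup>2\<close> equals
    \<open>G - m + m * (1 - t ^ 3) / (1 - w)\<close>, which is a Moebius map in \<open>w\<close>.
    Comparison with \<open>mob a b w\<close>, which is \<open>b - a + 2 * a / (1 - w)\<close>, gives
    \<open>a\<close> and \<open>b\<close>.\<close>
  define m where "m = c1 / t"
  define a where "a = m * (1 - t ^ 3) / 2"
  define b where "b = G + a - m"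
  have a: "a \<noteq> 0" using t3 c1 t by (simp add: a_def m_def)
  have V: "mob a b w = G + m * w + m * w\<^sup>2" if "w ^ 3 = t ^ 3" for w
  proof -
    have w: "w \<noteq> 1" using t3 that by auto
    have "a * (1 + w) = (m * (1 - w ^ 3) / 2) * (1 + w)" by (simp add: a_def that)
    also have "\<dots> = (m * w + m * w\<^sup>2 + m - a) * (1 - w)" unfolding a_def that[symmetric]
      by (simp add: power2_eq_square power3_eq_cube field_simps)
    finally have "a * (1 + w) / (1 - w) = m * w + m * w\<^sup>2 + m - a" using w by simp
    then show ?thesis by (simp add: mob_def b_def)
  qed
  have mt: "m * t = c1" "c1 * t = c2" using t c1 by (simp_all add: m_def t_def)
  have z: "zeta ^ 3 = 1" "(zeta\<^sup>2) ^ 3 = 1" "(zeta\<^sup>2)\<^sup>2 = zeta"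
    using zeta_cube by (simp_all add: power2_eq_square power3_eq_cube mult.assoc)
  have v: "mob a b (t * z) = G + z * c1 + z\<^sup>2 * c2" if "z ^ 3 = 1" for z
    using V[of "t * z"] that unfolding mt(2)[symmetric] mt(1)[symmetric]
    by (simp add: power_mult_distrib algebra_simps power2_eq_square)
  have "T = tri a b t" unfolding T ABC tri_def using v[of 1] v[of zeta] v[of "zeta\<^sup>2"] z by simp
  then show thesis using that t a by blast
qed

section \<open>Isodynamic points and inversion in the circumcircle\<close>

lemma mob_0: "mob a b 0 = b + a" by (simp add: mob_def)

text \<open>After cancellation the Apollonius conditions say that the parameter of \<open>P\<close>
  is equidistant from those of the vertices, hence 0. The second common point of the Apollonius
  circles is the image of infinity, and the ball excludes it.\<close>

lemma isodynamic_point1_tri: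
  assumes "t \<noteq> 0" "norm t < 1" "a \<noteq> 0"
  shows "isodynamic_point1 (tri a b t) = b + a"
  unfolding isodynamic_point1_def circumcircle_tri[OF assms]
proof (rule the_equality)
  have r: "0 < norm t" "norm t < 1" using assms by auto
  note n = zeta_mult_neq_1[OF assms(2)]
  let ?A = "mob a b t" and ?B = "mob a b (t * zeta)" and ?C = "mob a b (t * zeta\<^sup>2)"
  note D = dist_tri_vertices[OF assms(2), of a b]
  have pos: "norm (1 - t) > 0" "norm (1 - t * zeta) > 0" "norm (1 - t * zeta\<^sup>2) > 0" using n by auto
  {
    have E: "dist (b + a) (mob a b w) = 2 * norm a * norm w / norm (1 - w)" if "w \<noteq> 1" for w
      using dist_mob[OF _ that, of 0 a b] by (simp add: mob_0)
    have F: "dist (b + a) ?A * dist ?B ?C = dist (b + a) ?B * dist ?C ?A"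
      "dist (b + a) ?B * dist ?C ?A = dist (b + a) ?C * dist ?A ?B"
      unfolding D E[OF n(1)] E[OF n(2)] E[OF n(3)] using pos by (simp_all add: field_simps norm_mult norm_power)
    show "b + a \<in> ball (mob a b (of_real ((norm t)\<^sup>2))) (apo_radius a (norm t)) \<and>
      (\<forall>A B C. tri a b t = {A, B, C} \<longrightarrow> b + a \<in> apollonius_circle A B C)"
    proof (intro conjI allI impI)
      show "b + a \<in> ball (mob a b (of_real ((norm t)\<^sup>2))) (apo_radius a (norm t))"
        using mob_in_cball_iff(2)[OF r _ assms(3), of 0 b] r by (simp add: mob_0 dist_commute)
      fix A B C assume "tri a b t = {A, B, C}"
      from three_eq_insert_cases[OF this[symmetric, unfolded tri_def] tri_vertices_neq[OF assms]]
      show "b + a \<in> apollonius_circle A B C" unfolding apollonius_circle_def using F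
        by (auto simp: dist_commute)
    qed
  }
  fix P assume P: "P \<in> ball (mob a b (of_real ((norm t)\<^sup>2))) (apo_radius a (norm t)) \<and>
      (\<forall>A B C. tri a b t = {A, B, C} \<longrightarrow> P \<in> apollonius_circle A B C)"
  have "P \<noteq> b - a"
  proof
    assume "P = b - a"
    then have "norm a * (2 / (1 - (norm t)\<^sup>2)) < apo_radius a (norm t)" using P minus_diff_center[OF r, of b a]
      by (simp add: dist_commute)
    then show False using apo_radius_less[OF r assms(3)] by simp
  qed
  then obtain p where p: "p \<noteq> 1" "P = mob a b p" using mob_surj assms by blast
  have "P \<in> apollonius_circle ?A ?B ?C" "P \<in> apollonius_circle ?C ?A ?B"
    using P by (simp_all add: tri_def insert_commute)
  then have A: "dist P ?B * dist ?C ?A = dist P ?C * dist ?A ?B" "dist P ?A * dist ?B ?C = dist P ?B * dist ?C ?A"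
    by (simp_all add: apollonius_circle_def dist_commute)
  have E: "dist P (mob a b w) = 2 * norm a * dist p w / (norm (1 - p) * norm (1 - w))" if "w \<noteq> 1" for w
    unfolding p(2) using dist_mob[OF p(1) that] .
  have p': "norm (1 - p) > 0" using p by simp
  have "p = 0"
  proof (rule equidistant_zeta[OF _ _ assms(1)])
    show "dist p t = dist p (t * zeta)" using A(2) unfolding D E[OF n(1)] E[OF n(2)] E[OF n(3)]
      using pos p' assms by (simp add: field_simps)
    show "dist p (t * zeta) = dist p (t * zeta\<^sup>2)" using A(1) unfolding D E[OF n(1)] E[OF n(2)] E[OF n(3)]
      using pos p' assms by (simp add: field_simps)
  qed
  then show "P = b + a" using p by (simp add: mob_0)
qed

text \<open>In the parameter, the inversion is the reflection of \<open>p\<close> to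
  \<open>(norm t)\<^sup>2 / cnj p\<close>. Writing the result as the centre plus a displacement also
  covers \<open>p = 0\<close>, whose image is the parameterless point \<open>b - a\<close>.\<close>

lemma inverse_in_circumcircle_tri:
  assumes "t \<noteq> 0" "norm t < 1" "a \<noteq> 0" "p \<noteq> 1" "p \<noteq> of_real ((norm t)\<^sup>2)"
  shows "inverse_in_circumcircle (tri a b t) (mob a b p) = mob a b (of_real ((norm t)\<^sup>2)) +
    2 * a * of_real ((norm t)\<^sup>2) * (1 - cnj p) / ((cnj p - of_real ((norm t)\<^sup>2)) * (1 - of_real ((norm t)\<^sup>2)))"
proof -
  define r where "r = norm t"
  have r: "0 < r" "r < 1" using assms by (auto simp: r_def)
  have k: "(of_real (r\<^sup>2) :: complex) \<noteq> 1" by (rule of_real_sq_neq_1[OF r])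
  have p: "1 - r\<^sup>2 > 0" by (rule one_minus_sq_pos[OF r])
  have n: "norm (1 - of_real (r\<^sup>2) :: complex) = 1 - r\<^sup>2"
    using p by (metis abs_of_pos norm_of_real of_real_1 of_real_diff)
  have pr: "p - of_real (r\<^sup>2) \<noteq> 0" "cnj p - of_real (r\<^sup>2) \<noteq> 0" using assms unfolding r_def[symmetric]
    by (simp_all add: complex_eq_iff)
  have p1: "1 - p \<noteq> 0" "1 - cnj p \<noteq> 0" using assms by (simp_all add: complex_eq_iff)
  have q: "norm (p - of_real (r\<^sup>2)) > 0" "norm (1 - p) > 0" "norm a > 0" using pr p1 assms by auto
  have "apo_radius a r / dist (mob a b (of_real (r\<^sup>2))) (mob a b p) = r * norm (1 - p) / norm (p - of_real (r\<^sup>2))"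
    unfolding dist_mob[OF k assms(4)] n apo_radius_def using p q by (simp add: dist_commute dist_norm[of p])
  then have "complex_of_real ((apo_radius a r / dist (mob a b (of_real (r\<^sup>2))) (mob a b p))\<^sup>2)
     = of_real (r\<^sup>2) * ((1 - p) * (1 - cnj p)) / ((p - of_real (r\<^sup>2)) * (cnj p - of_real (r\<^sup>2)))"
    by (simp add: power_divide power_mult_distrib of_real_norm_sq)
  then have "inverse_in_circle (mob a b (of_real (r\<^sup>2))) (apo_radius a r) (mob a b p) = mob a b (of_real (r\<^sup>2)) +
     of_real (r\<^sup>2) * ((1 - p) * (1 - cnj p)) / ((p - of_real (r\<^sup>2)) * (cnj p - of_real (r\<^sup>2))) *
      (2 * a * (p - of_real (r\<^sup>2)) / ((1 - p) * (1 - of_real (r\<^sup>2))))"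
    by (simp only: inverse_in_circle_def scaleR_conv_of_real mob_diff[OF assms(4) k])
  also have "\<dots> = mob a b (of_real (r\<^sup>2)) +
    2 * a * of_real (r\<^sup>2) * (1 - cnj p) / ((cnj p - of_real (r\<^sup>2)) * (1 - of_real (r\<^sup>2)))"
  proof -
    have *: "R * (u * v) / (x * y) * (2 * a * x / (u * k)) = 2 * a * R * v / (y * k)" if "x \<noteq> 0" "u \<noteq> 0"
      for R u v x y k :: complex using that by simp
    show ?thesis unfolding *[OF pr(1) p1(1)] ..
  qed
  finally show ?thesis by (simp add: inverse_in_circumcircle_def circumcircle_tri[OF assms(1-3)] r_def)
qed

lemma isodynamic_point2_tri:
  assumes "t \<noteq> 0" "norm t < 1" "a \<noteq> 0"
  shows "isodynamic_point2 (tri a b t) = b - a"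
proof -
  have r: "0 < norm t" "norm t < 1" using assms by auto
  have "isodynamic_point2 (tri a b t) = inverse_in_circumcircle (tri a b t) (mob a b 0)"
    by (simp add: isodynamic_point2_def isodynamic_point1_tri[OF assms] mob_0)
  also have "\<dots> = mob a b (of_real ((norm t)\<^sup>2)) + - 2 * a / (1 - of_real ((norm t)\<^sup>2))"
    using inverse_in_circumcircle_tri[OF assms, of 0 b] assms by simp
  also have "\<dots> = b - a" using of_real_sq_neq_1[OF r] unfolding mob_def
    by (simp add: divide_simps) (simp add: algebra_simps)
  finally show ?thesis .
qed

lemma Im_of_real_mult: "Im (of_real c * z) = c * Im z"
  and Re_of_real_mult: "Re (of_real c * z) = c * Re z"
  by simp_all

section \<open>Brocard points and Beltrami points\<close>

text \<open>A positive imaginary part puts the argument strictly between 0 and \<open>pi\<close>, so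
  the unsigned angle is the argument itself. The angle condition then becomes an equation that is
  linear in \<open>P\<close>.\<close>

lemma vertex_angle_upper:
  assumes "Im (cnj (B - A) * (P - A)) > 0" "vertex_angle P A B = \<omega>"
  shows "0 < \<omega>" "\<omega> < pi"
    "Re (cnj (B - A) * (P - A)) * sin \<omega> = Im (cnj (B - A) * (P - A)) * cos \<omega>"
proof -
  define \<rho> where "\<rho> = (P - A) / (B - A)"
  have BA: "B - A \<noteq> 0" using assms(1) by auto
  have z: "cnj (B - A) * (P - A) = of_real ((norm (B - A))\<^sup>2) * \<rho>"
    using BA by (simp add: \<rho>_def of_real_norm_sq)
  then have "Im \<rho> > 0" using assms(1) by (simp only: Im_of_real_mult zero_less_mult_iff) auto
  then have a: "0 < Arg \<rho>" "Arg \<rho> < pi" using Arg_lt_pi by blast+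
  then have \<omega>: "Arg \<rho> = \<omega>" using assms(2) by (simp add: vertex_angle_def \<rho>_def)
  show "0 < \<omega>" "\<omega> < pi" using a \<omega> by auto
  have "\<rho> = of_real (norm \<rho>) * cis \<omega>" using rcis_cmod_Arg[of \<rho>] \<omega> by (simp add: rcis_def)
  then have "cnj (B - A) * (P - A) = of_real ((norm (B - A))\<^sup>2 * norm \<rho>) * cis \<omega>" using z by simp
  then show "Re (cnj (B - A) * (P - A)) * sin \<omega> = Im (cnj (B - A) * (P - A)) * cos \<omega>"
    by (simp only: Re_of_real_mult Im_of_real_mult) simp
qed

lemma vertex_angle_eq_arctan:
  assumes "(P - A) / (B - A) = of_real s * (of_real x + \<i> * of_real y)" "s > 0" "x > 0" "y > 0"
  shows "vertex_angle P A B = arctan (y / x)"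
proof -
  have "Arg (of_real s * (of_real x + \<i> * of_real y)) = Arg (of_real x + \<i> * of_real y)"
    using assms(2) by simp
  also have "\<dots> = arctan (y / x)" using arg_conv_arctan[of "of_real x + \<i> * of_real y"] assms(3) by simp
  finally have "Arg ((P - A) / (B - A)) = arctan (y / x)" using assms(1) by simp
  then show ?thesis unfolding vertex_angle_def using assms by (simp add: zero_le_arctan_iff)
qed

lemma vertex_angle_cnj: "vertex_angle (cnj P) (cnj A) (cnj B) = vertex_angle P A B"
proof -
  have "(cnj P - cnj A) / (cnj B - cnj A) = cnj ((P - A) / (B - A))" by simp
  then show ?thesis unfolding vertex_angle_def by (simp only: Arg_cnj) auto
qed

text \<open>Adding up the three angle conditions, the position of \<open>P\<close> drops out and only \<open>cot \<omega>\<close>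
  remains.\<close>

lemma brocard_unique_first:
  assumes P: "Im (cnj (B - A) * (P - A)) > 0" "Im (cnj (C - B) * (P - B)) > 0" "Im (cnj (A - C) * (P - C)) > 0"
    and \<omega>: "vertex_angle P A B = \<omega>" "vertex_angle P B C = \<omega>" "vertex_angle P C A = \<omega>"
    and P': "Im (cnj (B - A) * (P' - A)) > 0" "Im (cnj (C - B) * (P' - B)) > 0" "Im (cnj (A - C) * (P' - C)) > 0"
    and \<omega>': "vertex_angle P' A B = \<omega>'" "vertex_angle P' B C = \<omega>'" "vertex_angle P' C A = \<omega>'"
  shows "\<omega>' = \<omega> \<and> P' = P"
proof -
  define L where "L = Re (cnj (B - A) * (P - A)) + Re (cnj (C - B) * (P - B)) + Re (cnj (A - C) * (P - C))"
  define S where "S = Im (cnj (B - A) * (P - A)) + Im (cnj (C - B) * (P - B)) + Im (cnj (A - C) * (P - C))"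
  have S: "S > 0" using P by (simp add: S_def)
  have L': "L = Re (cnj (B - A) * (P' - A)) + Re (cnj (C - B) * (P' - B)) + Re (cnj (A - C) * (P' - C))"
    by (simp add: L_def algebra_simps)
  have S': "S = Im (cnj (B - A) * (P' - A)) + Im (cnj (C - B) * (P' - B)) + Im (cnj (A - C) * (P' - C))"
    by (simp add: S_def algebra_simps)
  have area: "S = Im (cnj (B - A) * (C - A))" by (simp add: S_def algebra_simps)
  note v = vertex_angle_upper[OF P(1) \<omega>(1)] vertex_angle_upper[OF P(2) \<omega>(2)] vertex_angle_upper[OF P(3) \<omega>(3)]
  note v' = vertex_angle_upper[OF P'(1) \<omega>'(1)] vertex_angle_upper[OF P'(2) \<omega>'(2)] vertex_angle_upper[OF P'(3) \<omega>'(3)]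
  have 1: "L * sin \<omega> = S * cos \<omega>" unfolding L_def S_def distrib_right using v by linarith
  have 2: "L * sin \<omega>' = S * cos \<omega>'" unfolding L' S' distrib_right using v' by linarith
  have "S * sin (\<omega>' - \<omega>) = (S * cos \<omega>) * sin \<omega>' - (S * cos \<omega>') * sin \<omega>"
    by (simp add: sin_diff algebra_simps)
  also have "\<dots> = 0" unfolding 1[symmetric] 2[symmetric] by simp
  finally have "sin (\<omega>' - \<omega>) = 0" using S by simp
  then have w: "\<omega>' = \<omega>" using v v' sin_eq_0_pi[of "\<omega>' - \<omega>"] by linarith
  \<comment> \<open>Both candidates see \<open>A B\<close> and \<open>B C\<close> under the same
    angle, so their difference, rotated back by this angle, is parallel to two different sides and
    must vanish.\<close>
  define X where "X = (P' - P) * cis (- \<omega>)"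
  have I: "Im (u * X) = Im (u * (P' - A)) * cos \<omega> - Re (u * (P' - A)) * sin \<omega>
      - (Im (u * (P - A)) * cos \<omega> - Re (u * (P - A)) * sin \<omega>)" for u A
    by (simp add: X_def algebra_simps)
  have I1: "Im (cnj (B - A) * X) = 0" unfolding I[of _ A] using v v' w by simp
  have I2: "Im (cnj (C - B) * X) = 0" unfolding I[of _ B] using v v' w by simp
  have "X = 0"
  proof (rule ccontr)
    assume "X \<noteq> 0"
    have "(cnj (B - A) * X) * cnj (cnj (C - B) * X) = of_real ((norm X)\<^sup>2) * (cnj (B - A) * (C - B))"
      by (simp add: of_real_norm_sq)
    then have "(norm X)\<^sup>2 * Im (cnj (B - A) * (C - B)) = Im ((cnj (B - A) * X) * cnj (cnj (C - B) * X))"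
      by (simp only: Im_of_real_mult)
    also have "\<dots> = 0"
    proof -
      have *: "Im (p * cnj q) = 0" if "Im p = 0" "Im q = 0" for p q :: complex using that by simp
      show ?thesis by (rule *[OF I1 I2])
    qed
    finally have "Im (cnj (B - A) * (C - B)) = 0" using \<open>X \<noteq> 0\<close> by simp
    moreover have "Im (cnj (B - A) * (C - B)) = S" unfolding area by (simp add: algebra_simps)
    ultimately show False using S by simp
  qed
  then show ?thesis using w by (simp add: X_def)
qed

text \<open>The three signed areas, divided by that of the whole triangle, are the barycentric
  coordinates of \<open>P\<close>.\<close>

lemma interior_hull_iff:
  fixes A B C P :: complex
  assumes S: "Im (cnj (B - A) * (C - A)) > 0"
  shows "P \<in> interior (convex hull {A, B, C}) \<longleftrightarrow>
    Im (cnj (B - A) * (P - A)) > 0 \<and> Im (cnj (C - B) * (P - B)) > 0 \<and> Im (cnj (A - C) * (P - C)) > 0"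
proof -
  define S where "S = Im (cnj (B - A) * (C - A))"
  have S0: "S > 0" using assms by (simp add: S_def)
  have nc: "\<not> collinear {A, B, C}" using S by (simp add: collinear_iff_Im)
  note hull = interior_convex_hull_3_minimal[OF nc DIM_complex]
  show ?thesis
  proof
    assume "P \<in> interior (convex hull {A, B, C})"
    then obtain x y z where xyz: "0 < x" "0 < y" "0 < z" "x + y + z = 1" "P = x *\<^sub>R A + y *\<^sub>R B + z *\<^sub>R C"
      unfolding hull by blast
    then have P: "P = (1 - y - z) *\<^sub>R A + y *\<^sub>R B + z *\<^sub>R C" and x: "x = 1 - y - z" by auto
    have "Im (cnj (B - A) * (P - A)) = z * S" "Im (cnj (C - B) * (P - B)) = x * S"
      "Im (cnj (A - C) * (P - C)) = y * S"
      unfolding P S_def x by (simp_all add: algebra_simps)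
    then show "Im (cnj (B - A) * (P - A)) > 0 \<and> Im (cnj (C - B) * (P - B)) > 0 \<and> Im (cnj (A - C) * (P - C)) > 0"
      using xyz S0 by simp
  next
    assume R: "Im (cnj (B - A) * (P - A)) > 0 \<and> Im (cnj (C - B) * (P - B)) > 0 \<and> Im (cnj (A - C) * (P - C)) > 0"
    define z where "z = Im (cnj (B - A) * (P - A)) / S"
    define x where "x = Im (cnj (C - B) * (P - B)) / S"
    define y where "y = Im (cnj (A - C) * (P - C)) / S"
    have pos: "0 < x" "0 < y" "0 < z" using R S0 by (simp_all add: x_def y_def z_def)
    have m: "x * S = Im (cnj (C - B) * (P - B))" "y * S = Im (cnj (A - C) * (P - C))" "z * S = Im (cnj (B - A) * (P - A))"
      using S0 by (simp_all add: x_def y_def z_def)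
    have "(x + y + z) * S = S" unfolding distrib_right m by (simp add: S_def algebra_simps)
    then have 1: "x + y + z = 1" using S0 by simp
    have "S *\<^sub>R (x *\<^sub>R A + y *\<^sub>R B + z *\<^sub>R C) = (x * S) *\<^sub>R A + (y * S) *\<^sub>R B + (z * S) *\<^sub>R C"
      by (simp add: scaleR_right_distrib mult.commute)
    also have "\<dots> = S *\<^sub>R P" unfolding m unfolding S_def by (simp add: complex_eq_iff algebra_simps)
    finally have "x *\<^sub>R A + y *\<^sub>R B + z *\<^sub>R C = P" using S0 by simp
    then show "P \<in> interior (convex hull {A, B, C})" unfolding hull using pos 1 by blast
  qed
qed

text \<open>In terms of the usual cotangent,
  \<open>cot \<omega> = sqrt 3 * (1 + r\<^sup>2) / (1 - r\<^sup>2)\<close>. The excluded value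
  \<open>r = 0\<close> would give \<open>pi / 6\<close>, the Brocard angle of an equilateral
  triangle.\<close>

definition brocard_arctan :: "real \<Rightarrow> real" where
  "brocard_arctan r = arctan ((1 - r\<^sup>2) / (sqrt 3 * (1 + r\<^sup>2)))"

text \<open>The ratio does not depend on the argument of \<open>w\<close>: this is why all triangles
  \<open>tri a b t\<close> with the same \<open>norm t\<close> share their Brocard points and their Brocard angle.\<close>

lemma brocard_ratio:
  assumes "w \<noteq> 0" "norm w < 1"
  shows "(mob a b (of_real ((norm w)\<^sup>2) * zeta\<^sup>2) - mob a b w) * ((1 - zeta) * (1 - of_real ((norm w)\<^sup>2) * zeta\<^sup>2)) =
    of_real ((norm (1 - w * zeta))\<^sup>2) * (mob a b (w * zeta) - mob a b w)"
proof -
  define R where "R = complex_of_real ((norm w)\<^sup>2)"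
  have R: "R = w * cnj w" by (simp add: R_def of_real_norm_sq)
  have "norm (R * zeta\<^sup>2) < 1" using assms by (simp add: R_def norm_mult norm_power power_less_one_iff)
  then have n: "R * zeta\<^sup>2 \<noteq> 1" by auto
  note m = zeta_mult_neq_1[OF assms(2)]
  have n1: "1 - R * zeta\<^sup>2 \<noteq> 0" "1 - w \<noteq> 0" "1 - w * zeta \<noteq> 0" using n m by auto
  have N: "complex_of_real ((norm (1 - w * zeta))\<^sup>2) = (1 - w * zeta) * (1 - cnj w * zeta\<^sup>2)"
    by (simp add: of_real_norm_sq zeta_sq)
  have "(mob a b (R * zeta\<^sup>2) - mob a b w) * ((1 - zeta) * (1 - R * zeta\<^sup>2)) =
    2 * a * (R * zeta\<^sup>2 - w) * (1 - zeta) / (1 - w)"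
    unfolding mob_diff[OF n m(1)] using n1 by simp
  also have "(R * zeta\<^sup>2 - w) * (1 - zeta) = (1 - cnj w * zeta\<^sup>2) * (w * zeta - w)"
    unfolding R by (simp add: algebra_simps)
  then have "2 * a * (R * zeta\<^sup>2 - w) * (1 - zeta) / (1 - w) =
     2 * a * ((1 - cnj w * zeta\<^sup>2) * (w * zeta - w)) / (1 - w)" by (simp add: mult.assoc)
  also have "\<dots> = of_real ((norm (1 - w * zeta))\<^sup>2) * (mob a b (w * zeta) - mob a b w)"
    unfolding mob_diff[OF m(2) m(1)] N using n1 by simp
  finally show ?thesis by (simp add: R_def)
qed


section \<open>The Brocard configuration in the parametrisation\<close>

lemma cnj_mob: "cnj (mob a b w) = mob (cnj a) (cnj b) (cnj w)"
  by (simp add: mob_def)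

text \<open>By \<open>brocard_ratio\<close> the quotient of the two vectors at the vertex is a
  positive real over \<open>X - \<i> * Y\<close>, so its argument is that of
  \<open>X + \<i> * Y\<close> and depends on \<open>norm w\<close> only.\<close>

lemma brocard_angle1:
  assumes "w \<noteq> 0" "norm w < 1" "a \<noteq> 0"
  shows "vertex_angle (mob a b (of_real ((norm w)\<^sup>2) * zeta\<^sup>2)) (mob a b w) (mob a b (w * zeta)) = brocard_arctan (norm w)"
    "Im (cnj (mob a b (w * zeta) - mob a b w) * (mob a b (of_real ((norm w)\<^sup>2) * zeta\<^sup>2) - mob a b w)) > 0"
proof -
  define R where "R = (norm w)\<^sup>2"
  define X where "X = 3 / 2 * (1 + R)"
  define Y where "Y = sqrt 3 / 2 * (1 - R)"
  define N where "N = (norm (1 - w * zeta))\<^sup>2"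
  note m = zeta_mult_neq_1[OF assms(2)]
  let ?P = "mob a b (of_real R * zeta\<^sup>2)" and ?A = "mob a b w" and ?B = "mob a b (w * zeta)"
  have BA: "?B - ?A \<noteq> 0" using tri_vertices_neq(1)[OF assms, of b] by auto
  have R: "0 < R" "R < 1" using assms by (simp_all add: R_def power_less_one_iff)
  then have XY: "0 < X" "0 < Y" by (simp_all add: X_def Y_def)
  have N: "N > 0" using m by (simp add: N_def)
  have c: "(1 - zeta) * (1 - of_real R * zeta\<^sup>2) = of_real X - \<i> * of_real Y"
    unfolding zeta_sq cnj_zeta by (simp add: complex_eq_iff X_def Y_def zeta_def) (simp add: field_simps)
  have "(of_real X - \<i> * of_real Y) * (of_real X + \<i> * of_real Y) = (of_real (X\<^sup>2 + Y\<^sup>2) :: complex)"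
    by (simp add: complex_eq_iff power2_eq_square)
  moreover have D: "X\<^sup>2 + Y\<^sup>2 > 0" using XY by (simp add: add_pos_pos)
  have "(?P - ?A) * (of_real X - \<i> * of_real Y) = of_real N * (?B - ?A)"
    using brocard_ratio[OF assms(1,2), of a b] unfolding R_def[symmetric] N_def[symmetric] c .
  then have "(?P - ?A) * ((of_real X - \<i> * of_real Y) * (of_real X + \<i> * of_real Y)) = of_real N * (?B - ?A) * (of_real X + \<i> * of_real Y)"
    by (simp only: mult.assoc[symmetric])
  ultimately have "(?P - ?A) * of_real (X\<^sup>2 + Y\<^sup>2) = of_real N * (?B - ?A) * (of_real X + \<i> * of_real Y)"
    by simp
  moreover have "complex_of_real (X\<^sup>2 + Y\<^sup>2) \<noteq> 0" unfolding of_real_eq_0_iff using D by (rule less_imp_neq[THEN not_sym])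
  ultimately have "?P - ?A = of_real N * (?B - ?A) * (of_real X + \<i> * of_real Y) / of_real (X\<^sup>2 + Y\<^sup>2)"
    by - (rule eq_divide_imp)
  then have PA: "?P - ?A = of_real (N / (X\<^sup>2 + Y\<^sup>2)) * (of_real X + \<i> * of_real Y) * (?B - ?A)"
    by (simp only: of_real_divide times_divide_eq_left times_divide_eq_right ac_simps)
  have s: "N / (X\<^sup>2 + Y\<^sup>2) > 0" using N D by simp
  have "(?P - ?A) / (?B - ?A) = of_real (N / (X\<^sup>2 + Y\<^sup>2)) * (of_real X + \<i> * of_real Y)"
    unfolding PA using BA by simp
  then have "vertex_angle ?P ?A ?B = arctan (Y / X)" by (rule vertex_angle_eq_arctan[OF _ s XY])
  also have "Y / X = (1 - R) / (sqrt 3 * (1 + R))"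
  proof -
    have "Y * (sqrt 3 * (1 + R)) = (1 - R) * X" by (simp add: X_def Y_def algebra_simps)
    moreover have "X \<noteq> 0" "sqrt 3 * (1 + R) \<noteq> 0" using XY R by simp_all
    ultimately show ?thesis by (metis frac_eq_eq)
  qed
  finally show "vertex_angle (mob a b (of_real ((norm w)\<^sup>2) * zeta\<^sup>2)) (mob a b w) (mob a b (w * zeta)) = brocard_arctan (norm w)"
    by (simp add: brocard_arctan_def R_def)
  have "cnj (?B - ?A) * (?P - ?A) = of_real (N / (X\<^sup>2 + Y\<^sup>2) * (norm (?B - ?A))\<^sup>2) * (of_real X + \<i> * of_real Y)"
    unfolding PA of_real_mult by (simp only: of_real_power of_real_norm_sq ac_simps)
  then have "Im (cnj (?B - ?A) * (?P - ?A)) = N / (X\<^sup>2 + Y\<^sup>2) * (norm (?B - ?A))\<^sup>2 * Y"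
    by (simp only: Im_of_real_mult) simp
  also have "\<dots> > 0" by (intro mult_pos_pos s XY(2)) (use BA in simp)
  finally show "Im (cnj (mob a b (w * zeta) - mob a b w) * (mob a b (of_real ((norm w)\<^sup>2) * zeta\<^sup>2) - mob a b w)) > 0"
    by (simp add: R_def)
qed

text \<open>Complex conjugation carries the parametrisation to the one with conjugate
  \<open>a\<close>, \<open>b\<close> and \<open>w\<close> and exchanges \<open>zeta\<close> with
  \<open>zeta\<^sup>2\<close>; it thus turns the statement for the first Brocard point into this
  one.\<close>

lemma brocard_angle2:
  assumes "w \<noteq> 0" "norm w < 1" "a \<noteq> 0"
  shows "vertex_angle (mob a b (of_real ((norm w)\<^sup>2) * zeta)) (mob a b w) (mob a b (w * zeta\<^sup>2)) = brocard_arctan (norm w)"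
    "Im (cnj (mob a b w - mob a b (w * zeta\<^sup>2)) * (mob a b (of_real ((norm w)\<^sup>2) * zeta) - mob a b (w * zeta\<^sup>2))) > 0"
proof -
  have z: "cnj (zeta\<^sup>2) = zeta" "cnj zeta = zeta\<^sup>2" by (simp_all only: zeta_sq complex_cnj_cnj)
  have c: "mob (cnj a) (cnj b) (of_real ((norm w)\<^sup>2) * zeta\<^sup>2) = cnj (mob a b (of_real ((norm w)\<^sup>2) * zeta))"
    "mob (cnj a) (cnj b) (cnj w * zeta) = cnj (mob a b (w * zeta\<^sup>2))"
    "mob (cnj a) (cnj b) (cnj w) = cnj (mob a b w)"
    unfolding cnj_mob complex_cnj_mult z complex_cnj_complex_of_real by simp_all
  note b = brocard_angle1[of "cnj w" "cnj a" "cnj b", simplified complex_mod_cnj c vertex_angle_cnj]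
  show "vertex_angle (mob a b (of_real ((norm w)\<^sup>2) * zeta)) (mob a b w) (mob a b (w * zeta\<^sup>2)) = brocard_arctan (norm w)"
    using b(1) assms by simp
  have "Im (cnj (A - C) * (P - C)) = Im (cnj (cnj C - cnj A) * (cnj P - cnj A))" for A C P
    by (simp add: algebra_simps)
  then show "Im (cnj (mob a b w - mob a b (w * zeta\<^sup>2)) * (mob a b (of_real ((norm w)\<^sup>2) * zeta) - mob a b (w * zeta\<^sup>2))) > 0"
    using b(2) assms by simp
qed

text \<open>Reflection reverses the orientation, so the result for the first Brocard point applies
  to the conjugate vertices in the order \<open>B\<close>, \<open>A\<close>,
  \<open>C\<close>.\<close>

lemma brocard_unique_second:
  assumes P: "Im (cnj (B - A) * (P - A)) > 0" "Im (cnj (C - B) * (P - B)) > 0" "Im (cnj (A - C) * (P - C)) > 0"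
    and \<omega>: "vertex_angle P B A = \<omega>" "vertex_angle P C B = \<omega>" "vertex_angle P A C = \<omega>"
    and P': "Im (cnj (B - A) * (P' - A)) > 0" "Im (cnj (C - B) * (P' - B)) > 0" "Im (cnj (A - C) * (P' - C)) > 0"
    and \<omega>': "vertex_angle P' B A = \<omega>'" "vertex_angle P' C B = \<omega>'" "vertex_angle P' A C = \<omega>'"
  shows "\<omega>' = \<omega> \<and> P' = P"
proof -
  have c: "Im (cnj (cnj X - cnj Y) * (cnj P - cnj Y)) = Im (cnj (Y - X) * (P - X))" for X Y P
    by (simp add: algebra_simps)
  have "\<omega>' = \<omega> \<and> cnj P' = cnj P"
    by (rule brocard_unique_first[of "cnj A" "cnj B" "cnj P" "cnj C" \<omega> "cnj P'" \<omega>'])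
      (simp_all only: c vertex_angle_cnj assms)
  then show ?thesis by simp
qed

lemma brocard_configuration_tri:
  assumes "t \<noteq> 0" "norm t < 1" "a \<noteq> 0"
  shows "brocard_configuration (tri a b t) \<omega> P Q \<longleftrightarrow> \<omega> = brocard_arctan (norm t) \<and>
    P = mob a b (of_real ((norm t)\<^sup>2) * zeta\<^sup>2) \<and> Q = mob a b (of_real ((norm t)\<^sup>2) * zeta)"
proof -
  define A where "A = mob a b t"
  define B where "B = mob a b (t * zeta)"
  define C where "C = mob a b (t * zeta\<^sup>2)"
  define P0 where "P0 = mob a b (of_real ((norm t)\<^sup>2) * zeta\<^sup>2)"
  define Q0 where "Q0 = mob a b (of_real ((norm t)\<^sup>2) * zeta)"
  define \<omega>0 where "\<omega>0 = brocard_arctan (norm t)"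
  have T: "tri a b t = {A, B, C}" by (simp add: tri_def A_def B_def C_def)
  have neq: "A \<noteq> B" "B \<noteq> C" "C \<noteq> A" using tri_vertices_neq[OF assms] by (simp_all add: A_def B_def C_def)
  have tz: "t * zeta \<noteq> 0" "norm (t * zeta) < 1" "t * zeta\<^sup>2 \<noteq> 0" "norm (t * zeta\<^sup>2) < 1"
    using assms zeta_neq_0 by (simp_all add: norm_mult norm_power)
  have n: "norm (t * zeta) = norm t" "norm (t * zeta\<^sup>2) = norm t" by (simp_all add: norm_mult norm_power)
  have e: "t * zeta * zeta = t * zeta\<^sup>2" "t * zeta\<^sup>2 * zeta = t" "t * zeta * zeta\<^sup>2 = t" "t * zeta\<^sup>2 * zeta\<^sup>2 = t * zeta"
    by (simp_all add: power2_eq_square mult.assoc zeta_mult_zeta zeta_mult_zeta_mult algebra_simps)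
  note b1 = brocard_angle1[OF assms, of b] brocard_angle1[OF tz(1,2) assms(3), of b] brocard_angle1[OF tz(3,4) assms(3), of b]
  note b2 = brocard_angle2[OF assms, of b] brocard_angle2[OF tz(1,2) assms(3), of b] brocard_angle2[OF tz(3,4) assms(3), of b]
  note b1 = b1[unfolded e n, folded A_def B_def C_def P0_def \<omega>0_def]
  note b2 = b2[unfolded e n, folded A_def B_def C_def Q0_def \<omega>0_def]
  have "Im (cnj (B - A) * (C - A)) =
     Im (cnj (B - A) * (P0 - A)) + Im (cnj (C - B) * (P0 - B)) + Im (cnj (A - C) * (P0 - C))"
    by (simp add: algebra_simps)
  then have S: "Im (cnj (B - A) * (C - A)) > 0" using b1 by linarith
  have rot: "Im (cnj (C - B) * (A - B)) = Im (cnj (B - A) * (C - A))"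
    "Im (cnj (A - C) * (B - C)) = Im (cnj (B - A) * (C - A))"
    "Im (cnj (C - A) * (B - A)) = - Im (cnj (B - A) * (C - A))"
    "Im (cnj (B - C) * (A - C)) = - Im (cnj (B - A) * (C - A))"
    "Im (cnj (A - B) * (C - B)) = - Im (cnj (B - A) * (C - A))"
    by (simp_all add: algebra_simps)
  note hull = interior_hull_iff[OF S]
  have "brocard_configuration {A, B, C} \<omega>0 P0 Q0"
    unfolding brocard_configuration_def hull ccw_def using b1 b2 S by blast
  moreover have "\<omega> = \<omega>0 \<and> P = P0 \<and> Q = Q0" if c: "brocard_configuration {A, B, C} \<omega> P Q"
  proof -
    have i: "Im (cnj (B - A) * (P - A)) > 0" "Im (cnj (C - B) * (P - B)) > 0" "Im (cnj (A - C) * (P - C)) > 0"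
      "Im (cnj (B - A) * (Q - A)) > 0" "Im (cnj (C - B) * (Q - B)) > 0" "Im (cnj (A - C) * (Q - C)) > 0"
      using c unfolding brocard_configuration_def hull by blast+
    from c obtain A' B' C' where T': "{A, B, C} = {A', B', C'}" and "ccw A' B' C'" and
      an: "vertex_angle P A' B' = \<omega> \<and> vertex_angle P B' C' = \<omega> \<and> vertex_angle P C' A' = \<omega> \<and>
        vertex_angle Q B' A' = \<omega> \<and> vertex_angle Q C' B' = \<omega> \<and> vertex_angle Q A' C' = \<omega>"
      unfolding brocard_configuration_def by blast
    then have S': "Im (cnj (B' - A') * (C' - A')) > 0" by (simp only: ccw_def)
    have an': "vertex_angle P A B = \<omega> \<and> vertex_angle P B C = \<omega> \<and> vertex_angle P C A = \<omega> \<and>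
        vertex_angle Q B A = \<omega> \<and> vertex_angle Q C B = \<omega> \<and> vertex_angle Q A C = \<omega>"
    proof -
      \<comment> \<open>The cyclic relabellings merely permute the angle conditions; the other three
        labellings are clockwise and contradict the sign of the area.\<close>
      consider (1) "A' = A" "B' = B" "C' = C" | (2) "A' = B" "B' = C" "C' = A" | (3) "A' = C" "B' = A" "C' = B" |
        (4) "A' = A" "B' = C" "C' = B" | (5) "A' = B" "B' = A" "C' = C" | (6) "A' = C" "B' = B" "C' = A"
        using three_eq_insert_cases[OF T'[symmetric] neq] by blast
      then show ?thesis
      proof cases
        case 1 show ?thesis using an unfolding 1 by blast
      next
        case 2 show ?thesis using an unfolding 2 by blast
      next
        case 3 show ?thesis using an unfolding 3 by blast
      next
        case 4 have False using S' S rot(3) unfolding 4 by linarith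
        then show ?thesis ..
      next
        case 5 have False using S' S rot(5) unfolding 5 by linarith
        then show ?thesis ..
      next
        case 6 have False using S' S rot(4) unfolding 6 by linarith
        then show ?thesis ..
      qed
    qed
    have "\<omega> = \<omega>0 \<and> P = P0" by (rule brocard_unique_first[of B A P0 C \<omega>0 P \<omega>]) (use b1 i an' in blast)+
    moreover have "\<omega> = \<omega>0 \<and> Q = Q0" by (rule brocard_unique_second[of B A Q0 C \<omega>0 Q \<omega>]) (use b2 i an' in blast)+
    ultimately show ?thesis by blast
  qed
  ultimately show ?thesis unfolding T P0_def[symmetric] Q0_def[symmetric] \<omega>0_def[symmetric] by blast
qed

lemma brocard_tri:
  assumes "t \<noteq> 0" "norm t < 1" "a \<noteq> 0"
  shows "brocard_angle (tri a b t) = brocard_arctan (norm t)"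
    "brocard_point1 (tri a b t) = mob a b (of_real ((norm t)\<^sup>2) * zeta\<^sup>2)"
    "brocard_point2 (tri a b t) = mob a b (of_real ((norm t)\<^sup>2) * zeta)"
  unfolding brocard_angle_def brocard_point1_def brocard_point2_def brocard_configuration_tri[OF assms]
  by simp_all

section \<open>The Brocard circle and the Beltrami points\<close>

lemma norm_of_real_sq: "norm (complex_of_real (r\<^sup>2)) = r\<^sup>2"
  by (simp only: norm_of_real abs_power2)

text \<open>With \<open>R = (norm t)\<^sup>2\<close>, the circumcenter and the Brocard points have
  the parameters \<open>R\<close>, \<open>R * zeta\<^sup>2\<close> and \<open>R * zeta\<close>. They
  form a triangle \<open>tri a b R\<close> of the same family, whose circumcircle is known.\<close>

lemma brocard_circle_tri:
  assumes "t \<noteq> 0" "norm t < 1" "a \<noteq> 0"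
  shows "brocard_circle (tri a b t) = apo a b ((norm t)\<^sup>2)"
proof -
  have "{circumcenter (tri a b t), brocard_point1 (tri a b t), brocard_point2 (tri a b t)} =
     tri a b (of_real ((norm t)\<^sup>2))"
    unfolding brocard_tri[OF assms] circumcircle_tri[OF assms] tri_def[of a b "of_real ((norm t)\<^sup>2)"] by blast
  moreover have n0: "complex_of_real ((norm t)\<^sup>2) \<noteq> 0" using assms by simp
  moreover have n1: "norm (complex_of_real ((norm t)\<^sup>2)) < 1"
    unfolding norm_of_real_sq using assms by (simp add: power_less_one_iff)
  ultimately show ?thesis unfolding brocard_circle_def using circumcircle_tri(3)[OF n0 n1 assms(3), of b]
    by (simp only: norm_of_real_sq)
qed

text \<open>The reflection in the circle of squared radius \<open>R\<close> takes
  \<open>R * x\<close> to \<open>1 / cnj x\<close>, which is \<open>x\<close> for unimodular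
  \<open>x\<close>. So the dependence on \<open>norm t\<close> disappears.\<close>

lemma beltrami_tri:
  assumes "t \<noteq> 0" "norm t < 1" "a \<noteq> 0"
  shows "beltrami_point1 (tri a b t) = mob a b (zeta\<^sup>2)"
    "beltrami_point2 (tri a b t) = mob a b zeta"
proof -
  define R where "R = complex_of_real ((norm t)\<^sup>2)"
  have r: "0 < norm t" "norm t < 1" using assms by auto
  have R: "R \<noteq> 1" "R \<noteq> 0" using of_real_sq_neq_1[OF r] assms by (simp_all add: R_def)
  have z2: "zeta\<^sup>2 \<noteq> 1" unfolding zeta_sq cnj_zeta by (simp add: complex_eq_iff zeta_def)
  have *: "inverse_in_circumcircle (tri a b t) (mob a b (R * x)) = mob a b x"
    if x: "x * cnj x = 1" "x \<noteq> 1" for x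
  proof -
    have "(norm x)\<^sup>2 = 1" using x(1) complex_norm_square[of x] by (metis of_real_eq_1_iff)
    then have nx: "norm x = 1" using norm_ge_zero[of x] by (auto simp: power2_eq_1_iff)
    have "norm (R * x) < 1" unfolding R_def norm_mult norm_of_real_sq nx using r by (simp add: power_less_one_iff)
    then have 1: "R * x \<noteq> 1" by auto
    have 2: "R * x \<noteq> of_real ((norm t)\<^sup>2)" unfolding R_def[symmetric] using R x by simp
    have cx: "cnj x \<noteq> 1" "x \<noteq> 0" using x by auto
    have cR: "cnj R = R" by (simp add: R_def)
    have "2 * a * R * (1 - cnj (R * x)) / ((cnj (R * x) - R) * (1 - R)) = 2 * a * (1 - R * cnj x) / ((cnj x - 1) * (1 - R))"
    proof -
      have "cnj (R * x) - R = R * (cnj x - 1)" by (simp add: cR algebra_simps)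
      then show ?thesis using R by (simp add: cR)
    qed
    also have "\<dots> = (2 * a * (1 - R * cnj x) * x) / ((cnj x - 1) * (1 - R) * x)" using cx by simp
    also have "\<dots> = 2 * a * (x - R) / ((1 - x) * (1 - R))"
    proof (rule arg_cong2[where f = "(/)"])
      have "2 * a * (1 - R * cnj x) * x = 2 * a * (x - R * (x * cnj x))" by (simp add: algebra_simps)
      then show "2 * a * (1 - R * cnj x) * x = 2 * a * (x - R)" unfolding x by simp
      have "(cnj x - 1) * (1 - R) * x = (x * cnj x - x) * (1 - R)" by (simp add: algebra_simps)
      then show "(cnj x - 1) * (1 - R) * x = (1 - x) * (1 - R)" unfolding x .
    qed
    also have "\<dots> = mob a b x - mob a b R" by (rule mob_diff[symmetric]) (use x R in auto)
    finally show ?thesis using inverse_in_circumcircle_tri[OF assms 1 2, of b] unfolding R_def[symmetric] by simp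
  qed
  have n: "zeta * cnj zeta = 1" "zeta\<^sup>2 * cnj (zeta\<^sup>2) = 1"
    unfolding complex_cnj_power power_mult_distrib[symmetric] complex_norm_square[symmetric] by simp_all
  show "beltrami_point1 (tri a b t) = mob a b (zeta\<^sup>2)"
    unfolding beltrami_point1_def brocard_tri[OF assms] R_def[symmetric] by (rule *[OF n(2) z2])
  show "beltrami_point2 (tri a b t) = mob a b zeta"
    unfolding beltrami_point2_def brocard_tri[OF assms] R_def[symmetric] by (rule *[OF n(1) zeta_neq_1])
qed

section \<open>The second Brocard triangle\<close>

text \<open>The symmedian divides the opposite side in the ratio of the squares of the adjacent
  sides, and these weights avoid the square roots hidden in \<open>sgn\<close>. With
  \<open>u\<close> and \<open>v\<close> the side vectors at \<open>A\<close>, the value is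
  \<open>u * v * cnj (u + v)\<close>, the reflected median up to a positive factor.\<close>

definition symmedian_dir :: "complex \<Rightarrow> complex \<Rightarrow> complex \<Rightarrow> complex" where
  "symmedian_dir A B C = of_real ((norm (B - A))\<^sup>2) * (C - A) + of_real ((norm (C - A))\<^sup>2) * (B - A)"

lemma symmedian_eq:
  assumes "A \<noteq> B" "A \<noteq> C"
  shows "symmedian A B C = range (\<lambda>s. A + of_real s * symmedian_dir A B C)"
proof -
  define u v where "u = B - A" and "v = C - A"
  have n: "norm u \<noteq> 0" "norm v \<noteq> 0" using assms by (simp_all add: u_def v_def)
  have M: "midpoint B C - A = (u + v) / 2"
    by (simp add: midpoint_def u_def v_def scaleR_conv_of_real field_simps)
  have d: "symmedian_dir A B C = u * v * cnj (u + v)"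
    by (simp only: symmedian_dir_def u_def[symmetric] v_def[symmetric] complex_norm_square)
      (simp add: algebra_simps)
  have "A + sgn u * sgn v * cnj ((A + s *\<^sub>R (midpoint B C - A)) - A)
    = A + of_real (s / (2 * norm u * norm v)) * (u * v * cnj (u + v))" for s
    unfolding M by (simp add: sgn_div_norm scaleR_conv_of_real divide_simps)
  then have "symmedian A B C = (\<lambda>s. A + of_real (s / (2 * norm u * norm v)) * symmedian_dir A B C) ` UNIV"
    unfolding symmedian_def affine_hull_2_alt u_def[symmetric] v_def[symmetric] image_image d
    by (intro image_cong refl)
  also have "\<dots> = (\<lambda>s. A + of_real s * symmedian_dir A B C) ` (range (\<lambda>s. s / (2 * norm u * norm v)))"
    by (simp only: image_image)
  also have "range (\<lambda>s. s / (2 * norm u * norm v)) = UNIV"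
    using n by (intro surjI[of _ "\<lambda>s. s * (2 * norm u * norm v)"]) simp
  finally show ?thesis .
qed

lemma symmedian_commute: "A \<noteq> B \<Longrightarrow> A \<noteq> C \<Longrightarrow> symmedian A C B = symmedian A B C"
  by (simp add: symmedian_eq symmedian_dir_def add.commute)

text \<open>Two distinct common points of the symmedians would place all three vertices on the line
  joining them.\<close>

lemma symmedian_point_unique:
  assumes nc: "\<not> collinear {A, B, C}" and neq: "A \<noteq> B" "B \<noteq> C" "C \<noteq> A"
    and K: "K \<in> symmedian A B C" "K \<in> symmedian B C A" "K \<in> symmedian C A B"
  shows "symmedian_point {A, B, C} = K"
  unfolding symmedian_point_def
proof (rule the_equality)
  show "\<forall>A' B' C'. {A, B, C} = {A', B', C'} \<longrightarrow> K \<in> symmedian A' B' C'"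
  proof (intro allI impI)
    fix A' B' C' assume "{A, B, C} = {A', B', C'}"
    from three_eq_insert_cases[OF this[symmetric] neq] show "K \<in> symmedian A' B' C'"
      using K neq symmedian_commute[of A B C] symmedian_commute[of B C A] symmedian_commute[of C A B]
      by metis
  qed
  fix L assume "\<forall>A' B' C'. {A, B, C} = {A', B', C'} \<longrightarrow> L \<in> symmedian A' B' C'"
  then have L: "L \<in> symmedian A B C" "L \<in> symmedian B C A" "L \<in> symmedian C A B"
    by (metis insert_commute)+
  show "L = K"
  proof (rule ccontr)
    assume "L \<noteq> K"
    have *: "\<exists>x. X = K + of_real x * (L - K)" if ne: "X \<noteq> Y" "X \<noteq> Z" and KL: "K \<in> symmedian X Y Z" "L \<in> symmedian X Y Z" for X Y Z
    proof -
      obtain s where s: "K = X + of_real s * symmedian_dir X Y Z" using KL ne by (auto simp: symmedian_eq)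
      obtain s' where s': "L = X + of_real s' * symmedian_dir X Y Z" using KL ne by (auto simp: symmedian_eq)
      have LK: "L - K = of_real (s' - s) * symmedian_dir X Y Z" by (simp add: s s' algebra_simps)
      then have "s' - s \<noteq> 0" using \<open>L \<noteq> K\<close> by auto
      then have "X = K + of_real (- s / (s' - s)) * (L - K)" unfolding LK
        by (simp add: s flip: mult.assoc of_real_mult of_real_diff of_real_minus of_real_divide) simp
      then show ?thesis by blast
    qed
    obtain x y z where xyz: "A = K + of_real x * (L - K)" "B = K + of_real y * (L - K)" "C = K + of_real z * (L - K)"
      using *[of A B C] *[of B C A] *[of C A B] K L neq by metis
    have d: "B - A = of_real (y - x) * (L - K)" "C - A = of_real (z - x) * (L - K)"
      unfolding xyz by (simp_all add: algebra_simps)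
    have "Im (cnj (B - A) * (C - A)) = 0" unfolding d by (simp add: algebra_simps)
    then show False using nc by (simp add: collinear_iff_Im)
  qed
qed

text \<open>The squared sides at the vertex are proportional to \<open>1 / n1\<close> and
  \<open>1 / n2\<close>, so the symmedian direction is proportional to
  \<open>n1 * u + n2 * v\<close>, and this sum collapses to a positive multiple of the vector to the
  claimed point. The parameter \<open>- (norm w)\<^sup>2\<close> is the reflection of
  \<open>-1\<close>: the symmedian point is the inverse of \<open>b\<close>, the midpoint of the
  isodynamic points.\<close>

lemma mob_symmedian:
  assumes "w \<noteq> 0" "norm w < 1" "a \<noteq> 0"
  shows "mob a b (- of_real ((norm w)\<^sup>2)) \<in> symmedian (mob a b w) (mob a b (w * zeta)) (mob a b (w * zeta\<^sup>2))"
proof -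
  define R where "R = (norm w)\<^sup>2"
  have R: "complex_of_real R = w * cnj w" by (simp add: R_def of_real_norm_sq)
  have R0: "R > 0" using assms by (simp add: R_def)
  note n = zeta_mult_neq_1[OF assms(2)]
  define n0 n1 n2 where "n0 = (norm (1 - w))\<^sup>2" and "n1 = (norm (1 - w * zeta))\<^sup>2" and "n2 = (norm (1 - w * zeta\<^sup>2))\<^sup>2"
  have npos: "n0 > 0" "n1 > 0" "n2 > 0" using n by (simp_all add: n0_def n1_def n2_def)
  define u where "u = mob a b (w * zeta) - mob a b w"
  define v where "v = mob a b (w * zeta\<^sup>2) - mob a b w"
  have cz: "cnj (zeta\<^sup>2) = zeta" "cnj zeta = zeta\<^sup>2" by (simp_all only: zeta_sq complex_cnj_cnj)
  have N: "complex_of_real n1 = (1 - w * zeta) * (1 - cnj w * zeta\<^sup>2)" "complex_of_real n2 = (1 - w * zeta\<^sup>2) * (1 - cnj w * zeta)"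
    unfolding n1_def n2_def complex_norm_square complex_cnj_diff complex_cnj_mult cz complex_cnj_one by simp_all
  have e: "u = 2 * a * (w * zeta - w) / ((1 - w * zeta) * (1 - w))" "v = 2 * a * (w * zeta\<^sup>2 - w) / ((1 - w * zeta\<^sup>2) * (1 - w))"
    unfolding u_def v_def using n by (simp_all add: mob_diff)
  have m1: "of_real n1 * u = 2 * a * ((w * zeta - w) * (1 - cnj w * zeta\<^sup>2)) / (1 - w)"
    unfolding N e using n by simp
  have m2: "of_real n2 * v = 2 * a * ((w * zeta\<^sup>2 - w) * (1 - cnj w * zeta)) / (1 - w)"
    unfolding N e using n by simp
  have "of_real n1 * u + of_real n2 * v = 2 * a * ((w * zeta - w) * (1 - cnj w * zeta\<^sup>2) + (w * zeta\<^sup>2 - w) * (1 - cnj w * zeta)) / (1 - w)"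
    unfolding m1 m2 by (simp only: add_divide_distrib[symmetric] distrib_left[symmetric])
  also have "(w * zeta - w) * (1 - cnj w * zeta\<^sup>2) + (w * zeta\<^sup>2 - w) * (1 - cnj w * zeta) = 3 * (- of_real R - w)"
    unfolding R by (simp add: power2_eq_square zeta_mult_zeta zeta_mult_zeta_mult algebra_simps)
  finally have 1: "of_real n1 * u + of_real n2 * v = 6 * a * (- of_real R - w) / (1 - w)" by simp
  have R1: "1 + complex_of_real R \<noteq> 0"
    using R0 by (metis add_pos_pos less_irrefl of_real_1 of_real_add of_real_eq_0_iff zero_less_one)
  then have "- complex_of_real R \<noteq> 1" by (metis left_minus)
  then have KA: "mob a b (- of_real R) - mob a b w = 2 * a * (- of_real R - w) / ((1 + of_real R) * (1 - w))"
    using n by (simp add: mob_diff)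
  have 2: "of_real n1 * u + of_real n2 * v = of_real (3 * (1 + R)) * (mob a b (- of_real R) - mob a b w)"
  proof -
    have "6 * a * y / z = 3 * x * (2 * a * y / (x * z))" if "x \<noteq> 0" for x y z :: complex using that by simp
    from this[OF R1] show ?thesis unfolding 1 KA by simp
  qed
  define k where "k = 12 * (norm a)\<^sup>2 * R"
  have "norm u = 2 * sqrt 3 * norm a * norm w / (norm (1 - w) * norm (1 - w * zeta))"
    "norm v = 2 * sqrt 3 * norm a * norm w / (norm (1 - w * zeta\<^sup>2) * norm (1 - w))"
    unfolding u_def v_def using dist_tri_vertices[OF assms(2), of a b] by (simp_all only: dist_norm norm_minus_commute)
  then have uv: "(norm u)\<^sup>2 = k / (n0 * n1)" "(norm v)\<^sup>2 = k / (n0 * n2)"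
    by (simp_all add: k_def n0_def n1_def n2_def R_def power_divide power_mult_distrib)
  have "symmedian_dir (mob a b w) (mob a b (w * zeta)) (mob a b (w * zeta\<^sup>2)) = of_real (k / (n0 * n1)) * v + of_real (k / (n0 * n2)) * u"
    by (simp add: symmedian_dir_def u_def[symmetric] v_def[symmetric] uv)
  also have "\<dots> = of_real (k / (n0 * n1 * n2)) * (of_real n1 * u + of_real n2 * v)"
    using npos by (simp add: field_simps)
  also have "\<dots> = of_real (k / (n0 * n1 * n2) * (3 * (1 + R))) * (mob a b (- of_real R) - mob a b w)"
    unfolding 2 by (simp only: of_real_mult mult.assoc)
  finally have d: "symmedian_dir (mob a b w) (mob a b (w * zeta)) (mob a b (w * zeta\<^sup>2)) =
    of_real (k / (n0 * n1 * n2) * (3 * (1 + R))) * (mob a b (- of_real R) - mob a b w)" (is "?d = of_real ?k * _") .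
  have k: "?k > 0" using R0 npos assms by (simp add: k_def)
  have "y = x + of_real (1 / k) * (of_real k * (y - x))" if "k > 0" for x y :: complex and k :: real
    using that by simp
  from this[OF k] have "mob a b (- of_real R) = mob a b w + of_real (1 / ?k) * ?d" unfolding d .
  moreover have "mob a b w \<noteq> mob a b (w * zeta)" "mob a b w \<noteq> mob a b (w * zeta\<^sup>2)"
    using tri_vertices_neq[OF assms, of b] by auto
  ultimately show ?thesis unfolding R_def[symmetric] by (subst symmedian_eq) blast+
qed

lemma tri_rotations:
  "t * zeta * zeta = t * zeta\<^sup>2" "t * zeta\<^sup>2 * zeta = t" "t * zeta * zeta\<^sup>2 = t" "t * zeta\<^sup>2 * zeta\<^sup>2 = t * zeta"
  by (simp_all add: power2_eq_square mult.assoc zeta_mult_zeta zeta_mult_zeta_mult algebra_simps)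

lemma symmedian_point_tri:
  assumes "t \<noteq> 0" "norm t < 1" "a \<noteq> 0"
  shows "symmedian_point (tri a b t) = mob a b (- of_real ((norm t)\<^sup>2))"
proof -
  have tz: "t * zeta \<noteq> 0" "norm (t * zeta) < 1" "t * zeta\<^sup>2 \<noteq> 0" "norm (t * zeta\<^sup>2) < 1"
    using assms zeta_neq_0 by (simp_all add: norm_mult norm_power)
  have n: "norm (t * zeta) = norm t" "norm (t * zeta\<^sup>2) = norm t" by (simp_all add: norm_mult norm_power)
  show ?thesis unfolding tri_def
  proof (rule symmedian_point_unique)
    show "\<not> collinear {mob a b t, mob a b (t * zeta), mob a b (t * zeta\<^sup>2)}"
      using triangle_tri[OF assms, of b] by (simp add: tri_def)
  qed (use tri_vertices_neq[OF assms] mob_symmedian[OF assms] mob_symmedian[OF tz(1,2) assms(3), unfolded tri_rotations n]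
    mob_symmedian[OF tz(3,4) assms(3), unfolded tri_rotations n] in auto)
qed

text \<open>The line through a vertex and the symmedian point meets the Brocard circle in the symmedian
  point and in \<open>mob a b (w\<^sup>2)\<close>, with multiplicity. The second parameter is found from the power of
  the vertex.\<close>

lemma line_inter_brocard_circle:
  assumes "w \<noteq> 0" "norm w < 1" "a \<noteq> 0"
  shows "affine hull {mob a b w, mob a b (- of_real ((norm w)\<^sup>2))} \<inter> apo a b ((norm w)\<^sup>2) =
    {mob a b (- of_real ((norm w)\<^sup>2)), mob a b (w\<^sup>2)}"
proof -
  define R where "R = (norm w)\<^sup>2"
  have R: "complex_of_real R = w * cnj w" by (simp add: R_def of_real_norm_sq)
  have R0: "0 < R" "R < 1" using assms by (simp_all add: R_def power_less_one_iff)
  define A where "A = mob a b w"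
  define K where "K = mob a b (- of_real R)"
  define O' where "O' = mob a b (of_real (R\<^sup>2))"
  define \<rho> where "\<rho> = apo_radius a R"
  define D where "D = K - A"
  define \<sigma> where "\<sigma> = (1 + R) / (norm (1 + w))\<^sup>2"
  have w1: "w \<noteq> 1" using assms by auto
  have wm: "1 + w \<noteq> 0" "1 - w \<noteq> 0" "1 + cnj w \<noteq> 0"
  proof -
    show m: "1 + w \<noteq> 0" using assms(2) by (metis add_eq_0_iff less_irrefl norm_minus_cancel norm_one)
    show "1 - w \<noteq> 0" using w1 by simp
    show "1 + cnj w \<noteq> 0" using m by (metis complex_cnj_add complex_cnj_one complex_cnj_zero_iff)
  qed
  have w2: "w\<^sup>2 \<noteq> 1"
    by (rule norm_less_1_neq) (use assms in \<open>simp add: norm_power power_less_one_iff\<close>)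
  have R1: "1 + complex_of_real R \<noteq> 0"
    using R0 by (metis add_pos_pos less_irrefl of_real_1 of_real_add of_real_eq_0_iff zero_less_one)
  then have Rn: "- complex_of_real R \<noteq> 1" by (metis left_minus)
  have D: "D = - 2 * a * w * (1 + cnj w) / ((1 + of_real R) * (1 - w))"
  proof -
    have "D = 2 * a * (- of_real R - w) / ((1 + of_real R) * (1 - w))"
      using mob_diff[OF Rn w1] by (simp add: D_def K_def A_def)
    also have "2 * a * (- of_real R - w) = - 2 * a * w * (1 + cnj w)" unfolding R by (simp add: algebra_simps)
    finally show ?thesis .
  qed
  have D0: "D \<noteq> 0" unfolding D using assms wm R1 by simp
  have N: "complex_of_real ((norm (1 + w))\<^sup>2) = (1 + w) * (1 + cnj w)" by (simp add: of_real_norm_sq)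
  have A': "mob a b (w\<^sup>2) = A + of_real \<sigma> * D"
  proof -
    have "mob a b (w\<^sup>2) - A = 2 * a * (w\<^sup>2 - w) / ((1 - w\<^sup>2) * (1 - w))"
      unfolding A_def by (rule mob_diff[OF w2 w1])
    also have "\<dots> = (- 2 * a * w) * (1 - w) / ((1 - w) * (1 + w) * (1 - w))"
      by (simp add: power2_eq_square algebra_simps)
    also have "\<dots> = - 2 * a * w / ((1 - w) * (1 + w))" using wm by simp
    also have "\<dots> = of_real \<sigma> * D" unfolding D \<sigma>_def of_real_divide N using wm R1 by simp (simp add: ac_simps)
    finally show ?thesis by (simp only: diff_eq_eq add.commute)
  qed
  have nD: "(norm D)\<^sup>2 = 4 * (norm a)\<^sup>2 * R * (norm (1 + w))\<^sup>2 / ((1 + R)\<^sup>2 * (norm (1 - w))\<^sup>2)"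
  proof -
    have "norm (1 + complex_of_real R) = 1 + R" using R0 by (metis abs_of_pos add_pos_pos norm_of_real of_real_1 of_real_add zero_less_one)
    moreover have "norm (1 + cnj w) = norm (1 + w)" by (metis complex_cnj_add complex_cnj_one complex_mod_cnj)
    ultimately show ?thesis unfolding D by (simp add: norm_mult norm_divide power_divide power_mult_distrib R_def)
  qed
  have pow: "(dist A O')\<^sup>2 - \<rho>\<^sup>2 = (norm D)\<^sup>2 * \<sigma>"
  proof -
    have "(dist A O')\<^sup>2 - \<rho>\<^sup>2 = 4 * (norm a)\<^sup>2 * (R - R\<^sup>2) / ((norm (1 - w))\<^sup>2 * (1 - R\<^sup>2))"
      using apo_power[OF R0 w1, of a b] by (simp add: A_def O'_def \<rho>_def R_def)
    also have "\<dots> = 4 * (norm a)\<^sup>2 * R / ((norm (1 - w))\<^sup>2 * (1 + R))"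
    proof -
      have "R - R\<^sup>2 = R * (1 - R)" "1 - R\<^sup>2 = (1 + R) * (1 - R)" by (simp_all add: power2_eq_square algebra_simps)
      then show ?thesis using R0 by simp
    qed
    also have "\<dots> = (norm D)\<^sup>2 * \<sigma>" unfolding nD \<sigma>_def using wm R0 by (simp add: power2_eq_square) (simp add: ac_simps)
    finally show ?thesis .
  qed
  have line: "(dist (A + of_real s * D) O')\<^sup>2 - \<rho>\<^sup>2 = (dist A O')\<^sup>2 - \<rho>\<^sup>2 + 2 * s * Re (D * cnj (A - O')) + s\<^sup>2 * (norm D)\<^sup>2" for s
    unfolding dist_norm cmod_power2 by (simp add: power2_eq_square algebra_simps)
  have \<rho>: "\<rho> > 0" using apo_radius_pos R0 assms by (simp add: \<rho>_def)
  \<comment> \<open>Since \<open>K\<close> is on the circle, \<open>s = 1\<close> is a root of the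
    quadratic in \<open>s\<close>. This fixes the linear coefficient, and the other root is
    \<sigma>; the case \<open>\<sigma> = 1\<close> is tangency.\<close>
  have "dist K O' = \<rho>" using mob_in_cball_iff(1)[OF R0 Rn assms(3), of b] R0 by (simp add: K_def O'_def \<rho>_def)
  then have "(norm D)\<^sup>2 * \<sigma> + 2 * Re (D * cnj (A - O')) + (norm D)\<^sup>2 = 0"
    using line[of 1] pow by (simp add: D_def)
  then have h: "2 * Re (D * cnj (A - O')) = - (norm D)\<^sup>2 * (1 + \<sigma>)" by (simp add: algebra_simps)
  have q: "(dist (A + of_real s * D) O')\<^sup>2 - \<rho>\<^sup>2 = (norm D)\<^sup>2 * ((s - 1) * (s - \<sigma>))" for s
  proof -
    have "2 * s * Re (D * cnj (A - O')) = s * (- (norm D)\<^sup>2 * (1 + \<sigma>))"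
      unfolding h[symmetric] by (simp only: ac_simps)
    then show ?thesis unfolding line pow by (simp add: power2_eq_square algebra_simps)
  qed
  have on: "A + of_real s * D \<in> apo a b R \<longleftrightarrow> s = 1 \<or> s = \<sigma>" for s
  proof -
    have "A + of_real s * D \<in> apo a b R \<longleftrightarrow> dist (A + of_real s * D) O' = \<rho>"
      by (simp add: apo_def O'_def \<rho>_def dist_commute)
    also have "\<dots> \<longleftrightarrow> (dist (A + of_real s * D) O')\<^sup>2 - \<rho>\<^sup>2 = 0" using \<rho> by simp
    also have "\<dots> \<longleftrightarrow> s = 1 \<or> s = \<sigma>" unfolding q using D0 by simp
    finally show ?thesis .
  qed
  have "affine hull {A, K} = range (\<lambda>s. A + of_real s * D)"
    unfolding affine_hull_2_alt D_def scaleR_conv_of_real ..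
  moreover have "range f \<inter> X = {f x, f y}" if "\<And>s. f s \<in> X \<longleftrightarrow> s = x \<or> s = y"
    for f :: "real \<Rightarrow> complex" and X x y using that by auto
  note this[of "\<lambda>s. A + of_real s * D", OF on]
  ultimately have "affine hull {A, K} \<inter> apo a b R = {A + of_real 1 * D, A + of_real \<sigma> * D}"
    by simp
  then show ?thesis unfolding A' A_def[symmetric] K_def[symmetric] R_def[symmetric]
    by (simp add: D_def)
qed

text \<open>Both branches of the definition agree with the formula: when the line is tangent, the
  two listed points coincide and the image of \<open>w\<^sup>2\<close> is the symmedian point
  itself.\<close>

lemma second_brocard_vertex_tri:
  assumes "t \<noteq> 0" "norm t < 1" "a \<noteq> 0" "w \<noteq> 0" "norm w = norm t"
  shows "second_brocard_vertex (tri a b t) (mob a b w) = mob a b (w\<^sup>2)"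
proof -
  have "affine hull {mob a b w, symmedian_point (tri a b t)} \<inter> brocard_circle (tri a b t) =
    {symmedian_point (tri a b t), mob a b (w\<^sup>2)}"
    using line_inter_brocard_circle[OF assms(4) _ assms(3), of b] assms(2)
    unfolding assms(5) symmedian_point_tri[OF assms(1-3)] brocard_circle_tri[OF assms(1-3)] by blast
  then show ?thesis unfolding second_brocard_vertex_def Let_def by auto
qed

lemma second_brocard_triangle_tri:
  assumes "t \<noteq> 0" "norm t < 1" "a \<noteq> 0"
  shows "second_brocard_triangle (tri a b t) = tri a b (t\<^sup>2)"
proof -
  have "second_brocard_triangle (tri a b t) = {mob a b (t\<^sup>2), mob a b ((t * zeta)\<^sup>2), mob a b ((t * zeta\<^sup>2)\<^sup>2)}"
    unfolding second_brocard_triangle_def tri_def[of a b t, THEN arg_cong[where f = "\<lambda>T. second_brocard_vertex _ ` T"]]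
    using second_brocard_vertex_tri[OF assms, of _ b] assms zeta_neq_0 by (simp add: norm_mult norm_power)
  \<comment> \<open>Squaring exchanges \<open>zeta\<close> and \<open>zeta\<^sup>2\<close>: the set
    of vertices has the same form, but the labelling inherited from the triangle reverses its
    orientation.\<close>
  also have "(t * zeta\<^sup>2)\<^sup>2 = t\<^sup>2 * zeta" using tri_rotations(2)[of zeta]
    by (simp add: power_mult_distrib power2_eq_square mult.assoc zeta_mult_zeta_mult zeta_mult_zeta algebra_simps)
  finally show ?thesis by (auto simp: tri_def power_mult_distrib)
qed

section \<open>Ellipses\<close>

text \<open>Along the line the sum of the distances to the foci tends to infinity in both directions, so a
  larger value than that at a point of tangency is attained on both sides.\<close>

lemma ellipse_tangent_unique_aux:
  fixes A B F1 F2 :: complex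
  assumes "A \<noteq> B" "affine hull {A, B} \<inter> ellipse F1 F2 \<alpha> = {P}" "affine hull {A, B} \<inter> ellipse F1 F2 \<beta> = {Q}"
  shows "\<not> \<alpha> < \<beta>"
proof
  assume less: "\<alpha> < \<beta>"
  define D where "D = B - A"
  define f where "f s = dist (A + s *\<^sub>R D) F1 + dist (A + s *\<^sub>R D) F2" for s
  have D: "norm D > 0" using assms(1) by (simp add: D_def)
  have line: "affine hull {A, B} = range (\<lambda>s. A + s *\<^sub>R D)" by (simp add: affine_hull_2_alt D_def)
  obtain p where p: "P = A + p *\<^sub>R D" using assms(2) line by blast
  obtain q where q: "Q = A + q *\<^sub>R D" using assms(3) line by blast
  have fp: "f p = 2 * \<alpha>" using assms(2) by (auto simp: f_def ellipse_def p)
  have fq: "f q = 2 * \<beta>" using assms(3) by (auto simp: f_def ellipse_def q)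
  have only: "s = q" if "f s = 2 * \<beta>" for s
  proof -
    have "A + s *\<^sub>R D \<in> affine hull {A, B} \<inter> ellipse F1 F2 \<beta>" using that unfolding line by (auto simp: f_def ellipse_def)
    then have "s *\<^sub>R D = q *\<^sub>R D" using assms(3) q by simp
    then show ?thesis using D by simp
  qed
  \<comment> \<open>The growth already comes from one focus: moving by
    \<open>2 * \<alpha> + 2 * \<beta>\<close> from a point at distance at most
    \<open>2 * \<alpha>\<close> leaves a distance of at least \<open>2 * \<beta>\<close>.\<close>
  have large: "f (p + x) \<ge> 2 * \<beta>" if "\<bar>x\<bar> * norm D = 2 * \<alpha> + 2 * \<beta>" for x
  proof -
    have "norm (x *\<^sub>R D) \<le> dist (A + (p + x) *\<^sub>R D) F1 + dist (A + p *\<^sub>R D) F1"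
      using dist_triangle3[of "A + (p + x) *\<^sub>R D" "A + p *\<^sub>R D" F1]
      by (simp add: dist_norm algebra_simps norm_minus_commute)
    then have "2 * \<alpha> + 2 * \<beta> \<le> dist (A + (p + x) *\<^sub>R D) F1 + f p"
      using that zero_le_dist[of "A + p *\<^sub>R D" F2] unfolding f_def norm_scaleR by linarith
    then show ?thesis using fp zero_le_dist[of "A + (p + x) *\<^sub>R D" F2] unfolding f_def by linarith
  qed
  have cont: "continuous_on S f" for S unfolding f_def by (intro continuous_intros)
  define x where "x = (2 * \<alpha> + 2 * \<beta>) / norm D"
  have \<alpha>0: "\<alpha> \<ge> 0" using fp zero_le_dist[of "A + p *\<^sub>R D" F1] zero_le_dist[of "A + p *\<^sub>R D" F2]
    unfolding f_def by linarith
  then have x: "x > 0" "\<bar>x\<bar> * norm D = 2 * \<alpha> + 2 * \<beta>" "\<bar>- x\<bar> * norm D = 2 * \<alpha> + 2 * \<beta>" using less D by (simp_all add: x_def)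
  obtain s where s: "p \<le> s" "f s = 2 * \<beta>"
    using IVT'[of f p "2 * \<beta>" "p + x"] fp less large[OF x(2)] cont x(1) by auto
  obtain s' where s': "s' \<le> p" "f s' = 2 * \<beta>"
    using IVT2'[of f p "2 * \<beta>" "p + - x"] fp less large[OF x(3)] cont x(1) by auto
  \<comment> \<open>The value \<open>2 * \<beta>\<close> is attained only at \<open>q\<close>, yet
    it is attained on either side of \<open>p\<close>; so \<open>p = q\<close>, where the two values
    clash.\<close>
  have "s = q" "s' = q" using only s s' by auto
  then have "p = q" using s s' by auto
  then show False using fp fq less by simp
qed

lemma ellipse_tangent_unique:
  fixes A B F1 F2 :: complex
  assumes "A \<noteq> B" "affine hull {A, B} \<inter> ellipse F1 F2 \<alpha> = {P}" "affine hull {A, B} \<inter> ellipse F1 F2 \<beta> = {Q}"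
  shows "\<alpha> = \<beta>"
  using ellipse_tangent_unique_aux[OF assms] ellipse_tangent_unique_aux[OF assms(1,3,2)] by linarith

text \<open>Both ends of the major axis and one end of the minor axis are all that is used to
  recover the semi-axes from the set.\<close>

lemma ellipse_axis_frame:
  fixes F1 F2 :: complex
  assumes "dist F1 F2 < 2 * \<alpha>"
  obtains M u where "norm u = 1" "F1 = M + of_real (dist F1 F2 / 2) * u" "F2 = M - of_real (dist F1 F2 / 2) * u"
    "M + of_real \<alpha> * u \<in> ellipse F1 F2 \<alpha>" "M - of_real \<alpha> * u \<in> ellipse F1 F2 \<alpha>"
    "M + of_real (sqrt (\<alpha>\<^sup>2 - (dist F1 F2 / 2)\<^sup>2)) * (\<i> * u) \<in> ellipse F1 F2 \<alpha>"
proof -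
  define c where "c = dist F1 F2 / 2"
  define M where "M = (F1 + F2) / 2"
  \<comment> \<open>For a circle every direction is an axis; 1 selects one.\<close>
  define u where "u = (if F1 = F2 then 1 else (F1 - F2) / of_real (dist F1 F2))"
  have c: "0 \<le> c" "c < \<alpha>" using assms by (simp_all add: c_def)
  have u: "norm u = 1" by (simp add: u_def norm_divide dist_norm)
  have cu: "of_real c * u = (F1 - F2) / 2" by (simp add: u_def c_def)
  have F: "F1 = M + of_real c * u" "F2 = M - of_real c * u" unfolding cu by (simp_all add: M_def field_simps)
  have d: "dist (M + x * u) (M + y * u) = norm (x - y)" for x y
    using u by (simp add: dist_norm norm_mult left_diff_distrib[symmetric])
  have F': "F1 = M + of_real c * u" "F2 = M + of_real (- c) * u" using F by simp_all
  have n: "norm (complex_of_real x - of_real y) = \<bar>x - y\<bar>" for x y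
    by (simp only: of_real_diff[symmetric] norm_of_real)
  define \<beta> where "\<beta> = sqrt (\<alpha>\<^sup>2 - c\<^sup>2)"
  have "c\<^sup>2 \<le> \<alpha>\<^sup>2" using c by (intro power_mono) auto
  then have "\<beta>\<^sup>2 + c\<^sup>2 = \<alpha>\<^sup>2" by (simp add: \<beta>_def)
  then have nb: "norm (of_real \<beta> * \<i> - complex_of_real c) = \<alpha>" "norm (of_real \<beta> * \<i> - complex_of_real (- c)) = \<alpha>"
    using c by (simp_all add: cmod_def add.commute)
  have 1: "M + of_real \<alpha> * u \<in> ellipse F1 F2 \<alpha>"
    unfolding ellipse_def F' mem_Collect_eq d n using c by simp
  have "M + of_real (- \<alpha>) * u \<in> ellipse F1 F2 \<alpha>"
    unfolding ellipse_def F' mem_Collect_eq d n using c by simp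
  then have 2: "M - of_real \<alpha> * u \<in> ellipse F1 F2 \<alpha>" by simp
  have "M + (of_real \<beta> * \<i>) * u \<in> ellipse F1 F2 \<alpha>"
    unfolding ellipse_def F' mem_Collect_eq d nb by simp
  then have 3: "M + of_real (sqrt (\<alpha>\<^sup>2 - (dist F1 F2 / 2)\<^sup>2)) * (\<i> * u) \<in> ellipse F1 F2 \<alpha>"
    by (simp add: \<beta>_def c_def mult.assoc)
  show thesis by (rule that[OF u F[unfolded c_def] 1 2 3])
qed

lemma ellipse_dist_le:
  assumes "P \<in> ellipse F1 F2 \<alpha>" "Q \<in> ellipse F1 F2 \<alpha>"
  shows "dist P Q \<le> 2 * \<alpha>"
  using assms dist_triangle2[of P Q F1] dist_triangle2[of P Q F2] by (simp add: ellipse_def)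

text \<open>The major axis is the diameter of the set. Its end points force the foci onto the axis, and the
  end points of the minor axis then give their distance.\<close>

lemma ellipse_determines_axes:
  fixes F1 F2 G1 G2 :: complex
  assumes F: "dist F1 F2 < 2 * \<alpha>" and G: "dist G1 G2 < 2 * \<beta>" and eq: "ellipse F1 F2 \<alpha> = ellipse G1 G2 \<beta>"
  shows "\<alpha> = \<beta> \<and> dist F1 F2 = dist G1 G2"
proof -
  have le: "\<alpha> \<le> \<beta>" if F: "dist F1 F2 < 2 * \<alpha>" and eq: "ellipse F1 F2 \<alpha> = ellipse G1 G2 \<beta>" for F1 F2 G1 G2 :: complex and \<alpha> \<beta>
  proof -
    have a: "\<alpha> > 0" using F zero_le_dist[of F1 F2] by linarith
    obtain M u where u: "norm u = 1" and "M + of_real \<alpha> * u \<in> ellipse F1 F2 \<alpha>" "M - of_real \<alpha> * u \<in> ellipse F1 F2 \<alpha>"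
      using ellipse_axis_frame[OF F] by metis
    then have "dist (M + of_real \<alpha> * u) (M - of_real \<alpha> * u) \<le> 2 * \<beta>" unfolding eq by - (rule ellipse_dist_le)
    also have "dist (M + of_real \<alpha> * u) (M - of_real \<alpha> * u) = norm (of_real (2 * \<alpha>) * u)"
      unfolding dist_norm by (rule arg_cong[of _ _ norm]) (simp add: algebra_simps)
    finally show ?thesis using u a by (simp add: norm_mult)
  qed
  have ab: "\<alpha> = \<beta>" using le[OF F eq] le[OF G eq[symmetric]] by simp
  have a: "\<alpha> > 0" using F zero_le_dist[of F1 F2] by linarith
  obtain M u where u: "norm u = 1" and P: "M + of_real \<alpha> * u \<in> ellipse F1 F2 \<alpha>" and Q: "M - of_real \<alpha> * u \<in> ellipse F1 F2 \<alpha>"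
    and N: "M + of_real (sqrt (\<alpha>\<^sup>2 - (dist F1 F2 / 2)\<^sup>2)) * (\<i> * u) \<in> ellipse F1 F2 \<alpha>"
    using ellipse_axis_frame[OF F] by metis
  define P where "P = M + of_real \<alpha> * u"
  define Q where "Q = M - of_real \<alpha> * u"
  have PG: "dist P G1 + dist P G2 = 2 * \<alpha>" "dist Q G1 + dist Q G2 = 2 * \<alpha>"
    using P[unfolded eq] Q[unfolded eq] ab by (simp_all add: ellipse_def P_def Q_def)
  have "dist P Q = norm (of_real (2 * \<alpha>) * u)"
    unfolding dist_norm P_def Q_def by (rule arg_cong[of _ _ norm]) (simp add: algebra_simps)
  then have PQ: "dist P Q = 2 * \<alpha>" using u a by (simp add: norm_mult)
  have seg: "\<exists>g. X = M + of_real g * u \<and> \<bar>g\<bar> \<le> \<alpha>" if "dist P Q = dist P X + dist X Q" for X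
  proof -
    have "X \<in> closed_segment P Q" using that by (simp add: between_mem_segment[symmetric] between)
    then obtain s where s: "0 \<le> s" "s \<le> 1" "X = (1 - s) *\<^sub>R P + s *\<^sub>R Q" by (auto simp: in_segment)
    have "X = M + of_real ((1 - 2 * s) * \<alpha>) * u"
      by (simp add: s(3) P_def Q_def scaleR_conv_of_real algebra_simps)
    moreover have "\<bar>(1 - 2 * s) * \<alpha>\<bar> \<le> 1 * \<alpha>" unfolding abs_mult using s a by (intro mult_mono) auto
    ultimately show ?thesis unfolding mult_1 by blast
  qed
  \<comment> \<open>The two right-hand sides add up to \<open>4 * \<alpha>\<close>, twice the length
    of \<open>P Q\<close>, so both triangle inequalities are equalities and each focus lies on the
    segment.\<close>
  have "dist P Q \<le> dist P G1 + dist G1 Q" "dist P Q \<le> dist P G2 + dist G2 Q" by (rule dist_triangle)+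
  then have "dist P Q = dist P G1 + dist G1 Q" "dist P Q = dist P G2 + dist G2 Q"
    using PG PQ by (simp_all add: dist_commute)
  then obtain g h where g: "G1 = M + of_real g * u" "\<bar>g\<bar> \<le> \<alpha>" and h: "G2 = M + of_real h * u" "\<bar>h\<bar> \<le> \<alpha>"
    using seg by metis
  have d: "dist (M + x * u) (M + y * u) = norm (x - y)" for x y
    using u by (simp add: dist_norm norm_mult left_diff_distrib[symmetric])
  have n: "norm (complex_of_real x - of_real y) = \<bar>x - y\<bar>" for x y
    by (simp only: of_real_diff[symmetric] norm_of_real)
  \<comment> \<open>The distance sum at the end \<open>P\<close> reads
    \<open>(\<alpha> - g) + (\<alpha> - h) = 2 * \<alpha>\<close>, so the foci are symmetric about
    \<open>M\<close>.\<close>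
  have gh: "h = - g" using PG(1) unfolding P_def g h d n using g(2) h(2) by linarith
  define c where "c = dist F1 F2 / 2"
  define s where "s = sqrt (\<alpha>\<^sup>2 - c\<^sup>2)"
  have "c\<^sup>2 \<le> \<alpha>\<^sup>2" using F by (intro power_mono) (auto simp: c_def)
  then have s: "s\<^sup>2 + c\<^sup>2 = \<alpha>\<^sup>2" by (simp add: s_def)
  have "M + (of_real s * \<i>) * u \<in> ellipse G1 G2 \<alpha>" using N eq ab by (simp add: s_def c_def mult.assoc)
  then have "norm (of_real s * \<i> - complex_of_real g) + norm (of_real s * \<i> - complex_of_real h) = 2 * \<alpha>"
    unfolding ellipse_def mem_Collect_eq g h d .
  then have "sqrt (s\<^sup>2 + g\<^sup>2) = \<alpha>" by (simp add: gh cmod_def add.commute)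
  then have "s\<^sup>2 + g\<^sup>2 = \<alpha>\<^sup>2" by (metis real_sqrt_pow2 sum_power2_ge_zero)
  then have "g\<^sup>2 = c\<^sup>2" using s by simp
  then have "\<bar>g\<bar> = c" by (metis abs_of_nonneg c_def power2_eq_iff_nonneg abs_ge_zero power2_abs zero_le_dist divide_nonneg_pos zero_less_numeral)
  moreover have "dist G1 G2 = 2 * \<bar>g\<bar>" unfolding g h d n gh by simp
  ultimately show ?thesis using ab by (simp add: c_def)
qed

text \<open>Both semi-axes depend on the foci only through their distance, so it suffices that the
  set determines this distance and the major semi-axis.\<close>

lemma semiaxes_ellipse:
  fixes F1 F2 :: complex
  assumes "dist F1 F2 < 2 * \<alpha>"
  shows "major_semiaxis (ellipse F1 F2 \<alpha>) = \<alpha>"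
    "minor_semiaxis (ellipse F1 F2 \<alpha>) = sqrt (\<alpha>\<^sup>2 - (dist F1 F2 / 2)\<^sup>2)"
proof -
  show "major_semiaxis (ellipse F1 F2 \<alpha>) = \<alpha>" unfolding major_semiaxis_def
    by (rule the_equality) (use ellipse_determines_axes[OF assms] assms in blast)+
  show "minor_semiaxis (ellipse F1 F2 \<alpha>) = sqrt (\<alpha>\<^sup>2 - (dist F1 F2 / 2)\<^sup>2)" unfolding minor_semiaxis_def
  proof (rule the_equality)
    fix b assume "\<exists>G1 G2 \<beta>. dist G1 G2 < 2 * \<beta> \<and> ellipse F1 F2 \<alpha> = ellipse G1 G2 \<beta> \<and> b = sqrt (\<beta>\<^sup>2 - (dist G1 G2 / 2)\<^sup>2)"
    then obtain G1 G2 \<beta> where "dist G1 G2 < 2 * \<beta>" "ellipse F1 F2 \<alpha> = ellipse G1 G2 \<beta>" "b = sqrt (\<beta>\<^sup>2 - (dist G1 G2 / 2)\<^sup>2)" by blast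
    then show "b = sqrt (\<alpha>\<^sup>2 - (dist F1 F2 / 2)\<^sup>2)" using ellipse_determines_axes[OF assms] by metis
  qed (use assms in blast)
qed

section \<open>Similarities and the Cartesian equation of an ellipse\<close>

lemma ellipse_similarity:
  assumes "a \<noteq> 0"
  shows "ellipse (b + a * F1) (b + a * F2) (norm a * \<alpha>) = (\<lambda>z. b + a * z) ` ellipse F1 F2 \<alpha>"
proof -
  have d: "dist (b + a * x) (b + a * y) = norm a * dist x y" for x y
    by (simp add: dist_norm norm_mult right_diff_distrib[symmetric])
  have i: "b + a * z \<in> ellipse (b + a * F1) (b + a * F2) (norm a * \<alpha>) \<longleftrightarrow> z \<in> ellipse F1 F2 \<alpha>" for z
  proof -
    have "b + a * z \<in> ellipse (b + a * F1) (b + a * F2) (norm a * \<alpha>) \<longleftrightarrow>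
      norm a * (dist z F1 + dist z F2) = norm a * (2 * \<alpha>)"
      unfolding ellipse_def mem_Collect_eq d by (simp add: algebra_simps)
    then show ?thesis using assms by (simp add: ellipse_def)
  qed
  show ?thesis
  proof (intro equalityI subsetI)
    fix P assume P: "P \<in> ellipse (b + a * F1) (b + a * F2) (norm a * \<alpha>)"
    have "P = b + a * ((P - b) / a)" using assms by simp
    then show "P \<in> (\<lambda>z. b + a * z) ` ellipse F1 F2 \<alpha>" using P i by (metis image_eqI)
  qed (use i in auto)
qed

text \<open>The squared focal distances differ by \<open>4 * c * y\<close>; together with their sum
  \<open>2 * \<alpha>\<close> this makes each focal distance affine in \<open>y\<close>. Conversely
  the equation bounds \<open>y\<close>, so that these affine expressions are nonnegative and may be
  compared with the distances after squaring.\<close>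

lemma ellipse_vertical:
  assumes \<alpha>: "\<alpha> > 0" and \<beta>: "\<beta> > 0" and c: "c \<ge> 0" and abc: "\<alpha>\<^sup>2 = \<beta>\<^sup>2 + c\<^sup>2"
  shows "ellipse (Complex m (- c)) (Complex m c) \<alpha> = {z. ((Re z - m) / \<beta>)\<^sup>2 + (Im z / \<alpha>)\<^sup>2 = 1}"
proof (intro Collect_cong iffI set_eqI)
  fix z
  define x where "x = Re z - m"
  define y where "y = Im z"
  define d1 where "d1 = dist z (Complex m (- c))"
  define d2 where "d2 = dist z (Complex m c)"
  have sq: "d1\<^sup>2 = x\<^sup>2 + (y + c)\<^sup>2" "d2\<^sup>2 = x\<^sup>2 + (y - c)\<^sup>2"
    unfolding d1_def d2_def dist_norm cmod_power2 by (simp_all add: x_def y_def)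
  have ca: "c < \<alpha>" using abc \<alpha> \<beta> sq_less_iff[of c \<alpha>] c by simp
  have id: "(x\<^sup>2 + (y + c)\<^sup>2 = (\<alpha> + c * y / \<alpha>)\<^sup>2) \<longleftrightarrow> (x / \<beta>)\<^sup>2 + (y / \<alpha>)\<^sup>2 = 1"
    "(x\<^sup>2 + (y - c)\<^sup>2 = (\<alpha> - c * y / \<alpha>)\<^sup>2) \<longleftrightarrow> (x / \<beta>)\<^sup>2 + (y / \<alpha>)\<^sup>2 = 1"
  proof -
    \<comment> \<open>The sign \<open>e\<close>, equal to 1 or -1, treats both foci at once.\<close>
    have k: "(\<alpha> + e * (c * y / \<alpha>))\<^sup>2 - (x\<^sup>2 + (y + e * c)\<^sup>2) = \<beta>\<^sup>2 * (1 - ((x / \<beta>)\<^sup>2 + (y / \<alpha>)\<^sup>2))" if "e\<^sup>2 = 1" for e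
    proof -
      have "(\<alpha> + e * (c * y / \<alpha>))\<^sup>2 = \<alpha>\<^sup>2 + 2 * e * c * y + e\<^sup>2 * (c\<^sup>2 * (y / \<alpha>)\<^sup>2)"
        using \<alpha> by (simp add: power2_eq_square field_simps)
      moreover have "(y + e * c)\<^sup>2 = y\<^sup>2 + 2 * e * c * y + e\<^sup>2 * c\<^sup>2" by (simp add: power2_eq_square algebra_simps)
      moreover have "y\<^sup>2 = \<alpha>\<^sup>2 * (y / \<alpha>)\<^sup>2" "x\<^sup>2 = \<beta>\<^sup>2 * (x / \<beta>)\<^sup>2" using \<alpha> \<beta> by (simp_all add: power_divide)
      moreover have "\<alpha>\<^sup>2 * (y / \<alpha>)\<^sup>2 = \<beta>\<^sup>2 * (y / \<alpha>)\<^sup>2 + c\<^sup>2 * (y / \<alpha>)\<^sup>2" by (simp only: abc distrib_right)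
      ultimately show ?thesis using that abc by (simp add: algebra_simps)
    qed
    have b: "\<beta>\<^sup>2 > 0" using \<beta> by simp
    have z: "u = v \<longleftrightarrow> p = 1" if "v - u = \<beta>\<^sup>2 * (1 - p)" for u v p
      using that b by auto
    show "(x\<^sup>2 + (y + c)\<^sup>2 = (\<alpha> + c * y / \<alpha>)\<^sup>2) \<longleftrightarrow> (x / \<beta>)\<^sup>2 + (y / \<alpha>)\<^sup>2 = 1"
      using z k[of 1] by simp
    show "(x\<^sup>2 + (y - c)\<^sup>2 = (\<alpha> - c * y / \<alpha>)\<^sup>2) \<longleftrightarrow> (x / \<beta>)\<^sup>2 + (y / \<alpha>)\<^sup>2 = 1"
      using z k[of "-1"] by simp
  qed
  {
    assume "z \<in> ellipse (Complex m (- c)) (Complex m c) \<alpha>"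
    then have s: "d1 + d2 = 2 * \<alpha>" by (simp add: ellipse_def d1_def d2_def)
    have "(d1 + d2) * (d1 - d2) = d1\<^sup>2 - d2\<^sup>2" by (simp add: power2_eq_square algebra_simps)
    also have "\<dots> = 4 * c * y" unfolding sq by (simp add: power2_eq_square algebra_simps)
    finally have "\<alpha> * (d1 - d2) = 2 * (c * y)" unfolding s by simp
    then have "d1 - d2 = 2 * (c * y / \<alpha>)" using \<alpha> by (simp add: field_simps)
    then have "d1 = \<alpha> + c * y / \<alpha>" using s by simp
    then have "x\<^sup>2 + (y + c)\<^sup>2 = (\<alpha> + c * y / \<alpha>)\<^sup>2" using sq(1) by simp
    then show "z \<in> {z. ((Re z - m) / \<beta>)\<^sup>2 + (Im z / \<alpha>)\<^sup>2 = 1}" unfolding id by (simp add: x_def y_def)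
  }
  assume "z \<in> {z. ((Re z - m) / \<beta>)\<^sup>2 + (Im z / \<alpha>)\<^sup>2 = 1}"
  then have e: "(x / \<beta>)\<^sup>2 + (y / \<alpha>)\<^sup>2 = 1" by (simp add: x_def y_def)
  have "(y / \<alpha>)\<^sup>2 \<le> 1" using e zero_le_power2[of "x / \<beta>"] by linarith
  then have "\<bar>y / \<alpha>\<bar> \<le> 1" by (simp add: abs_square_le_1)
  then have "\<bar>c * (y / \<alpha>)\<bar> \<le> c * 1" unfolding abs_mult using c by (intro mult_mono) auto
  then have b: "\<bar>c * y / \<alpha>\<bar> < \<alpha>" using ca by simp
  then have nn: "0 \<le> \<alpha> + c * y / \<alpha>" "0 \<le> \<alpha> - c * y / \<alpha>" by linarith+
  have "d1 = \<alpha> + c * y / \<alpha>"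
    by (rule power2_eq_imp_eq[OF _ _ nn(1)]) (use e id(1) sq(1) in \<open>simp_all add: d1_def\<close>)
  moreover have "d2 = \<alpha> - c * y / \<alpha>"
    by (rule power2_eq_imp_eq[OF _ _ nn(2)]) (use e id(2) sq(2) in \<open>simp_all add: d2_def\<close>)
  ultimately show "z \<in> ellipse (Complex m (- c)) (Complex m c) \<alpha>" by (simp add: ellipse_def d1_def d2_def)
qed

section \<open>The Brocard inellipse and the 3-periodics\<close>

text \<open>The projective map that takes the disc \<open>norm v \<le> r\<close>, read as the Klein model, to the disc
  bounded by the Apollonius circle \<open>apo a b r\<close>. It agrees with \<open>mob a b\<close> on the circle \<open>norm v = r\<close>, maps chords to
  chords, and the inellipse is the image of the incircle of the equilateral triangles inscribed in \<open>norm v = r\<close>.\<close>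

definition klein :: "complex \<Rightarrow> complex \<Rightarrow> real \<Rightarrow> complex \<Rightarrow> complex" where
  "klein a b r v = b + a * Complex ((1 - r\<^sup>2) / (1 + r\<^sup>2 - 2 * Re v)) (2 * Im v / (1 + r\<^sup>2 - 2 * Re v))"

definition inellipse :: "complex \<Rightarrow> complex \<Rightarrow> real \<Rightarrow> complex set" where
  "inellipse a b r = klein a b r ` sphere 0 (r / 2)"

lemma klein_den_pos:
  assumes "0 < r" "r < 1" "norm v \<le> r"
  shows "0 < 1 + r\<^sup>2 - 2 * Re v"
proof -
  have "Re v \<le> r" using complex_Re_le_cmod[of v] assms by linarith
  moreover have "(1 - r)\<^sup>2 > 0" using assms by simp
  ultimately show ?thesis by (simp add: power2_eq_square algebra_simps)
qed

text \<open>Expanding \<open>(1 + v) / (1 - v)\<close> by the conjugate denominator gives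
  \<open>1 - (norm v)\<^sup>2 + 2 * \<i> * Im v\<close> over
  \<open>1 + (norm v)\<^sup>2 - 2 * Re v\<close>. Freezing \<open>norm v\<close> at \<open>r\<close>
  makes both affine in \<open>v\<close>, which is the origin of the projective map
  \<open>klein\<close>.\<close>

lemma klein_eq_mob:
  assumes r: "0 < r" "r < 1" and v: "norm v = r"
  shows "klein a b r v = mob a b v"
proof -
  define e where "e = 1 + r\<^sup>2 - 2 * Re v"
  have e: "e > 0" using klein_den_pos[OF r] v by (simp add: e_def)
  have n: "1 - v \<noteq> 0" using r v by auto
  have rv: "r\<^sup>2 = (Re v)\<^sup>2 + (Im v)\<^sup>2" using v by (simp add: cmod_power2[symmetric])
  have "of_real e * (1 + v) = Complex (1 - r\<^sup>2) (2 * Im v) * (1 - v)"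
    unfolding e_def rv by (simp add: complex_eq_iff power2_eq_square algebra_simps)
  then have "1 + v = (Complex (1 - r\<^sup>2) (2 * Im v) / of_real e) * (1 - v)"
    using e by (simp add: field_simps)
  also have "Complex (1 - r\<^sup>2) (2 * Im v) / of_real e = Complex ((1 - r\<^sup>2) / e) (2 * Im v / e)"
    by (simp add: complex_eq_iff)
  finally have "Complex ((1 - r\<^sup>2) / e) (2 * Im v / e) = (1 + v) / (1 - v)" using n by (simp add: nonzero_eq_divide_eq)
  then show ?thesis by (simp add: klein_def mob_def e_def)
qed

lemma klein_inj_on:
  assumes "0 < r" "r < 1" "a \<noteq> 0"
  shows "inj_on (klein a b r) (cball 0 r)"
proof (rule inj_onI)
  fix v w assume "v \<in> cball 0 r" "w \<in> cball 0 r" and eq: "klein a b r v = klein a b r w"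
  then have e: "0 < 1 + r\<^sup>2 - 2 * Re v" "0 < 1 + r\<^sup>2 - 2 * Re w" using klein_den_pos assms by auto
  have p: "1 - r\<^sup>2 > 0" using assms one_minus_sq_pos by blast
  have 1: "(1 - r\<^sup>2) / (1 + r\<^sup>2 - 2 * Re v) = (1 - r\<^sup>2) / (1 + r\<^sup>2 - 2 * Re w)"
    "2 * Im v / (1 + r\<^sup>2 - 2 * Re v) = 2 * Im w / (1 + r\<^sup>2 - 2 * Re w)"
    using eq assms by (simp_all add: klein_def)
  from 1(1) have "1 + r\<^sup>2 - 2 * Re v = 1 + r\<^sup>2 - 2 * Re w" using e p by (simp add: frac_eq_eq)
  then have R: "Re v = Re w" by simp
  then have "Im v = Im w" using 1(2) e by simp
  then show "v = w" using R by (simp add: complex_eq_iff)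
qed

text \<open>A projective map sends segments to segments but rescales the weights of the end points
  by its denominator, here \<open>1 + r\<^sup>2 - 2 * Re v\<close>, which is affine along the
  segment.\<close>

lemma klein_convex_combination:
  assumes r: "0 < r" "r < 1" and v: "norm v \<le> r" "norm w \<le> r" and s: "0 \<le> s" "s \<le> 1"
  shows "klein a b r ((1 - s) *\<^sub>R v + s *\<^sub>R w) =
    (1 - s * (1 + r\<^sup>2 - 2 * Re w) / ((1 - s) * (1 + r\<^sup>2 - 2 * Re v) + s * (1 + r\<^sup>2 - 2 * Re w))) *\<^sub>R klein a b r v +
    (s * (1 + r\<^sup>2 - 2 * Re w) / ((1 - s) * (1 + r\<^sup>2 - 2 * Re v) + s * (1 + r\<^sup>2 - 2 * Re w))) *\<^sub>R klein a b r w"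
proof -
  define e where "e v = 1 + r\<^sup>2 - 2 * Re v" for v
  define E where "E = (1 - s) * e v + s * e w"
  have e0: "e v > 0" "e w > 0" using klein_den_pos r v by (simp_all add: e_def)
  have E: "E > 0"
  proof (cases "s = 0")
    case False then show ?thesis unfolding E_def using e0 s by (intro add_nonneg_pos mult_nonneg_nonneg mult_pos_pos) auto
  qed (use e0 in \<open>simp add: E_def\<close>)
  have lin: "e ((1 - s) *\<^sub>R v + s *\<^sub>R w) = E" by (simp add: e_def E_def algebra_simps)
  define u where "u = s * e w / E"
  have u1: "1 - u = (1 - s) * e v / E" using E by (simp add: u_def E_def field_simps)
  have c: "x / E = (1 - u) * (y / e v) + u * (z / e w)" if "x = (1 - s) * y + s * z" for x y z
    unfolding u1 unfolding u_def that using e0 by (simp add: add_divide_distrib)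
  have "Complex ((1 - r\<^sup>2) / E) (2 * Im ((1 - s) *\<^sub>R v + s *\<^sub>R w) / E) =
    (1 - u) *\<^sub>R Complex ((1 - r\<^sup>2) / e v) (2 * Im v / e v) + u *\<^sub>R Complex ((1 - r\<^sup>2) / e w) (2 * Im w / e w)"
    unfolding complex_eq_iff complex.sel plus_complex.sel scaleR_complex.sel
    by (intro conjI c) (simp_all add: algebra_simps)
  note comb = this
  have aff: "b + a * ((1 - u) *\<^sub>R y + u *\<^sub>R z) = (1 - u) *\<^sub>R (b + a * y) + u *\<^sub>R (b + a * z)" for y z
    by (simp add: scaleR_conv_of_real algebra_simps)
  have "klein a b r ((1 - s) *\<^sub>R v + s *\<^sub>R w) = (1 - u) *\<^sub>R klein a b r v + u *\<^sub>R klein a b r w"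
    unfolding klein_def e_def[symmetric] lin comb by (rule aff)
  then show ?thesis by (simp only: u_def E_def e_def)
qed

lemma klein_image_segment:
  assumes r: "0 < r" "r < 1" and v: "norm v \<le> r" "norm w \<le> r"
  shows "klein a b r ` closed_segment v w = closed_segment (klein a b r v) (klein a b r w)"
proof -
  define p where "p = 1 + r\<^sup>2 - 2 * Re v"
  define q where "q = 1 + r\<^sup>2 - 2 * Re w"
  have pq: "p > 0" "q > 0" using klein_den_pos r v by (simp_all add: p_def q_def)
  have conv: "(1 - s) * x + s * y > 0" if "0 \<le> s" "s \<le> 1" "x > 0" "y > 0" for s x y :: real
  proof (cases "s = 0")
    case False then show ?thesis using that by (intro add_nonneg_pos mult_nonneg_nonneg mult_pos_pos) auto
  qed (use that in simp)
  note k = klein_convex_combination[OF r v, of _ a b, folded p_def q_def]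
  show ?thesis
  proof (intro equalityI subsetI)
    fix P assume "P \<in> klein a b r ` closed_segment v w"
    then obtain s where s: "0 \<le> s" "s \<le> 1" "P = klein a b r ((1 - s) *\<^sub>R v + s *\<^sub>R w)" by (auto simp: in_segment)
    have "0 < (1 - s) * p + s * q" using conv s pq by blast
    moreover have "0 \<le> (1 - s) * p" "0 \<le> s * q" using s pq by simp_all
    ultimately have "0 \<le> s * q / ((1 - s) * p + s * q)" "s * q / ((1 - s) * p + s * q) \<le> 1" by simp_all
    then show "P \<in> closed_segment (klein a b r v) (klein a b r w)" unfolding in_segment s(3) k[OF s(1,2)] by blast
  next
    fix P assume "P \<in> closed_segment (klein a b r v) (klein a b r w)"
    then obtain u where u: "0 \<le> u" "u \<le> 1" "P = (1 - u) *\<^sub>R klein a b r v + u *\<^sub>R klein a b r w" by (auto simp: in_segment)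
    \<comment> \<open>Inverting the change of weights exchanges the two denominators
      \<open>p\<close> and \<open>q\<close>.\<close>
    define s where "s = u * p / ((1 - u) * q + u * p)"
    have d: "0 < (1 - u) * q + u * p" using conv u pq by blast
    moreover have "0 \<le> (1 - u) * q" "0 \<le> u * p" using u pq by simp_all
    ultimately have s: "0 \<le> s" "s \<le> 1" unfolding s_def by simp_all
    have s1: "1 - s = (1 - u) * q / ((1 - u) * q + u * p)" using d by (simp add: s_def field_simps)
    have "(1 - s) * p + s * q = p * q / ((1 - u) * q + u * p)" unfolding s1 unfolding s_def
      by (simp add: add_divide_distrib[symmetric]) (simp add: algebra_simps)
    then have "s * q / ((1 - s) * p + s * q) = u" using pq d by (simp add: s_def)
    then have "P = klein a b r ((1 - s) *\<^sub>R v + s *\<^sub>R w)" using k[OF s] u by simp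
    moreover have "(1 - s) *\<^sub>R v + s *\<^sub>R w \<in> closed_segment v w" unfolding in_segment using s by blast
    ultimately show "P \<in> klein a b r ` closed_segment v w" by (rule image_eqI)
  qed
qed

text \<open>By Stewart's theorem the squared distance to \<open>c\<close> drops below
  \<open>\<rho>\<^sup>2\<close> by \<open>s * (1 - s)\<close> times the squared length of the chord,
  so a point of the closed disc has \<open>s\<close> between 0 and 1.\<close>

lemma line_sphere_segment:
  fixes A B P c :: complex
  assumes "dist c A = \<rho>" "dist c B = \<rho>" "A \<noteq> B" "P \<in> affine hull {A, B}" "dist c P \<le> \<rho>"
  shows "P \<in> closed_segment A B"
proof -
  obtain s where s: "P = A + s *\<^sub>R (B - A)" using assms(4) by (auto simp: affine_hull_2_alt)
  have "(dist c P)\<^sup>2 = (1 - s) * (dist c A)\<^sup>2 + s * (dist c B)\<^sup>2 - s * (1 - s) * (dist A B)\<^sup>2"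
    unfolding s dist_norm cmod_power2 by (simp add: power2_eq_square algebra_simps)
  moreover have "(dist c P)\<^sup>2 \<le> \<rho>\<^sup>2" using assms(5) by (intro power_mono) auto
  ultimately have "0 \<le> s * (1 - s) * (dist A B)\<^sup>2" unfolding assms(1,2) by (simp add: algebra_simps)
  then have "0 \<le> s * (1 - s)" using assms(3) by (simp add: zero_le_mult_iff)
  then have "0 \<le> s" "s \<le> 1" by (auto simp: zero_le_mult_iff)
  moreover have "P = (1 - s) *\<^sub>R A + s *\<^sub>R B" by (simp add: s algebra_simps)
  ultimately show ?thesis by (auto simp: in_segment)
qed

text \<open>Each point of the disc lies on the vertical chord through it. The ends of the chord are
  mapped by \<open>mob a b\<close> to the bounding circle, and the image of the chord is a segment,
  which stays in the convex ball.\<close>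

lemma klein_in_cball:
  assumes r: "0 < r" "r < 1" and a: "a \<noteq> 0" and v: "norm v \<le> r"
  shows "klein a b r v \<in> cball (mob a b (of_real (r\<^sup>2))) (apo_radius a r)"
proof -
  define h where "h = sqrt (r\<^sup>2 - (Re v)\<^sup>2)"
  have "(norm v)\<^sup>2 \<le> r\<^sup>2" using v by (intro power_mono) auto
  then have "(Re v)\<^sup>2 + (Im v)\<^sup>2 \<le> r\<^sup>2" by (simp add: cmod_power2)
  then have h': "(Im v)\<^sup>2 \<le> r\<^sup>2 - (Re v)\<^sup>2" by simp
  then have "0 \<le> r\<^sup>2 - (Re v)\<^sup>2" using zero_le_power2[of "Im v"] by linarith
  then have h: "h\<^sup>2 + (Re v)\<^sup>2 = r\<^sup>2" "\<bar>Im v\<bar> \<le> h"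
    using h' unfolding h_def by (simp_all add: real_le_rsqrt)
  have n: "norm (Complex (Re v) h) = r" "norm (Complex (Re v) (- h)) = r"
    using h(1) r by (simp_all add: cmod_def add.commute)
  have "v \<in> closed_segment (Complex (Re v) (- h)) (Complex (Re v) h)"
  proof (cases "h = 0")
    case True then show ?thesis using h(2) by (simp add: complex_eq_iff)
  next
    case False
    then have "h > 0" using h(2) by linarith
    moreover have "- h \<le> Im v" "Im v \<le> h" using h(2) by linarith+
    then have "0 \<le> Im v + h" "Im v + h \<le> 2 * h" by linarith+
    ultimately show ?thesis unfolding in_segment
      by (intro exI[of _ "(Im v + h) / (2 * h)"]) (simp add: complex_eq_iff field_simps)
  qed
  then have "klein a b r v \<in> closed_segment (klein a b r (Complex (Re v) (- h))) (klein a b r (Complex (Re v) h))"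
    using klein_image_segment[OF r, of "Complex (Re v) (- h)" "Complex (Re v) h" a b] n by auto
  also have "\<dots> \<subseteq> cball (mob a b (of_real (r\<^sup>2))) (apo_radius a r)"
    unfolding klein_eq_mob[OF r n(1)] klein_eq_mob[OF r n(2)]
  proof (rule closed_segment_subset[OF _ _ convex_cball])
    have i: "mob a b z \<in> cball (mob a b (of_real (r\<^sup>2))) (apo_radius a r)" if "norm z = r" for z
      using apo_eq_image[OF r a, of b] that unfolding apo_def by (metis (mono_tags, lifting) imageI mem_Collect_eq sphere_cball subsetD)
    show "mob a b (Complex (Re v) (- h)) \<in> cball (mob a b (of_real (r\<^sup>2))) (apo_radius a r)"
      "mob a b (Complex (Re v) h) \<in> cball (mob a b (of_real (r\<^sup>2))) (apo_radius a r)" using i n by blast+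
  qed
  finally show ?thesis .
qed

text \<open>The norm along the chord is symmetric under the exchange of \<open>s\<close> and
  \<open>1 - s\<close>, so a single common point must be the midpoint. Its distance from 0 is
  \<open>r / 2\<close> exactly for the side length of an inscribed equilateral triangle.\<close>

lemma chord_inter_inner_sphere:
  fixes v w :: complex
  assumes r: "0 < r" and v: "norm v = r" "norm w = r" "v \<noteq> w"
  shows "(\<exists>z. closed_segment v w \<inter> sphere 0 (r / 2) = {z}) \<longleftrightarrow> dist v w = sqrt 3 * r"
proof -
  define L where "L = dist v w"
  have L: "L > 0" using v by (simp add: L_def)
  define f where "f s = (1 - s) *\<^sub>R v + s *\<^sub>R w" for s
  have inj: "f s = f s' \<longleftrightarrow> s = s'" for s s'
  proof -
    have "f s - f s' = (s - s') *\<^sub>R (w - v)" by (simp add: f_def algebra_simps)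
    then show ?thesis using v by (metis eq_iff_diff_eq_0 scaleR_eq_0_iff)
  qed
  have n: "(norm (f s))\<^sup>2 = r\<^sup>2 - s * (1 - s) * L\<^sup>2" for s
  proof -
    have "(norm (f s))\<^sup>2 = (1 - s) * (norm v)\<^sup>2 + s * (norm w)\<^sup>2 - s * (1 - s) * L\<^sup>2"
      unfolding f_def L_def dist_norm cmod_power2 by (simp add: power2_eq_square algebra_simps)
    then show ?thesis unfolding v by (simp add: algebra_simps)
  qed
  have on: "f s \<in> sphere 0 (r / 2) \<longleftrightarrow> s * (1 - s) * L\<^sup>2 = 3 / 4 * r\<^sup>2" for s
  proof -
    have "f s \<in> sphere 0 (r / 2) \<longleftrightarrow> (norm (f s))\<^sup>2 = (r / 2)\<^sup>2" using r by simp
    then show ?thesis unfolding n by (auto simp: power_divide)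
  qed
  have mem: "z \<in> closed_segment v w \<inter> sphere 0 (r / 2) \<longleftrightarrow>
      (\<exists>s. 0 \<le> s \<and> s \<le> 1 \<and> s * (1 - s) * L\<^sup>2 = 3 / 4 * r\<^sup>2 \<and> z = f s)" for z
    unfolding in_segment Int_iff f_def[symmetric] using on by blast
  show ?thesis
  proof
    assume "\<exists>z. closed_segment v w \<inter> sphere 0 (r / 2) = {z}"
    then obtain z where z: "closed_segment v w \<inter> sphere 0 (r / 2) = {z}" by blast
    then obtain s where s: "0 \<le> s" "s \<le> 1" "s * (1 - s) * L\<^sup>2 = 3 / 4 * r\<^sup>2" "z = f s" using mem by blast
    have "f (1 - s) \<in> closed_segment v w \<inter> sphere 0 (r / 2)" unfolding mem
      by (rule exI[of _ "1 - s"]) (use s in \<open>simp add: mult.commute\<close>)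
    then have "f (1 - s) = f s" using z s by blast
    then have s': "s = 1 / 2" by (simp add: inj)
    have "L\<^sup>2 = (sqrt 3 * r)\<^sup>2" using s(3) unfolding s' by (simp add: power_mult_distrib)
    then show "dist v w = sqrt 3 * r" using L r by (simp add: L_def)
  next
    assume "dist v w = sqrt 3 * r"
    then have L2: "L\<^sup>2 = 3 * r\<^sup>2" by (simp add: L_def power_mult_distrib)
    have "s * (1 - s) * L\<^sup>2 = 3 / 4 * r\<^sup>2 \<longleftrightarrow> s = 1 / 2" for s
    proof -
      have "s * (1 - s) * L\<^sup>2 = 3 / 4 * r\<^sup>2 \<longleftrightarrow> 3 * r\<^sup>2 * (s - 1 / 2)\<^sup>2 = 0"
        unfolding L2 by (simp add: power2_eq_square algebra_simps) auto
      then show ?thesis using r by simp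
    qed
    note half = this
    have one: "(\<exists>s. 0 \<le> s \<and> s \<le> 1 \<and> s = c \<and> z = f s) \<longleftrightarrow> z = f c" if "0 \<le> c" "c \<le> 1" for c z
      using that by auto
    have "z \<in> closed_segment v w \<inter> sphere 0 (r / 2) \<longleftrightarrow> z = f (1 / 2)" for z
      unfolding mem half by (rule one) simp_all
    then have "closed_segment v w \<inter> sphere 0 (r / 2) = {f (1 / 2)}" by blast
    then show "\<exists>z. closed_segment v w \<inter> sphere 0 (r / 2) = {z}" by blast
  qed
qed

text \<open>The inellipse lies in the closed disc of \<open>apo a b r\<close>, so the line through
  the two points meets it only within their chord. There \<open>klein\<close> is injective, and
  having exactly one common point is equivalent for the chord and its preimage.\<close>

lemma inellipse_tangent_chord:
  assumes r: "0 < r" "r < 1" and a: "a \<noteq> 0" and v: "norm v = r" "norm w = r" "v \<noteq> w"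
  shows "(\<exists>P\<in>closed_segment (mob a b v) (mob a b w). affine hull {mob a b v, mob a b w} \<inter> inellipse a b r = {P})
    \<longleftrightarrow> dist v w = sqrt 3 * r"
proof -
  define X where "X = closed_segment v w \<inter> sphere 0 (r / 2)"
  have n1: "v \<noteq> 1" "w \<noteq> 1" using r v by auto
  have neq: "mob a b v \<noteq> mob a b w" using mob_inj[OF n1 a] v by blast
  have seg: "closed_segment v w \<subseteq> cball 0 r"
    by (rule closed_segment_subset[OF _ _ convex_cball]) (use v in auto)
  have sph: "sphere 0 (r / 2) \<subseteq> cball (0::complex) r" using r by auto
  note kseg = klein_image_segment[OF r, of v w a b, unfolded klein_eq_mob[OF r v(1)] klein_eq_mob[OF r v(2)]]
  have i: "mob a b z \<in> apo a b r" if "norm z = r" for z using apo_eq_image[OF r a] that by blast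
  have "affine hull {mob a b v, mob a b w} \<inter> inellipse a b r = closed_segment (mob a b v) (mob a b w) \<inter> inellipse a b r"
  proof (intro equalityI subsetI)
    fix P assume P: "P \<in> affine hull {mob a b v, mob a b w} \<inter> inellipse a b r"
    then have "P \<in> cball (mob a b (of_real (r\<^sup>2))) (apo_radius a r)"
      using klein_in_cball[OF r a] sph by (auto simp: inellipse_def)
    then show "P \<in> closed_segment (mob a b v) (mob a b w) \<inter> inellipse a b r"
      using line_sphere_segment[OF _ _ neq, of "mob a b (of_real (r\<^sup>2))" "apo_radius a r" P] i[OF v(1)] i[OF v(2)] P
      by (auto simp: apo_def)
  qed (use convex_hull_subset_affine_hull[of "{mob a b v, mob a b w}"] in \<open>auto simp: segment_convex_hull\<close>)
  also have "\<dots> = klein a b r ` X"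
    using kseg v inj_on_image_Int[OF klein_inj_on[OF r a] seg sph, of b] by (simp add: inellipse_def X_def)
  finally have eq: "affine hull {mob a b v, mob a b w} \<inter> inellipse a b r = klein a b r ` X" .
  have Xs: "X \<subseteq> closed_segment v w" "X \<subseteq> cball 0 r" using seg by (auto simp: X_def)
  have "(\<exists>P\<in>closed_segment (mob a b v) (mob a b w). klein a b r ` X = {P}) \<longleftrightarrow> (\<exists>z. X = {z})"
  proof
    assume "\<exists>P\<in>closed_segment (mob a b v) (mob a b w). klein a b r ` X = {P}"
    then obtain P where P: "klein a b r ` X = {P}" by blast
    then obtain z where z: "z \<in> X" by blast
    have "X = {z}"
    proof (intro equalityI subsetI)
      fix y assume y: "y \<in> X"
      then have "klein a b r y \<in> {P}" "klein a b r z \<in> {P}" using z unfolding P[symmetric] by simp_all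
      then have "klein a b r y = klein a b r z" by simp
      then show "y \<in> {z}" using inj_onD[OF klein_inj_on[OF r a]] y z Xs by blast
    qed (use z in blast)
    then show "\<exists>z. X = {z}" by blast
  next
    assume "\<exists>z. X = {z}"
    then obtain z where z: "X = {z}" by blast
    then have "klein a b r z \<in> klein a b r ` closed_segment v w" using Xs(1) by (intro imageI) blast
    then show "\<exists>P\<in>closed_segment (mob a b v) (mob a b w). klein a b r ` X = {P}"
      unfolding kseg[OF eq_refl[OF v(1)] eq_refl[OF v(2)]] unfolding z by (rule bexI[rotated]) simp
  qed
  then show ?thesis unfolding eq using chord_inter_inner_sphere[OF r(1) v] by (simp add: X_def)
qed

section \<open>The inellipse as an ellipse with the Brocard points as foci\<close>

definition den :: "real \<Rightarrow> real" where "den r = 1 + r\<^sup>2 + r ^ 4"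
definition inell_center :: "real \<Rightarrow> real" where "inell_center r = (1 - r ^ 4) / den r"
definition inell_major :: "real \<Rightarrow> real" where "inell_major r = r / sqrt (den r)"
definition inell_minor :: "real \<Rightarrow> real" where "inell_minor r = r * (1 - r\<^sup>2) / den r"
definition inell_focal :: "real \<Rightarrow> real" where "inell_focal r = sqrt 3 * r\<^sup>2 / den r"

lemma den_pos: "den r > 0"
proof -
  have "r ^ 4 \<ge> 0" by simp
  then show ?thesis using zero_le_power2[of r] unfolding den_def by linarith
qed

text \<open>Substituting the inverse of \<open>klein 1 0 r\<close> into the equation of the circle
  of radius \<open>r / 2\<close> gives the conic \<open>Q X Y = 0\<close>, and completing the square
  in \<open>X\<close> brings it to the form with centre and semi-axes.\<close>

lemma inellipse_canonical:
  assumes r: "0 < r" "r < 1"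
  shows "inellipse 1 0 r = {z. ((Re z - inell_center r) / inell_minor r)\<^sup>2 + (Im z / inell_major r)\<^sup>2 = 1}"
proof -
  have p: "1 - r\<^sup>2 > 0" by (rule one_minus_sq_pos[OF r])
  define Q where "Q X Y = den r * X\<^sup>2 - 2 * (1 - r ^ 4) * X + (1 - r\<^sup>2)\<^sup>2 * (1 + Y\<^sup>2)" for X Y
  have Q1: "((X - inell_center r) / inell_minor r)\<^sup>2 + (Y / inell_major r)\<^sup>2 = 1 \<longleftrightarrow> Q X Y = 0" for X Y
  proof -
    have 1: "(X - inell_center r) / inell_minor r = (den r * X - (1 - r ^ 4)) / (r * (1 - r\<^sup>2))"
      using den_pos[of r] r p by (simp add: inell_center_def inell_minor_def field_simps)
    have 2: "(Y / inell_major r)\<^sup>2 = Y\<^sup>2 * den r / r\<^sup>2"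
    proof -
      have "(inell_major r)\<^sup>2 = r\<^sup>2 / den r" unfolding inell_major_def power_divide
        using den_pos[of r] by simp
      then show ?thesis unfolding power_divide by simp
    qed
    have k: "r\<^sup>2 * (1 - r\<^sup>2)\<^sup>2 > 0" using r p by simp
    have "((X - inell_center r) / inell_minor r)\<^sup>2 + (Y / inell_major r)\<^sup>2 - 1 =
      ((den r * X - (1 - r ^ 4))\<^sup>2 + Y\<^sup>2 * den r * (1 - r\<^sup>2)\<^sup>2 - r\<^sup>2 * (1 - r\<^sup>2)\<^sup>2) / (r\<^sup>2 * (1 - r\<^sup>2)\<^sup>2)"
      unfolding 1 2 unfolding power_divide power_mult_distrib using r p by (simp add: diff_divide_distrib add_divide_distrib)
    also have "(den r * X - (1 - r ^ 4))\<^sup>2 + Y\<^sup>2 * den r * (1 - r\<^sup>2)\<^sup>2 - r\<^sup>2 * (1 - r\<^sup>2)\<^sup>2 = den r * Q X Y"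
      unfolding Q_def den_def by (simp add: power2_eq_square power4_eq_xxxx algebra_simps)
    finally have "((X - inell_center r) / inell_minor r)\<^sup>2 + (Y / inell_major r)\<^sup>2 - 1 = den r * Q X Y / (r\<^sup>2 * (1 - r\<^sup>2)\<^sup>2)" .
    then have "((X - inell_center r) / inell_minor r)\<^sup>2 + (Y / inell_major r)\<^sup>2 = 1 \<longleftrightarrow> den r * Q X Y / (r\<^sup>2 * (1 - r\<^sup>2)\<^sup>2) = 0"
      by linarith
    then show ?thesis using r p den_pos[of r] by auto
  qed
  have Q2: "Q ((1 - r\<^sup>2) / e) (2 * y / e) = 0 \<longleftrightarrow> 4 * (x\<^sup>2 + y\<^sup>2) = r\<^sup>2" if "e = 1 + r\<^sup>2 - 2 * x" "e \<noteq> 0" for e x y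
  proof -
    have "e\<^sup>2 * Q ((1 - r\<^sup>2) / e) (2 * y / e) = den r * (1 - r\<^sup>2)\<^sup>2 - 2 * (1 - r ^ 4) * (1 - r\<^sup>2) * e + (1 - r\<^sup>2)\<^sup>2 * (e\<^sup>2 + 4 * y\<^sup>2)"
    proof -
      have g: "e\<^sup>2 * Q X Y = den r * (e * X)\<^sup>2 - 2 * (1 - r ^ 4) * (e * X) * e + (1 - r\<^sup>2)\<^sup>2 * (e\<^sup>2 + (e * Y)\<^sup>2)" for X Y
        by (simp add: Q_def power_mult_distrib) (simp add: power2_eq_square algebra_simps)
      have e: "e * ((1 - r\<^sup>2) / e) = 1 - r\<^sup>2" "e * (2 * y / e) = 2 * y" using that(2) by simp_all
      show ?thesis unfolding g e by (simp add: power_mult_distrib)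
    qed
    also have "\<dots> = (1 - r\<^sup>2)\<^sup>2 * (4 * (x\<^sup>2 + y\<^sup>2) - r\<^sup>2)"
      unfolding that(1) den_def by (simp add: power2_eq_square power4_eq_xxxx algebra_simps)
    finally have *: "e\<^sup>2 * Q ((1 - r\<^sup>2) / e) (2 * y / e) = (1 - r\<^sup>2)\<^sup>2 * (4 * (x\<^sup>2 + y\<^sup>2) - r\<^sup>2)" .
    have "Q ((1 - r\<^sup>2) / e) (2 * y / e) = 0 \<longleftrightarrow> e\<^sup>2 * Q ((1 - r\<^sup>2) / e) (2 * y / e) = 0" using that(2) by simp
    also have "\<dots> \<longleftrightarrow> 4 * (x\<^sup>2 + y\<^sup>2) = r\<^sup>2" unfolding * using p by auto
    finally show ?thesis .
  qed
  have sph: "v \<in> sphere 0 (r / 2) \<longleftrightarrow> 4 * ((Re v)\<^sup>2 + (Im v)\<^sup>2) = r\<^sup>2" for v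
  proof -
    have "v \<in> sphere 0 (r / 2) \<longleftrightarrow> (norm v)\<^sup>2 = (r / 2)\<^sup>2" using r by simp
    then show ?thesis by (simp add: cmod_power2 power_divide) (simp add: field_simps)
  qed
  have "inellipse 1 0 r = {z. Q (Re z) (Im z) = 0}"
  proof (intro equalityI subsetI CollectI)
    fix z assume "z \<in> inellipse 1 0 r"
    then obtain v where v: "v \<in> sphere 0 (r / 2)" "z = klein 1 0 r v" by (auto simp: inellipse_def)
    have "1 + r\<^sup>2 - 2 * Re v \<noteq> 0" using klein_den_pos[OF r, of v] v r by auto
    then show "Q (Re z) (Im z) = 0" using Q2[OF refl, of "Re v" "Im v"] v(1) sph[of v] by (simp add: v(2) klein_def)
  next
    fix z assume "z \<in> {z. Q (Re z) (Im z) = 0}"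
    then have z: "Q (Re z) (Im z) = 0" by simp
    \<comment> \<open>The imaginary axis corresponds to the vanishing line of the projective map;
      \<open>Q\<close> is positive on it, so the conic misses it and the map can be
      inverted.\<close>
    have X: "Re z \<noteq> 0"
    proof
      assume "Re z = 0"
      then have "(1 - r\<^sup>2)\<^sup>2 * (1 + (Im z)\<^sup>2) = 0" using z by (simp add: Q_def)
      moreover have "1 + (Im z)\<^sup>2 > 0" using zero_le_power2[of "Im z"] by linarith
      ultimately show False using p by simp
    qed
    define e where "e = (1 - r\<^sup>2) / Re z"
    define v where "v = Complex ((1 + r\<^sup>2 - e) / 2) (Im z * e / 2)"
    have e: "e \<noteq> 0" "e = 1 + r\<^sup>2 - 2 * Re v"
    proof -
      show "e \<noteq> 0" using X p by (simp add: e_def)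
      show "e = 1 + r\<^sup>2 - 2 * Re v" by (simp add: v_def field_simps)
    qed
    have zz: "(1 - r\<^sup>2) / e = Re z" "2 * Im v / e = Im z"
    proof -
      show "(1 - r\<^sup>2) / e = Re z" using X p by (simp add: e_def)
      have "2 * Im v = Im z * e" by (simp add: v_def)
      then show "2 * Im v / e = Im z" using e(1) by simp
    qed
    have "v \<in> sphere 0 (r / 2)" unfolding sph using Q2[OF e(2,1), of "Im v"] z unfolding zz by simp
    moreover have "z = klein 1 0 r v" unfolding klein_def e(2)[symmetric] zz by simp
    ultimately show "z \<in> inellipse 1 0 r" by (simp add: inellipse_def)
  qed
  then show ?thesis unfolding Q1 .
qed

lemma inellipse_similarity: "inellipse a b r = (\<lambda>z. b + a * z) ` inellipse 1 0 r"
  unfolding inellipse_def image_image klein_def by simp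

lemma inell_axes:
  assumes r: "0 < r" "r < 1"
  shows "inell_major r > 0" "inell_minor r > 0" "inell_focal r > 0" "inell_focal r < inell_major r"
    "(inell_major r)\<^sup>2 = (inell_minor r)\<^sup>2 + (inell_focal r)\<^sup>2"
proof -
  have p: "1 - r\<^sup>2 > 0" by (rule one_minus_sq_pos[OF r])
  show a: "inell_major r > 0" "inell_minor r > 0" "inell_focal r > 0"
    using r p den_pos[of r] by (simp_all add: inell_major_def inell_minor_def inell_focal_def)
  have "(inell_minor r)\<^sup>2 + (inell_focal r)\<^sup>2 = ((r * (1 - r\<^sup>2))\<^sup>2 + 3 * (r\<^sup>2)\<^sup>2) / (den r)\<^sup>2"
    by (simp add: inell_minor_def inell_focal_def power_divide power_mult_distrib add_divide_distrib)
  also have "(r * (1 - r\<^sup>2))\<^sup>2 + 3 * (r\<^sup>2)\<^sup>2 = r\<^sup>2 * den r"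
    by (simp add: den_def power2_eq_square power4_eq_xxxx algebra_simps)
  also have "r\<^sup>2 * den r / (den r)\<^sup>2 = (inell_major r)\<^sup>2"
    using den_pos[of r] by (simp add: inell_major_def power_divide power2_eq_square)
  finally show e: "(inell_major r)\<^sup>2 = (inell_minor r)\<^sup>2 + (inell_focal r)\<^sup>2" by simp
  have "(inell_focal r)\<^sup>2 < (inell_major r)\<^sup>2" unfolding e using a by simp
  then show "inell_focal r < inell_major r" using sq_less_iff a by (metis less_eq_real_def)
qed

lemma mob_canonical: "mob a b w = b + a * mob 1 0 w"
  by (simp add: mob_def)

text \<open>Since \<open>zeta\<close> and \<open>zeta\<^sup>2\<close> differ only in the sign of the
  imaginary part, one computation with \<open>y\<^sup>2 = 3 / 4\<close> gives both foci. Here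
  \<open>den r\<close> arises as the squared norm of the denominator
  \<open>1 - r\<^sup>2 * zeta\<close>.\<close>

lemma brocard_foci:
  assumes r: "0 < r" "r < 1"
  shows "mob 1 0 (of_real (r\<^sup>2) * zeta\<^sup>2) = Complex (inell_center r) (- inell_focal r)"
    "mob 1 0 (of_real (r\<^sup>2) * zeta) = Complex (inell_center r) (inell_focal r)"
proof -
  have *: "mob 1 0 (of_real (r\<^sup>2) * Complex (- 1 / 2) y) = Complex (inell_center r) (2 * r\<^sup>2 * y / den r)"
    if y: "y\<^sup>2 = 3 / 4" for y
  proof -
    define w where "w = of_real (r\<^sup>2) * Complex (- 1 / 2) y"
    have w: "Re w = - r\<^sup>2 / 2" "Im w = r\<^sup>2 * y" unfolding w_def by (simp_all only: Re_of_real_mult Im_of_real_mult) simp_all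
    have "1 - w \<noteq> 0"
    proof
      assume "1 - w = 0"
      then have "Re w = 1" by (simp add: complex_eq_iff)
      then show False using zero_le_power2[of r] unfolding w by linarith
    qed
    moreover have "(1 + w) * of_real (den r) = Complex (1 - r ^ 4) (2 * r\<^sup>2 * y) * (1 - w)"
    proof -
      have yy: "y * y = 3 / 4" "y * (y * x) = 3 / 4 * x" for x
        using y by (simp_all add: power2_eq_square mult.assoc[symmetric])
      show ?thesis
        by (simp add: complex_eq_iff w den_def) (simp add: power2_eq_square power4_eq_xxxx algebra_simps yy)
    qed
    ultimately have "(1 + w) / (1 - w) = Complex (1 - r ^ 4) (2 * r\<^sup>2 * y) / of_real (den r)"
      using den_pos[of r] by (simp add: frac_eq_eq)
    also have "\<dots> = Complex (inell_center r) (2 * r\<^sup>2 * y / den r)"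
      by (simp add: complex_eq_iff inell_center_def)
    finally show ?thesis by (simp add: mob_def w_def)
  qed
  have z: "zeta\<^sup>2 = Complex (- 1 / 2) (- sqrt 3 / 2)" "zeta = Complex (- 1 / 2) (sqrt 3 / 2)"
    unfolding zeta_sq by (simp_all add: zeta_def complex_eq_iff)
  show "mob 1 0 (of_real (r\<^sup>2) * zeta\<^sup>2) = Complex (inell_center r) (- inell_focal r)"
    unfolding z(1) by (subst *) (simp_all add: power_divide inell_focal_def)
  show "mob 1 0 (of_real (r\<^sup>2) * zeta) = Complex (inell_center r) (inell_focal r)"
    unfolding z(2) by (subst *) (simp_all add: power_divide inell_focal_def)
qed

lemma inellipse_eq_ellipse:
  assumes r: "0 < r" "r < 1" and a: "a \<noteq> 0"
  shows "inellipse a b r = ellipse (mob a b (of_real (r\<^sup>2) * zeta\<^sup>2)) (mob a b (of_real (r\<^sup>2) * zeta)) (norm a * inell_major r)"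
  unfolding inellipse_similarity[of a b r] inellipse_canonical[OF r] mob_canonical[of a b] brocard_foci[OF r]
    ellipse_similarity[OF a]
  using inell_axes[OF r] by (subst ellipse_vertical[of _ "inell_minor r"]) auto

lemma foci_dist:
  assumes r: "0 < r" "r < 1"
  shows "dist (mob a b (of_real (r\<^sup>2) * zeta\<^sup>2)) (mob a b (of_real (r\<^sup>2) * zeta)) = 2 * (norm a * inell_focal r)"
proof -
  have "dist (mob a b (of_real (r\<^sup>2) * zeta\<^sup>2)) (mob a b (of_real (r\<^sup>2) * zeta)) =
    norm (a * (Complex (inell_center r) (- inell_focal r) - Complex (inell_center r) (inell_focal r)))"
    unfolding mob_canonical[of a b] brocard_foci[OF r] dist_norm by (simp add: right_diff_distrib)
  also have "Complex (inell_center r) (- inell_focal r) - Complex (inell_center r) (inell_focal r) = Complex 0 (- 2 * inell_focal r)"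
    by (simp add: complex_eq_iff)
  also have "norm (a * \<dots>) = norm a * norm (Complex 0 (- 2 * inell_focal r))" by (rule norm_mult)
  also have "norm (Complex 0 (- 2 * inell_focal r)) = \<bar>- 2 * inell_focal r\<bar>"
    by (simp only: complex_norm zero_power2 add_0 real_sqrt_abs)
  finally show ?thesis using inell_axes(3)[OF r] by simp
qed

lemma semiaxes_inellipse:
  assumes r: "0 < r" "r < 1" and a: "a \<noteq> 0"
  shows "major_semiaxis (inellipse a b r) = norm a * inell_major r"
    "minor_semiaxis (inellipse a b r) = norm a * inell_minor r"
proof -
  have *: "dist (mob a b (of_real (r\<^sup>2) * zeta\<^sup>2)) (mob a b (of_real (r\<^sup>2) * zeta)) < 2 * (norm a * inell_major r)"
    unfolding foci_dist[OF r] using inell_axes(4)[OF r] a by simp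
  show "major_semiaxis (inellipse a b r) = norm a * inell_major r"
    unfolding inellipse_eq_ellipse[OF r a] by (rule semiaxes_ellipse(1)[OF *])
  have "minor_semiaxis (inellipse a b r) = sqrt ((norm a * inell_major r)\<^sup>2 - (norm a * inell_focal r)\<^sup>2)"
    unfolding inellipse_eq_ellipse[OF r a] semiaxes_ellipse(2)[OF *] foci_dist[OF r] by simp
  also have "(norm a * inell_major r)\<^sup>2 - (norm a * inell_focal r)\<^sup>2 = (norm a * inell_minor r)\<^sup>2"
    unfolding power_mult_distrib inell_axes(5)[OF r] by (simp add: algebra_simps)
  finally show "minor_semiaxis (inellipse a b r) = norm a * inell_minor r"
    using inell_axes(2)[OF r] by (simp add: real_sqrt_abs)
qed

text \<open>The quotient \<open>q = w / v\<close> is unimodular at distance \<open>sqrt 3\<close>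
  from 1, which leaves only the real part \<open>- 1 / 2\<close>.\<close>

lemma dist_eq_imp_zeta:
  assumes "norm v = r" "norm w = r" "0 < r" "dist v w = sqrt 3 * r"
  shows "w = v * zeta \<or> w = v * zeta\<^sup>2"
proof -
  define q where "q = w / v"
  have v: "v \<noteq> 0" using assms by auto
  have w: "w = v * q" using v by (simp add: q_def)
  have nq: "norm q = 1" using assms by (simp add: q_def norm_divide)
  have "v - w = v * (1 - q)" by (simp add: w algebra_simps)
  then have "norm (1 - q) = sqrt 3" using assms by (simp add: dist_norm norm_mult)
  then have "(norm (1 - q))\<^sup>2 = 3" "(norm q)\<^sup>2 = 1" using nq by simp_all
  then have "(1 - Re q)\<^sup>2 + (Im q)\<^sup>2 = 3" "(Re q)\<^sup>2 + (Im q)\<^sup>2 = 1" by (simp_all add: cmod_power2)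
  then have R: "Re q = - 1 / 2" and "(Im q)\<^sup>2 = 1 - (Re q)\<^sup>2" by (simp_all add: power2_eq_square algebra_simps)
  then have "(Im q)\<^sup>2 = (sqrt 3 / 2)\<^sup>2" by (simp add: R power_divide)
  then have "Im q = sqrt 3 / 2 \<or> Im q = - (sqrt 3 / 2)" by (simp add: power2_eq_iff)
  then have "q = zeta \<or> q = zeta\<^sup>2" unfolding zeta_sq using R by (auto simp: zeta_def complex_eq_iff)
  then show ?thesis using w by blast
qed

lemma circumscribed_about_inellipse:
  assumes "t \<noteq> 0" "norm t < 1" "a \<noteq> 0"
  shows "circumscribed_about (tri a b t) (inellipse a b (norm t))"
proof -
  have r: "0 < norm t" "norm t < 1" using assms by auto
  have n: "norm (t * zeta) = norm t" "norm (t * zeta\<^sup>2) = norm t" by (simp_all add: norm_mult norm_power)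
  have d: "dist v w = sqrt 3 * norm t" if "v \<in> {t, t * zeta, t * zeta\<^sup>2}" "w \<in> {t, t * zeta, t * zeta\<^sup>2}" "v \<noteq> w" for v w
    using that dist_zeta[of t] by (auto simp: dist_commute)
  show ?thesis unfolding circumscribed_about_def
  proof (intro ballI impI)
    fix A B assume "A \<in> tri a b t" "B \<in> tri a b t" "A \<noteq> B"
    then obtain v w where v: "v \<in> {t, t * zeta, t * zeta\<^sup>2}" "A = mob a b v" and w: "w \<in> {t, t * zeta, t * zeta\<^sup>2}" "B = mob a b w"
      unfolding tri_def by blast
    have vw: "v \<noteq> w" using \<open>A \<noteq> B\<close> v w by blast
    have nv: "norm v = norm t" "norm w = norm t" using v(1) w(1) n by auto
    show "\<exists>P\<in>closed_segment A B. affine hull {A, B} \<inter> inellipse a b (norm t) = {P}"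
      unfolding v(2) w(2) inellipse_tangent_chord[OF r assms(3) nv vw] by (rule d[OF v(1) w(1) vw])
  qed
qed

text \<open>The foci are prescribed, and for given foci a single tangent side fixes the major
  semi-axis, so uniqueness follows from \<open>ellipse_tangent_unique\<close> on one side.\<close>

lemma brocard_inellipse_tri:
  assumes "t \<noteq> 0" "norm t < 1" "a \<noteq> 0"
  shows "brocard_inellipse (tri a b t) = inellipse a b (norm t)"
  unfolding brocard_inellipse_def brocard_tri[OF assms]
proof (rule the_equality)
  let ?F = "mob a b (of_real ((norm t)\<^sup>2) * zeta\<^sup>2)" and ?G = "mob a b (of_real ((norm t)\<^sup>2) * zeta)"
  have r: "0 < norm t" "norm t < 1" using assms by auto
  have "dist ?F ?G < 2 * (norm a * inell_major (norm t))"
    unfolding foci_dist[OF r] using inell_axes(4)[OF r] assms by simp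
  then show "(\<exists>\<alpha>. dist ?F ?G < 2 * \<alpha> \<and> inellipse a b (norm t) = ellipse ?F ?G \<alpha>) \<and>
      circumscribed_about (tri a b t) (inellipse a b (norm t))"
    using inellipse_eq_ellipse[OF r assms(3), of b] circumscribed_about_inellipse[OF assms] by blast
  fix E assume E: "(\<exists>\<alpha>. dist ?F ?G < 2 * \<alpha> \<and> E = ellipse ?F ?G \<alpha>) \<and> circumscribed_about (tri a b t) E"
  then obtain \<alpha> where \<alpha>: "E = ellipse ?F ?G \<alpha>" by blast
  let ?A = "mob a b t" and ?B = "mob a b (t * zeta)"
  have AB: "?A \<in> tri a b t" "?B \<in> tri a b t" "?A \<noteq> ?B" using tri_vertices_neq[OF assms, of b] by (auto simp: tri_def)
  obtain P where P: "affine hull {?A, ?B} \<inter> E = {P}" using E AB unfolding circumscribed_about_def by blast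
  obtain Q where Q: "affine hull {?A, ?B} \<inter> inellipse a b (norm t) = {Q}"
    using circumscribed_about_inellipse[OF assms, of b] AB unfolding circumscribed_about_def by blast
  show "E = inellipse a b (norm t)"
    using ellipse_tangent_unique[OF AB(3) P[unfolded \<alpha>] Q[unfolded inellipse_eq_ellipse[OF r assms(3)]]]
    unfolding \<alpha> inellipse_eq_ellipse[OF r assms(3)] by simp
qed

section \<open>Porisms, their 3-periodics and their attributes\<close>

definition porism :: "complex \<Rightarrow> complex \<Rightarrow> real \<Rightarrow> porism" where
  "porism a b r = (apo a b r, inellipse a b r)"

text \<open>Poncelet closure is visible in the parameters: tangent sides come from chords of length
  \<open>sqrt 3 * r\<close>, so the two sides at one vertex force the other vertices to be its
  rotations by \<open>zeta\<close> and \<open>zeta\<^sup>2\<close>.\<close>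

lemma three_periodics_porism:
  assumes r: "0 < r" "r < 1" and a: "a \<noteq> 0"
  shows "three_periodics (porism a b r) = {tri a b t |t. norm t = r}"
proof (intro equalityI subsetI)
  fix T assume "T \<in> {tri a b t |t. norm t = r}"
  then obtain t where t: "T = tri a b t" "norm t = r" by blast
  then have "t \<noteq> 0" "norm t < 1" using r by auto
  then show "T \<in> three_periodics (porism a b r)"
    using triangle_tri(1)[OF _ _ a, of t b] tri_subset_apo[OF _ _ a, of t b] circumscribed_about_inellipse[OF _ _ a, of t b] t
    by (simp add: three_periodics_def porism_def)
next
  fix T assume "T \<in> three_periodics (porism a b r)"
  then have T: "triangle T" "T \<subseteq> apo a b r" "circumscribed_about T (inellipse a b r)"
    by (simp_all add: three_periodics_def porism_def)
  obtain A B C where ABC: "T = {A, B, C}" "A \<noteq> B" "A \<noteq> C" "B \<noteq> C"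
    using T(1) unfolding triangle_def card_3_iff by blast
  then obtain u v w where u: "A = mob a b u" "norm u = r" and v: "B = mob a b v" "norm v = r" and w: "C = mob a b w" "norm w = r"
    using T(2) unfolding apo_eq_image[OF r a] by auto
  have neq: "u \<noteq> v" "u \<noteq> w" "v \<noteq> w" using ABC u v w by auto
  have "dist u v = sqrt 3 * r"
    using inellipse_tangent_chord[OF r a u(2) v(2) neq(1), of b] T(3) ABC unfolding circumscribed_about_def u(1) v(1) by auto
  moreover have "dist u w = sqrt 3 * r"
    using inellipse_tangent_chord[OF r a u(2) w(2) neq(2), of b] T(3) ABC unfolding circumscribed_about_def u(1) w(1) by auto
  ultimately have "v = u * zeta \<or> v = u * zeta\<^sup>2" "w = u * zeta \<or> w = u * zeta\<^sup>2"
    using dist_eq_imp_zeta r u v w by blast+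
  then have "T = tri a b u" unfolding ABC(1) tri_def u(1) v(1) w(1) using neq(3) by (elim disjE) auto
  then show "T \<in> {tri a b t |t. norm t = r}" using u by blast
qed

lemma porism_attribute_eq:
  assumes r: "0 < r" "r < 1" and a: "a \<noteq> 0" and f: "\<And>t. t \<noteq> 0 \<Longrightarrow> norm t < 1 \<Longrightarrow> norm t = r \<Longrightarrow> f (tri a b t) = x"
  shows "porism_attribute f (porism a b r) = x"
  unfolding porism_attribute_def three_periodics_porism[OF r a]
proof (rule the_equality)
  have f': "f (tri a b t) = x" if "norm t = r" for t using f[of t] that r by auto
  then show "\<forall>T\<in>{tri a b t |t. norm t = r}. f T = x" by blast
  fix y assume y: "\<forall>T\<in>{tri a b t |t. norm t = r}. f T = y"
  \<comment> \<open>An actual 3-periodic keeps the quantifier from being vacuous, in which case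
    every value would qualify.\<close>
  have "norm (complex_of_real r) = r" using r by simp
  then have "f (tri a b (of_real r)) = y" "f (tri a b (of_real r)) = x" using y f' by blast+
  then show "y = x" by simp
qed

lemma porism_attributes:
  assumes r: "0 < r" "r < 1" and a: "a \<noteq> 0"
  shows "porism_attribute isodynamic_point1 (porism a b r) = b + a"
    "porism_attribute isodynamic_point2 (porism a b r) = b - a"
    "porism_attribute beltrami_point1 (porism a b r) = mob a b (zeta\<^sup>2)"
    "porism_attribute beltrami_point2 (porism a b r) = mob a b zeta"
    "porism_attribute brocard_circle (porism a b r) = apo a b (r\<^sup>2)"
    "porism_attribute circumradius (porism a b r) = apo_radius a r"
    "porism_attribute brocard_angle (porism a b r) = brocard_arctan r"
  by (rule porism_attribute_eq[OF r a];
      use a in \<open>simp add: isodynamic_point1_tri isodynamic_point2_tri beltrami_tri brocard_circle_tri circumcircle_tri brocard_tri\<close>)+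

lemma brocard_porism_iff: "brocard_porism \<B> \<longleftrightarrow> (\<exists>a b r. 0 < r \<and> r < 1 \<and> a \<noteq> 0 \<and> \<B> = porism a b r)"
proof
  assume "brocard_porism \<B>"
  then obtain T where T: "triangle T" "\<not> equilateral T" "\<B> = (circumcircle T, brocard_inellipse T)"
    unfolding brocard_porism_def by blast
  obtain a b t where t: "T = tri a b t" "t \<noteq> 0" "norm t < 1" "a \<noteq> 0" using triangle_eq_tri[OF T(1,2)] by blast
  have "\<B> = porism a b (norm t)" using T(3) t by (simp add: porism_def circumcircle_tri brocard_inellipse_tri)
  moreover have "0 < norm t" using t by simp
  ultimately show "\<exists>a b r. 0 < r \<and> r < 1 \<and> a \<noteq> 0 \<and> \<B> = porism a b r" using t by blast
next
  assume "\<exists>a b r. 0 < r \<and> r < 1 \<and> a \<noteq> 0 \<and> \<B> = porism a b r"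
  then obtain a b r where r: "0 < r" "r < 1" and a: "a \<noteq> 0" and B: "\<B> = porism a b r" by blast
  define t where "t = complex_of_real r"
  have t: "t \<noteq> 0" "norm t < 1" "norm t = r" using r by (simp_all add: t_def)
  have "\<B> = (circumcircle (tri a b t), brocard_inellipse (tri a b t))"
    using circumcircle_tri(3)[OF t(1,2) a] brocard_inellipse_tri[OF t(1,2) a] unfolding B porism_def t(3) by simp
  then show "brocard_porism \<B>" unfolding brocard_porism_def
    using triangle_tri(1)[OF t(1,2) a, of b] not_equilateral_tri[OF t(1,2) a, of b] by blast
qed

section \<open>The sequence of porisms\<close>

lemma apo_radius_eq_imp:
  assumes r: "0 < r" "r < 1" "0 < s" "s < 1" and a: "a \<noteq> 0" and eq: "apo_radius a r = apo_radius a s"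
  shows "r = s"
proof -
  have p: "1 - r\<^sup>2 > 0" "1 - s\<^sup>2 > 0" using one_minus_sq_pos r by blast+
  have "2 * r / (1 - r\<^sup>2) = 2 * s / (1 - s\<^sup>2)" using eq a unfolding apo_radius_def mult_cancel_left norm_eq_zero by blast
  then have "r * (1 - s\<^sup>2) = s * (1 - r\<^sup>2)" using p by (simp add: frac_eq_eq)
  then have "(r - s) * (1 + r * s) = 0" by (simp add: power2_eq_square algebra_simps)
  moreover have "1 + r * s > 0" using r by (simp add: add_pos_pos)
  ultimately show ?thesis by simp
qed

lemma apo_radius_strict_mono:
  assumes "0 < r" "r < s" "s < 1" "a \<noteq> 0"
  shows "apo_radius a r < apo_radius a s"
proof -
  have p: "1 - s\<^sup>2 > 0" using one_minus_sq_pos assms by auto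
  have "r\<^sup>2 < s\<^sup>2" using assms by (intro power_strict_mono) auto
  then have "2 * r / (1 - r\<^sup>2) < 2 * s / (1 - s\<^sup>2)" using assms p by (intro frac_less) auto
  then show ?thesis unfolding apo_radius_def using assms(4) by (intro mult_strict_left_mono) simp_all
qed

text \<open>The isodynamic points recover \<open>b + a\<close> and \<open>b - a\<close>, and the
  circumradius recovers \<open>norm t\<close>. Nothing is claimed about \<open>t\<close> itself,
  since multiplying it by \<open>zeta\<close> gives the same triangle.\<close>

lemma tri_eq_imp:
  assumes t: "t \<noteq> 0" "norm t < 1" "a \<noteq> 0" and t': "t' \<noteq> 0" "norm t' < 1" "a' \<noteq> 0"
    and eq: "tri a b t = tri a' b' t'"
  shows "a = a' \<and> b = b' \<and> norm t = norm t'"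
proof -
  have 1: "b + a = b' + a'" "b - a = b' - a'"
    using isodynamic_point1_tri[OF t, of b] isodynamic_point1_tri[OF t', of b']
      isodynamic_point2_tri[OF t, of b] isodynamic_point2_tri[OF t', of b'] eq by simp_all
  have "b = ((b + a) + (b - a)) / 2" by simp
  also have "\<dots> = ((b' + a') + (b' - a')) / 2" unfolding 1 ..
  finally have b: "b = b'" by simp
  have a: "a = a'" using 1(1) unfolding b by simp
  have "apo_radius a (norm t) = apo_radius a (norm t')"
    using circumcircle_tri(2)[OF t, of b] circumcircle_tri(2)[OF t', of b'] eq a by simp
  then have "norm t = norm t'" using apo_radius_eq_imp t t' by simp
  then show ?thesis using a b by blast
qed

text \<open>A candidate has parameters of its own; comparing its squared triangle with the given one
  forces them to share \<open>a\<close> and \<open>b\<close>. The condition compares triangles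
  rather than \<open>u\<^sup>2\<close> with \<open>t\<close>, because \<open>t\<close> is determined
  only up to cube roots of unity.\<close>

lemma anti_second_brocard_iff:
  assumes t: "t \<noteq> 0" "norm t < 1" "a \<noteq> 0"
  shows "is_anti_second_brocard T' (tri a b t) \<longleftrightarrow> (\<exists>u. T' = tri a b u \<and> norm u = sqrt (norm t) \<and> tri a b (u\<^sup>2) = tri a b t)"
proof
  assume "is_anti_second_brocard T' (tri a b t)"
  then have T': "triangle T'" "\<not> equilateral T'" "second_brocard_triangle T' = tri a b t"
    by (simp_all add: is_anti_second_brocard_def)
  obtain a' b' u where u: "T' = tri a' b' u" "u \<noteq> 0" "norm u < 1" "a' \<noteq> 0" using triangle_eq_tri[OF T'(1,2)] by blast
  have "tri a' b' (u\<^sup>2) = tri a b t" using T'(3) second_brocard_triangle_tri[OF u(2-4)] u(1) by simp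
  moreover have "u\<^sup>2 \<noteq> 0" "norm (u\<^sup>2) < 1" using u by (simp_all add: norm_power power_less_one_iff)
  ultimately have "a' = a \<and> b' = b \<and> norm (u\<^sup>2) = norm t" using tri_eq_imp[OF _ _ u(4) t] by blast
  moreover from this have "norm u = sqrt (norm t)" by (metis norm_ge_zero norm_power real_sqrt_unique)
  ultimately show "\<exists>u. T' = tri a b u \<and> norm u = sqrt (norm t) \<and> tri a b (u\<^sup>2) = tri a b t"
    using u(1) \<open>tri a' b' (u\<^sup>2) = tri a b t\<close> by blast
next
  assume "\<exists>u. T' = tri a b u \<and> norm u = sqrt (norm t) \<and> tri a b (u\<^sup>2) = tri a b t"
  then obtain u where u: "T' = tri a b u" "norm u = sqrt (norm t)" "tri a b (u\<^sup>2) = tri a b t" by blast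
  have "u \<noteq> 0" "norm u < 1" using u(2) t by auto
  then show "is_anti_second_brocard T' (tri a b t)" unfolding is_anti_second_brocard_def u(1)
    using triangle_tri(1) not_equilateral_tri second_brocard_triangle_tri t(3) u(3) by simp
qed

text \<open>Taking anti triangles of all 3-periodics gives exactly the family of radius
  \<open>sqrt r\<close>. One common triangle fixes \<open>a\<close>, \<open>b\<close> and the
  radius, so a Brocard porism is determined by its set of 3-periodics.\<close>

lemma is_anti_porism_iff:
  assumes r: "0 < r" "r < 1" and a: "a \<noteq> 0"
  shows "is_anti_porism \<B>' (porism a b r) \<longleftrightarrow> \<B>' = porism a b (sqrt r)"
proof -
  have sr: "0 < sqrt r" "sqrt r < 1" using r by simp_all
  have eq: "{T'. \<exists>T\<in>three_periodics (porism a b r). is_anti_second_brocard T' T} = {tri a b u |u. norm u = sqrt r}"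
  proof (intro equalityI subsetI)
    fix T' assume "T' \<in> {T'. \<exists>T\<in>three_periodics (porism a b r). is_anti_second_brocard T' T}"
    then obtain t where t: "norm t = r" "is_anti_second_brocard T' (tri a b t)"
      unfolding three_periodics_porism[OF r a] by blast
    then show "T' \<in> {tri a b u |u. norm u = sqrt r}" using anti_second_brocard_iff[OF _ _ a, of t T' b] r by auto
  next
    fix T' assume "T' \<in> {tri a b u |u. norm u = sqrt r}"
    then obtain u where u: "T' = tri a b u" "norm u = sqrt r" by blast
    have n: "norm (u\<^sup>2) = r" using u r by (simp add: norm_power)
    then have "u\<^sup>2 \<noteq> 0" "norm (u\<^sup>2) < 1" using r by auto
    then have "is_anti_second_brocard T' (tri a b (u\<^sup>2))"
      using anti_second_brocard_iff[OF _ _ a, of "u\<^sup>2" T' b] u n by metis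
    then show "T' \<in> {T'. \<exists>T\<in>three_periodics (porism a b r). is_anti_second_brocard T' T}"
      unfolding three_periodics_porism[OF r a] using n by blast
  qed
  show ?thesis unfolding is_anti_porism_def eq
  proof
    assume B: "brocard_porism \<B>' \<and> three_periodics \<B>' = {tri a b u |u. norm u = sqrt r}"
    then obtain a' b' r' where r': "0 < r'" "r' < 1" and a': "a' \<noteq> 0" and B': "\<B>' = porism a' b' r'"
      unfolding brocard_porism_iff by blast
    have tp: "{tri a' b' t |t. norm t = r'} = {tri a b u |u. norm u = sqrt r}"
      using B unfolding B' three_periodics_porism[OF r' a'] by blast
    have n: "norm (complex_of_real (sqrt r)) = sqrt r" using r by simp
    then have "tri a b (of_real (sqrt r)) \<in> {tri a' b' t |t. norm t = r'}" unfolding tp by blast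
    then obtain t where t: "tri a b (of_real (sqrt r)) = tri a' b' t" "norm t = r'" by blast
    have "a = a' \<and> b = b' \<and> norm (complex_of_real (sqrt r)) = norm t"
      by (rule tri_eq_imp[OF _ _ a _ _ a' t(1)]) (use n sr t r' in auto)
    then show "\<B>' = porism a b (sqrt r)" unfolding B' using n t by simp
  next
    assume "\<B>' = porism a b (sqrt r)"
    then show "brocard_porism \<B>' \<and> three_periodics \<B>' = {tri a b u |u. norm u = sqrt r}"
      using three_periodics_porism[OF sr a] brocard_porism_iff sr a by blast
  qed
qed

lemma root_two_power_Suc: "root (2 ^ Suc n) r = sqrt (root (2 ^ n) r)"
  by (simp add: sqrt_def real_root_mult_exp)

lemma root_two_power_bounds:
  assumes "0 < r" "r < 1"
  shows "0 < root (2 ^ n) r" "root (2 ^ n) r < 1"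
  using assms by simp_all

text \<open>Since each step is an equivalence, existence and uniqueness of the sequence come
  together; \<open>n\<close> square roots make up the root of index \<open>2 ^ n\<close>.\<close>

lemma anti_porism_sequence_iff:
  assumes r: "0 < r" "r < 1" and a: "a \<noteq> 0"
  shows "anti_porism_sequence (porism a b r) s \<longleftrightarrow> s = (\<lambda>n. porism a b (root (2 ^ n) r))"
proof
  assume s: "anti_porism_sequence (porism a b r) s"
  have "s n = porism a b (root (2 ^ n) r)" for n
  proof (induction n)
    case 0 then show ?case using s by (simp add: anti_porism_sequence_def)
  next
    case (Suc n)
    have "is_anti_porism (s (Suc n)) (porism a b (root (2 ^ n) r))"
      using s Suc by (metis anti_porism_sequence_def)
    then show ?case unfolding is_anti_porism_iff[OF root_two_power_bounds[OF r] a] root_two_power_Suc .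
  qed
  then show "s = (\<lambda>n. porism a b (root (2 ^ n) r))" by blast
next
  assume s: "s = (\<lambda>n. porism a b (root (2 ^ n) r))"
  show "anti_porism_sequence (porism a b r) s" unfolding anti_porism_sequence_def
  proof (intro conjI allI)
    show "s 0 = porism a b r" by (simp add: s)
    fix n show "is_anti_porism (s (Suc n)) (s n)"
      unfolding s is_anti_porism_iff[OF root_two_power_bounds[OF r] a] root_two_power_Suc ..
  qed
qed

section \<open>Monotonicity and limits\<close>

lemma root_two_power_tendsto:
  assumes "0 < r"
  shows "(\<lambda>n. root (2 ^ n) r) \<longlonglongrightarrow> 1"
proof -
  have "filterlim (\<lambda>n. 2 ^ n :: nat) sequentially sequentially"
    by (rule filterlim_subseq) (simp add: strict_mono_Suc_iff)
  from filterlim_compose[OF LIMSEQ_root_const[OF assms] this] show ?thesis .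
qed

text \<open>The circles are nested because their parameters are concentric. The topological
  \<open>inside\<close> of a circle becomes the open ball as the interior of a convex set with this
  frontier.\<close>

lemma apo_subset_inside:
  assumes "0 < r" "r < s" "s < 1" "a \<noteq> 0"
  shows "apo a b r \<subseteq> inside (apo a b s)"
proof -
  define c where "c = mob a b (of_real (s\<^sup>2))"
  have "apo a b r \<subseteq> ball c (apo_radius a s)"
  proof
    fix P assume "P \<in> apo a b r"
    then obtain w where w: "P = mob a b w" "norm w = r" using apo_eq_image[of r a b] assms by auto
    then have "w \<noteq> 1" using assms by auto
    then show "P \<in> ball c (apo_radius a s)" using mob_in_cball_iff(2)[of s w a b] assms w
      by (simp add: c_def dist_commute)
  qed
  moreover have "sphere c (apo_radius a s) = frontier (cball c (apo_radius a s))" by simp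
  then have "inside (sphere c (apo_radius a s)) = interior (cball c (apo_radius a s))"
    by (metis inside_frontier_eq_interior bounded_cball convex_cball)
  ultimately show ?thesis unfolding apo_def c_def[symmetric] by simp
qed

lemma brocard_arctan_strict_antimono:
  assumes "0 < r" "r < s" "s < 1"
  shows "brocard_arctan s < brocard_arctan r"
proof -
  have "r\<^sup>2 < s\<^sup>2" using assms by (intro power_strict_mono) auto
  moreover have "0 < 1 + r\<^sup>2" by (simp add: add_pos_nonneg)
  moreover have "1 - s\<^sup>2 > 0" using one_minus_sq_pos assms by auto
  ultimately have "(1 - s\<^sup>2) / (sqrt 3 * (1 + s\<^sup>2)) < (1 - r\<^sup>2) / (sqrt 3 * (1 + r\<^sup>2))"
    by (intro frac_less) auto
  then show ?thesis by (simp add: brocard_arctan_def arctan_less_iff)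
qed

text \<open>The map \<open>mob 1 0\<close> takes unimodular parameters other than 1 to the imaginary
  axis, so in general the Beltrami points lie on the line through \<open>b\<close> in the direction
  \<open>\<i> * a\<close>, symmetric about \<open>b\<close>.\<close>

lemma beltrami_canonical:
  "mob 1 0 (zeta\<^sup>2) = Complex 0 (- (1 / sqrt 3))" "mob 1 0 zeta = Complex 0 (1 / sqrt 3)"
proof -
  have n: "1 - zeta \<noteq> 0" "1 - zeta\<^sup>2 \<noteq> 0" unfolding zeta_sq by (simp_all add: zeta_def complex_eq_iff)
  have "1 + zeta\<^sup>2 = Complex 0 (- (1 / sqrt 3)) * (1 - zeta\<^sup>2)"
    unfolding zeta_sq by (simp add: zeta_def complex_eq_iff field_simps)
  then show "mob 1 0 (zeta\<^sup>2) = Complex 0 (- (1 / sqrt 3))" using n by (simp add: mob_def)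
  have "1 + zeta = Complex 0 (1 / sqrt 3) * (1 - zeta)"
    by (simp add: zeta_def complex_eq_iff field_simps)
  then show "mob 1 0 zeta = Complex 0 (1 / sqrt 3)" using n by (simp add: mob_def)
qed

lemma segment_beltrami:
  "closed_segment (mob a b (zeta\<^sup>2)) (mob a b zeta) = (\<lambda>z. b + a * z) ` {z. Re z = 0 \<and> \<bar>Im z\<bar> \<le> 1 / sqrt 3}"
proof -
  define k where "k = 1 / sqrt 3"
  have k: "k > 0" by (simp add: k_def)
  have e: "(1 - u) *\<^sub>R (b + a * Complex 0 (- k)) + u *\<^sub>R (b + a * Complex 0 k) = b + a * Complex 0 ((2 * u - 1) * k)" for u
    by (simp add: complex_eq_iff algebra_simps)
  show ?thesis unfolding mob_canonical[of a b] beltrami_canonical k_def[symmetric]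
  proof (intro equalityI subsetI)
    fix P assume "P \<in> closed_segment (b + a * Complex 0 (- k)) (b + a * Complex 0 k)"
    then obtain u where u: "0 \<le> u" "u \<le> 1" "P = b + a * Complex 0 ((2 * u - 1) * k)" unfolding in_segment e by blast
    have "\<bar>(2 * u - 1) * k\<bar> \<le> 1 * k" unfolding abs_mult using u k by (intro mult_mono) auto
    then show "P \<in> (\<lambda>z. b + a * z) ` {z. Re z = 0 \<and> \<bar>Im z\<bar> \<le> k}" using u(3) by auto
  next
    fix P assume "P \<in> (\<lambda>z. b + a * z) ` {z. Re z = 0 \<and> \<bar>Im z\<bar> \<le> k}"
    then obtain z where z: "Re z = 0" "\<bar>Im z\<bar> \<le> k" "P = b + a * z" by blast
    define u where "u = Im z / k / 2 + 1 / 2"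
    have "- k \<le> Im z" "Im z \<le> k" using z(2) by linarith+
    then have "- 1 \<le> Im z / k" "Im z / k \<le> 1" using k by (simp_all add: field_simps)
    then have u: "0 \<le> u" "u \<le> 1" by (simp_all add: u_def)
    have "2 * u - 1 = Im z / k" by (simp add: u_def)
    then have "(2 * u - 1) * k = Im z" using k by simp
    then have "z = Complex 0 ((2 * u - 1) * k)" using z by (simp add: complex_eq_iff)
    then show "P \<in> closed_segment (b + a * Complex 0 (- k)) (b + a * Complex 0 k)" unfolding in_segment e using u z(3) by blast
  qed
qed

lemma dist_beltrami: "dist (mob a b (zeta\<^sup>2)) (mob a b zeta) = norm a * (2 / sqrt 3)"
proof -
  have "dist (mob a b (zeta\<^sup>2)) (mob a b zeta) = norm (a * (Complex 0 (- (1 / sqrt 3)) - Complex 0 (1 / sqrt 3)))"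
    unfolding mob_canonical[of a b] beltrami_canonical dist_norm by (simp add: right_diff_distrib)
  also have "Complex 0 (- (1 / sqrt 3)) - Complex 0 (1 / sqrt 3) = Complex 0 (- (2 / sqrt 3))"
    by (simp add: complex_eq_iff)
  also have "norm (a * Complex 0 (- (2 / sqrt 3))) = norm a * \<bar>- (2 / sqrt 3)\<bar>"
    by (simp only: norm_mult complex_norm zero_power2 add_0 real_sqrt_abs)
  finally show ?thesis by simp
qed

text \<open>This is \<open>(1 - r\<^sup>2)\<^sup>2 \<ge> 0\<close> in disguise. It keeps the
  projection of the inellipse onto the line of the Beltrami points within the segment between
  them.\<close>

lemma inell_major_less:
  assumes "0 < r" "r < 1"
  shows "inell_major r \<le> 1 / sqrt 3"
proof -
  have "0 \<le> (1 - r\<^sup>2)\<^sup>2" by simp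
  then have "3 * r\<^sup>2 \<le> den r" by (simp add: den_def power2_eq_square power4_eq_xxxx algebra_simps)
  then have "sqrt (3 * r\<^sup>2) \<le> sqrt (den r)" by (rule real_sqrt_le_mono)
  then have "sqrt 3 * r \<le> sqrt (den r)" using assms by (simp add: real_sqrt_mult)
  then show ?thesis using den_pos[of r] by (simp add: inell_major_def field_simps)
qed

text \<open>Up to the scale \<open>norm a\<close>, the sum of centre and minor semi-axis bounds the
  displacement across the segment, and the last term bounds the mismatch between the half-lengths of
  ellipse and segment.\<close>

lemma inellipse_hausdorff_dist:
  assumes r: "0 < r" "r < 1" and a: "a \<noteq> 0"
    and e: "norm a * (inell_center r + inell_minor r + \<bar>1 - sqrt 3 * inell_major r\<bar>) < e"
  shows "inellipse a b r \<subseteq> (\<Union>x\<in>closed_segment (mob a b (zeta\<^sup>2)) (mob a b zeta). ball x e)"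
    "closed_segment (mob a b (zeta\<^sup>2)) (mob a b zeta) \<subseteq> (\<Union>x\<in>inellipse a b r. ball x e)"
proof -
  define m where "m = inell_center r"
  define \<alpha> where "\<alpha> = inell_major r"
  define \<beta> where "\<beta> = inell_minor r"
  have ab: "\<alpha> > 0" "\<beta> > 0" using inell_axes[OF r] by (simp_all add: \<alpha>_def \<beta>_def)
  have "r ^ 4 \<le> 1" using r by (intro power_le_one) auto
  then have m: "m \<ge> 0" using den_pos[of r] by (simp add: m_def inell_center_def)
  define d where "d = m + \<beta> + \<bar>1 - sqrt 3 * \<alpha>\<bar>"
  have d: "norm a * d < e" using e by (simp add: d_def m_def \<alpha>_def \<beta>_def)
  have E: "inellipse a b r = (\<lambda>z. b + a * z) ` {z. ((Re z - m) / \<beta>)\<^sup>2 + (Im z / \<alpha>)\<^sup>2 = 1}"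
    unfolding inellipse_similarity[of a b r] inellipse_canonical[OF r] m_def \<alpha>_def \<beta>_def ..
  have close: "dist (b + a * x) (b + a * y) < e" if "norm (x - y) \<le> d" for x y
  proof -
    have "dist (b + a * x) (b + a * y) = norm a * norm (x - y)"
      by (simp add: dist_norm norm_mult[symmetric] right_diff_distrib)
    also have "\<dots> \<le> norm a * d" using that by (intro mult_left_mono) auto
    finally show ?thesis using d by linarith
  qed
  have abs1: "\<bar>x\<bar> \<le> 1" if "x\<^sup>2 + y\<^sup>2 = 1" for x y :: real
  proof -
    have "x\<^sup>2 \<le> 1" using that zero_le_power2[of y] by linarith
    then show ?thesis by (simp add: abs_square_le_1)
  qed
  show "inellipse a b r \<subseteq> (\<Union>x\<in>closed_segment (mob a b (zeta\<^sup>2)) (mob a b zeta). ball x e)"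
  proof
    fix P assume "P \<in> inellipse a b r"
    then obtain z where z: "P = b + a * z" "((Re z - m) / \<beta>)\<^sup>2 + (Im z / \<alpha>)\<^sup>2 = 1" unfolding E by blast
    have "\<bar>(Re z - m) / \<beta>\<bar> \<le> 1" "\<bar>Im z / \<alpha>\<bar> \<le> 1" using abs1[OF z(2)] abs1[of "Im z / \<alpha>" "(Re z - m) / \<beta>"] z(2) by auto
    then have b1: "\<bar>Re z - m\<bar> \<le> \<beta>" and b2: "\<bar>Im z\<bar> \<le> \<alpha>" using ab by (simp_all add: abs_divide)
    have "b + a * Complex 0 (Im z) \<in> closed_segment (mob a b (zeta\<^sup>2)) (mob a b zeta)"
      unfolding segment_beltrami using b2 inell_major_less[OF r] by (intro imageI) (simp add: \<alpha>_def)
    moreover have "norm (Complex 0 (Im z) - z) = \<bar>Re z\<bar>"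
    proof -
      have "Complex 0 (Im z) - z = of_real (- Re z)" by (simp add: complex_eq_iff)
      then show ?thesis by (simp only: norm_of_real abs_minus_cancel)
    qed
    then have "norm (Complex 0 (Im z) - z) \<le> d" using b1 m by (simp add: d_def)
    then have "P \<in> ball (b + a * Complex 0 (Im z)) e" using close z(1) by simp
    ultimately show "P \<in> (\<Union>x\<in>closed_segment (mob a b (zeta\<^sup>2)) (mob a b zeta). ball x e)" by blast
  qed
  show "closed_segment (mob a b (zeta\<^sup>2)) (mob a b zeta) \<subseteq> (\<Union>x\<in>inellipse a b r. ball x e)"
  proof
    fix P assume "P \<in> closed_segment (mob a b (zeta\<^sup>2)) (mob a b zeta)"
    then obtain w where w: "P = b + a * w" "Re w = 0" "\<bar>Im w\<bar> \<le> 1 / sqrt 3" unfolding segment_beltrami by blast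
    \<comment> \<open>The position relative to the half-length of the segment; the point is matched
      with the ellipse point of the same relative height on the right half.\<close>
    define y where "y = sqrt 3 * Im w"
    have "\<bar>y\<bar> \<le> 1" using w(3) by (simp add: y_def abs_mult field_simps)
    then have y: "y\<^sup>2 \<le> 1" by (simp add: abs_square_le_1)
    define x where "x = sqrt (1 - y\<^sup>2)"
    have x: "x\<^sup>2 = 1 - y\<^sup>2" "0 \<le> x" "x \<le> 1" using y by (simp_all add: x_def)
    define z where "z = Complex (m + \<beta> * x) (\<alpha> * y)"
    have "b + a * z \<in> inellipse a b r" unfolding E by (intro imageI) (use ab x in \<open>simp add: z_def\<close>)
    moreover have "norm (z - w) \<le> d"
    proof -
      have "norm (z - w) \<le> \<bar>Re (z - w)\<bar> + \<bar>Im (z - w)\<bar>" by (rule cmod_le)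
      also have "\<bar>Re (z - w)\<bar> \<le> m + \<beta>" using w(2) m ab x mult_left_le[of x \<beta>] by (simp add: z_def)
      also have "\<bar>Im (z - w)\<bar> = \<bar>Im w\<bar> * \<bar>1 - sqrt 3 * \<alpha>\<bar>"
      proof -
        have "Im (z - w) = - (Im w * (1 - sqrt 3 * \<alpha>))" by (simp add: z_def y_def algebra_simps)
        then show ?thesis by (simp only: abs_minus_cancel abs_mult)
      qed
      also have "\<bar>Im w\<bar> * \<bar>1 - sqrt 3 * \<alpha>\<bar> \<le> 1 * \<bar>1 - sqrt 3 * \<alpha>\<bar>"
      proof (rule mult_right_mono)
        have "1 / sqrt 3 \<le> (1::real)" by (simp add: field_simps)
        then show "\<bar>Im w\<bar> \<le> 1" using w(3) by linarith
      qed simp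
      finally show ?thesis by (simp add: d_def)
    qed
    then have "P \<in> ball (b + a * z) e" using close w(1) by simp
    ultimately show "P \<in> (\<Union>x\<in>inellipse a b r. ball x e)" by blast
  qed
qed

lemma inell_limits:
  assumes "(\<rho> \<longlongrightarrow> 1) F"
  shows "((\<lambda>n. inell_major (\<rho> n)) \<longlongrightarrow> 1 / sqrt 3) F" "((\<lambda>n. inell_minor (\<rho> n)) \<longlongrightarrow> 0) F"
    "((\<lambda>n. inell_center (\<rho> n)) \<longlongrightarrow> 0) F" "((\<lambda>n. brocard_arctan (\<rho> n)) \<longlongrightarrow> 0) F"
proof -
  have d: "((\<lambda>n. den (\<rho> n)) \<longlongrightarrow> 1 + 1\<^sup>2 + 1 ^ 4) F" unfolding den_def by (intro tendsto_intros assms)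
  have "((\<lambda>n. inell_major (\<rho> n)) \<longlongrightarrow> 1 / sqrt (1 + 1\<^sup>2 + 1 ^ 4)) F" unfolding inell_major_def
    by (intro tendsto_intros assms d) simp
  then show "((\<lambda>n. inell_major (\<rho> n)) \<longlongrightarrow> 1 / sqrt 3) F" by simp
  have "((\<lambda>n. inell_minor (\<rho> n)) \<longlongrightarrow> 1 * (1 - 1\<^sup>2) / (1 + 1\<^sup>2 + 1 ^ 4)) F" unfolding inell_minor_def
    by (intro tendsto_intros assms d) simp
  then show "((\<lambda>n. inell_minor (\<rho> n)) \<longlongrightarrow> 0) F" by simp
  have "((\<lambda>n. inell_center (\<rho> n)) \<longlongrightarrow> (1 - 1 ^ 4) / (1 + 1\<^sup>2 + 1 ^ 4)) F" unfolding inell_center_def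
    by (intro tendsto_intros assms d) simp
  then show "((\<lambda>n. inell_center (\<rho> n)) \<longlongrightarrow> 0) F" by simp
  have "((\<lambda>n. brocard_arctan (\<rho> n)) \<longlongrightarrow> arctan ((1 - 1\<^sup>2) / (sqrt 3 * (1 + 1\<^sup>2)))) F" unfolding brocard_arctan_def
    by (intro tendsto_intros assms) simp
  then show "((\<lambda>n. brocard_arctan (\<rho> n)) \<longlongrightarrow> 0) F" by simp
qed

lemma apo_radius_at_top:
  assumes "\<rho> \<longlonglongrightarrow> 1" "\<And>n. 0 < \<rho> n" "\<And>n. \<rho> n < 1" "a \<noteq> 0"
  shows "filterlim (\<lambda>n. apo_radius a (\<rho> n)) at_top sequentially"
proof -
  have 1: "(\<lambda>n. 1 - (\<rho> n)\<^sup>2) \<longlonglongrightarrow> 1 - 1\<^sup>2" by (intro tendsto_intros assms)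
  have 2: "(\<lambda>n. norm a * (2 * \<rho> n)) \<longlonglongrightarrow> norm a * (2 * 1)" by (intro tendsto_intros assms)
  have "filterlim (\<lambda>n. norm a * (2 * \<rho> n) / (1 - (\<rho> n)\<^sup>2)) at_top sequentially"
    by (rule LIM_at_top_divide[OF 2]) (use 1 assms one_minus_sq_pos in auto)
  then show ?thesis by (simp add: apo_radius_def)
qed

theorem proposition4:
  fixes \<B> :: porism and X15 X16 P2 U2 :: complex
  assumes "brocard_porism \<B>"
    and "X15 = porism_attribute isodynamic_point1 \<B>"
    and "X16 = porism_attribute isodynamic_point2 \<B>"
    and "P2 = porism_attribute beltrami_point1 \<B>"
    and "U2 = porism_attribute beltrami_point2 \<B>"
  shows "(\<exists>!s. anti_porism_sequence \<B> s) \<and>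
    (\<forall>s. anti_porism_sequence \<B> s \<longrightarrow>
      (\<forall>n. \<forall>T\<in>three_periodics (s n). \<exists>T'. is_anti_second_brocard T' T) \<and>
      (\<forall>n. porism_attribute isodynamic_point1 (s n) = X15 \<and>
           porism_attribute isodynamic_point2 (s n) = X16) \<and>
      (\<forall>n. porism_attribute brocard_circle (s n)
             \<subseteq> inside (porism_attribute brocard_circle (s (Suc n)))) \<and>
      hausdorff_converges (\<lambda>n. snd (s n)) (closed_segment P2 U2) \<and>
      (\<lambda>n. 2 * major_semiaxis (snd (s n))) \<longlonglongrightarrow> dist P2 U2 \<and>
      (\<lambda>n. minor_semiaxis (snd (s n))) \<longlonglongrightarrow> 0 \<and>
      strict_mono (\<lambda>n. porism_attribute circumradius (s n)) \<and>
      filterlim (\<lambda>n. porism_attribute circumradius (s n)) at_top sequentially \<and>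
      (\<forall>n. porism_attribute brocard_angle (s (Suc n)) < porism_attribute brocard_angle (s n)) \<and>
      (\<lambda>n. porism_attribute brocard_angle (s n)) \<longlonglongrightarrow> 0)"
proof -
  obtain a b r where r: "0 < r" "r < 1" and a: "a \<noteq> 0" and B: "\<B> = porism a b r"
    using assms(1) unfolding brocard_porism_iff by blast
  define \<rho> where "\<rho> n = root (2 ^ n) r" for n
  have \<rho>: "0 < \<rho> n" "\<rho> n < 1" for n using root_two_power_bounds[OF r] by (simp_all add: \<rho>_def)
  have Suc: "\<rho> (Suc n) = sqrt (\<rho> n)" for n unfolding \<rho>_def by (rule root_two_power_Suc)
  have less: "\<rho> n < \<rho> (Suc n)" for n
  proof -
    have "\<rho> (Suc n) * \<rho> (Suc n) = \<rho> n" using \<rho>(1)[of n] by (simp add: Suc)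
    then show ?thesis using mult_strict_left_mono[OF \<rho>(2) \<rho>(1), of "Suc n" "Suc n"] by simp
  qed
  have lim: "\<rho> \<longlonglongrightarrow> 1" unfolding \<rho>_def by (rule root_two_power_tendsto[OF r(1)])
  note limits = inell_limits[OF lim]
  have P2: "P2 = mob a b (zeta\<^sup>2)" and U2: "U2 = mob a b zeta" and X15: "X15 = b + a" and X16: "X16 = b - a"
    using assms(2-5) unfolding B porism_attributes[OF r a] by blast+
  define S where "S n = porism a b (\<rho> n)" for n
  have seq: "anti_porism_sequence \<B> s \<longleftrightarrow> s = S" for s
    unfolding B anti_porism_sequence_iff[OF r a] S_def \<rho>_def by auto
  note at = porism_attributes[OF \<rho> a, where b = b, folded S_def]
  have snd: "snd (S n) = inellipse a b (\<rho> n)" for n by (simp add: S_def porism_def)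
  have sub: "\<exists>T'. is_anti_second_brocard T' T" if T: "T \<in> three_periodics (S n)" for T n
  proof -
    obtain t where t: "T = tri a b t" "norm t = \<rho> n"
      using T unfolding S_def three_periodics_porism[OF \<rho> a] by blast
    have "t \<noteq> 0" "norm t < 1" using t(2) \<rho>[of n] by auto
    \<comment> \<open>Any complex square root of \<open>t\<close> yields an anti triangle;
      \<open>csqrt\<close> names one.\<close>
    then have "is_anti_second_brocard (tri a b (csqrt t)) T"
      using anti_second_brocard_iff[OF _ _ a, of t "tri a b (csqrt t)" b] unfolding t(1)
      by (metis norm_csqrt power2_csqrt)
    then show ?thesis by blast
  qed
  \<comment> \<open>By \<open>\<rho> (Suc n)\<^sup>2 = \<rho> n\<close>, the Brocard circle of each
    new porism is the circumcircle of the previous one.\<close>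
  have nest: "apo a b ((\<rho> n)\<^sup>2) \<subseteq> inside (apo a b ((\<rho> (Suc n))\<^sup>2))" for n
  proof (rule apo_subset_inside[OF _ _ _ a])
    show "(\<rho> n)\<^sup>2 < (\<rho> (Suc n))\<^sup>2" using less \<rho>(1)[of n] by (intro power_strict_mono) auto
    show "(\<rho> (Suc n))\<^sup>2 < 1" using one_minus_sq_pos[OF \<rho>, of "Suc n"] by simp
    show "0 < (\<rho> n)\<^sup>2" using \<rho>(1)[of n] by simp
  qed
  have haus: "hausdorff_converges (\<lambda>n. inellipse a b (\<rho> n)) (closed_segment P2 U2)"
    unfolding hausdorff_converges_def P2 U2
  proof (intro allI impI)
    fix e :: real assume "e > 0"
    have "(\<lambda>n. norm a * (inell_center (\<rho> n) + inell_minor (\<rho> n) + \<bar>1 - sqrt 3 * inell_major (\<rho> n)\<bar>))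
      \<longlonglongrightarrow> norm a * (0 + 0 + \<bar>1 - sqrt 3 * (1 / sqrt 3)\<bar>)"
      by (intro tendsto_intros limits)
    then have "(\<lambda>n. norm a * (inell_center (\<rho> n) + inell_minor (\<rho> n) + \<bar>1 - sqrt 3 * inell_major (\<rho> n)\<bar>)) \<longlonglongrightarrow> 0"
      by simp
    from order_tendstoD(2)[OF this \<open>e > 0\<close>]
    show "\<forall>\<^sub>F n in sequentially. inellipse a b (\<rho> n) \<subseteq> (\<Union>x\<in>closed_segment (mob a b (zeta\<^sup>2)) (mob a b zeta). ball x e) \<and>
        closed_segment (mob a b (zeta\<^sup>2)) (mob a b zeta) \<subseteq> (\<Union>x\<in>inellipse a b (\<rho> n). ball x e)"
      by (rule eventually_mono) (intro conjI inellipse_hausdorff_dist[OF \<rho> a])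
  qed
  \<comment> \<open>The semi-axis tends to \<open>norm a / sqrt 3\<close>, half the distance of the
    Beltrami points, so it is the full major axis that tends to \<open>dist P2 U2\<close>.\<close>
  have major: "(\<lambda>n. 2 * (norm a * inell_major (\<rho> n))) \<longlonglongrightarrow> dist P2 U2"
  proof -
    have "(\<lambda>n. 2 * (norm a * inell_major (\<rho> n))) \<longlonglongrightarrow> 2 * (norm a * (1 / sqrt 3))"
      by (intro tendsto_intros limits)
    also have "2 * (norm a * (1 / sqrt 3)) = norm a * (2 / sqrt 3)" by simp
    finally show ?thesis unfolding P2 U2 dist_beltrami .
  qed
  have minor: "(\<lambda>n. norm a * inell_minor (\<rho> n)) \<longlonglongrightarrow> 0" by (rule tendsto_mult_right_zero[OF limits(2)])
  show ?thesis unfolding seq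
    by (simp add: at snd X15 X16 semiaxes_inellipse[OF \<rho> a] sub nest haus major minor limits(4)
        strict_mono_Suc_iff apo_radius_strict_mono[OF \<rho>(1) less \<rho>(2) a] apo_radius_at_top[OF lim \<rho> a]
        brocard_arctan_strict_antimono[OF \<rho>(1) less \<rho>(2)])
qed

end
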